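(* Let $N\geq 2M-1$ and let $k_1,\ldots,k_N$ be integers with $1\leq k_i\leq M-1$ for all $i$. Then for a generic collection $\Phi=(P_1,\ldots,P_N)$ of orthogonal projections of $\mathbb{R}^M$ of ranks $k_1,\ldots,k_N$ respectively, the map $\mathcal{A}_\Phi$ is injective. That is, there is a non-empty Zariski open subset of the product $\prod_{i=1}^N\mathrm{Gr}(k_i,\mathbb{R}^M)$ of real Grassmannians, whose complement has strictly smaller dimension than the product, such that $\mathcal{A}_\Phi$ is injective for every $\Phi$ corresponding to a point of this open subset.
   Context: $\langle\cdot,\cdot\rangle$ is the standard inner product on $\mathbb{R}^M$. For a tuple $\Phi=(P_1,\ldots,P_N)$ of orthogonal projections of $\mathbb{R}^M$, the map $\mathcal{A}_\Phi\colon(\mathbb{R}^M\smallsetminus\{0\})/\pm1\to\mathbb{R}_{\geq0}^N$ is defined by $x\mapsto(\langle P_1x,P_1x\rangle,\ldots,\langle P_Nx,P_Nx\rangle)$, where $(\mathbb{R}^M\smallsetminus\{0\})/\pm1$ identifies $x$ with $-x$. The real Grassmannian $\mathrm{Gr}(k,\mathbb{R}^M)$ of $k$-dimensional subspaces of $\mathbb{R}^M$ is regarded as a real affine algebraic set by identifying a subspace with the orthogonal projection onto it, i.e. as the set of real $M\times M$ matrices $P$ with $P^2=P$, $P=P^t$, $\operatorname{trace}(P)=k$; it has real dimension $k(M-k)$. The dimension of a real (semi-)algebraic set is its usual dimension (the maximal dimension of a cell in a decomposition into finitely many pieces semi-algebraically homeomorphic to open hypercubes). *)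

theory Defs
  imports "HOL-Analysis.Analysis"
begin

text \<open>Measurement maps.  A collection of \<open>N\<close> matrices of size \<open>M \<times> M\<close> has type
  \<open>real ^ 'm ^ 'm ^ 'n\<close>, where \<open>M = CARD('m)\<close> and \<open>N = CARD('n)\<close>.\<close>

definition sign_rel :: "('a::real_vector \<times> 'a) set" where
  "sign_rel = {(x, y). x \<noteq> 0 \<and> (y = x \<or> y = - x)}"

definition nonzero_mod_sign :: "'a::real_vector set set" where
  "nonzero_mod_sign = (UNIV - {0}) // sign_rel"

definition measurements :: "real ^ 'm ^ 'm ^ 'n \<Rightarrow> real ^ 'm \<Rightarrow> real ^ 'n" where
  "measurements \<Phi> x = (\<chi> i. (\<Phi> $ i *v x) \<bullet> (\<Phi> $ i *v x))"

text \<open>The map induced on sign classes: \<open>measurements \<Phi>\<close> is constant on each class \<open>X\<close>, and the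
  value at \<open>X\<close> is that constant (see \<open>measurement_map_class\<close> below).\<close>

definition measurement_map :: "real ^ 'm ^ 'm ^ 'n \<Rightarrow> (real ^ 'm) set \<Rightarrow> real ^ 'n" where
  "measurement_map \<Phi> X = the_elem (measurements \<Phi> ` X)"

lemma equiv_sign_rel: "equiv (UNIV - {0}) sign_rel"
  by (auto simp: equiv_def refl_on_def sym_def trans_def sign_rel_def)

lemma measurement_map_class:
  assumes "x \<noteq> 0"
  shows "measurement_map \<Phi> (sign_rel `` {x}) = measurements \<Phi> x"
proof -
  have "sign_rel `` {x} = {x, - x}"
    using assms by (auto simp: sign_rel_def)
  moreover have "\<Phi> $ i *v (- x) = - (\<Phi> $ i *v x)" for i
    by (metis matrix_vector_mul_linear linear_neg)
  then have "measurements \<Phi> (- x) = measurements \<Phi> x"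
    by (simp add: measurements_def)
  ultimately show ?thesis
    by (simp add: measurement_map_def)
qed


text \<open>The real Grassmannian as a set of matrices, and products of Grassmannians.\<close>

definition Grassmannian :: "nat \<Rightarrow> (real ^ 'm ^ 'm) set" where
  "Grassmannian k = {P. P ** P = P \<and> P = transpose P \<and> trace P = real k}"

definition Grassmannian_product :: "('n \<Rightarrow> nat) \<Rightarrow> (real ^ 'm ^ 'm ^ 'n) set" where
  "Grassmannian_product k = {\<Phi>. \<forall>i. \<Phi> $ i \<in> Grassmannian (k i)}"


text \<open>The Zariski topology on a subset of a Euclidean space.\<close>

definition Zariski_closed :: "'a::euclidean_space set \<Rightarrow> bool" where
  "Zariski_closed Z \<longleftrightarrow>
     (\<exists>F. (\<forall>f\<in>F. real_polynomial_function f) \<and> Z = {x. \<forall>f\<in>F. f x = 0})"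

definition Zariski_openin :: "'a::euclidean_space set \<Rightarrow> 'a set \<Rightarrow> bool" where
  "Zariski_openin X U \<longleftrightarrow> (\<exists>Z. Zariski_closed Z \<and> U = X - Z)"


text \<open>Semi-algebraic sets, cells and dimension.\<close>

definition basic_semialgebraic :: "'a::euclidean_space set \<Rightarrow> bool" where
  "basic_semialgebraic S \<longleftrightarrow>
     (\<exists>F G. finite F \<and> finite G \<and> (\<forall>f \<in> F \<union> G. real_polynomial_function f) \<and>
        S = {x. (\<forall>f\<in>F. f x = 0) \<and> (\<forall>g\<in>G. g x > 0)})"

definition semialgebraic :: "'a::euclidean_space set \<Rightarrow> bool" where
  "semialgebraic S \<longleftrightarrow> (\<exists>D. finite D \<and> (\<forall>B\<in>D. basic_semialgebraic B) \<and> S = \<Union>D)"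

text \<open>The graph condition makes the inverse semi-algebraic too: its graph is obtained by
  exchanging coordinates.\<close>

definition semialgebraic_homeomorphic ::
    "'a::euclidean_space set \<Rightarrow> 'b::euclidean_space set \<Rightarrow> bool" where
  "semialgebraic_homeomorphic S T \<longleftrightarrow>
     semialgebraic S \<and> semialgebraic T \<and>
     (\<exists>f g. homeomorphism S T f g \<and> semialgebraic ((\<lambda>x. (x, f x)) ` S))"

text \<open>For \<open>B \<subseteq> Basis\<close> with \<open>d\<close> elements this is a copy of \<open>(0,1)\<^sup>d\<close> inside a coordinate
  subspace of \<open>'a\<close>.  A dimension that is a number cannot index a type; no cell is lost by
  using such copies, since by invariance of domain a subset of \<open>'a\<close> is homeomorphic to
  \<open>(0,1)\<^sup>d\<close> only if \<open>d \<le> DIM('a)\<close>.\<close>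

definition open_cube :: "'a::euclidean_space set \<Rightarrow> 'a set" where
  "open_cube B = {x. (\<forall>b\<in>B. 0 < x \<bullet> b \<and> x \<bullet> b < 1) \<and> (\<forall>b \<in> Basis - B. x \<bullet> b = 0)}"

definition semialgebraic_cell :: "nat \<Rightarrow> 'a::euclidean_space set \<Rightarrow> bool" where
  "semialgebraic_cell d C \<longleftrightarrow>
     (\<exists>B\<subseteq>Basis. card B = d \<and> semialgebraic_homeomorphic C (open_cube B :: 'a set))"

definition cell_decomposition :: "'a::euclidean_space set \<Rightarrow> 'a set set \<Rightarrow> bool" where
  "cell_decomposition S D \<longleftrightarrow>
     finite D \<and> partition_on S D \<and> (\<forall>C\<in>D. \<exists>d. semialgebraic_cell d C)"

text \<open>Every semi-algebraic set has a cell decomposition, and the maximal dimension of a cell does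
  not depend on the decomposition, so for semi-algebraic \<open>S\<close> this supremum is the maximal
  dimension of a cell in any one decomposition of \<open>S\<close>.  The empty set has dimension \<open>-\<infinity>\<close>.\<close>

definition semialgebraic_dim :: "'a::euclidean_space set \<Rightarrow> ereal" where
  "semialgebraic_dim S =
     Sup {ereal (real d) | d. \<exists>D. cell_decomposition S D \<and> (\<exists>C\<in>D. semialgebraic_cell d C)}"

end

theory Submission
  imports Defs
begin

text \<open>Write \<open>M\<close> for the dimension of the space and \<open>N\<close> for the number of projections.  If \<open>x\<close> and
  \<open>y\<close> have the same measurements, then \<open>u = x - y\<close> and \<open>v = x + y\<close> satisfy \<open>u \<bullet> P v = 0\<close> for every
  projection \<open>P\<close> of the tuple, and \<open>u\<close>, \<open>v\<close> are both nonzero if \<open>x\<close> and \<open>y\<close> are different modulo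
  sign.  Up to scaling, the pair \<open>(u, v)\<close> has \<open>2 (M - 1)\<close> parameters, while it imposes one condition
  on each of the \<open>N\<close> projections.  So for \<open>N \<ge> 2 M - 1\<close> the tuples without injectivity depend on
  fewer parameters than all tuples.

  The exceptional set has to be Zariski closed, so this count of parameters must produce a polynomial.
  A projection of rank \<open>k\<close> is replaced by an \<open>M \<times> M\<close> matrix \<open>T\<close> of which \<open>k\<close> columns span its image;
  the set \<open>J\<close> of these columns is fixed.  In terms of \<open>T\<close> the bad tuples are finitely many images of
  rational maps in fewer than \<open>N M^2\<close> parameters (\<open>stratum_polynomial\<close>).  More functions than
  parameters satisfy a polynomial relation (\<open>algebraic_dependence\<close>, a comparison of dimensions of
  spaces of polynomials), which gives a nonzero polynomial \<open>q\<close> in \<open>T\<close> that vanishes on all bad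
  tuples (\<open>degenerate_polynomial\<close>).  It is pulled back to the Grassmannians along the polynomial maps
  that replace the columns in \<open>J\<close> of fixed square matrices by their images under the projections.
  The common zero set \<open>Z\<close> of all these pullbacks contains the bad tuples.  It has no interior points in
  the product of Grassmannians, because \<open>T\<close> determines the projections continuously and \<open>q\<close> does not
  vanish on any open set (\<open>generic_injectivity\<close>).

  It remains to compare dimensions, and both bounds come from graph charts: a subspace that projects
  isomorphically onto the coordinates in \<open>J\<close> is the graph of a unique linear map.  The charts make
  the product of Grassmannians a manifold of dimension \<open>d\<close>, the sum of all \<open>k (M - k)\<close>.  By invariance
  of domain, a cell of dimension at least \<open>d\<close> has interior points, so \<open>Z\<close> contains none
  (\<open>semialgebraic_cell_interior\<close>).  On the other hand the product does have a cell decomposition with a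
  cell of dimension \<open>d\<close>, by products of Schubert cells.  A Schubert cell is a coordinate subspace of a
  chart; it is described by explicit polynomial conditions, and so is the graph of its homeomorphism
  with a cube (\<open>semialgebraic_cell_Schubert_cell\<close>).\<close>

section \<open>Polynomial functions\<close>

lemmas real_polynomial_function_basic =
  real_polynomial_function_sum real_polynomial_function_prod real_polynomial_function_power
  real_polynomial_function_diff real_polynomial_function_minus real_polynomial_function.intros(2-4)

lemma real_polynomial_function_inner: "real_polynomial_function (\<lambda>x. x \<bullet> b)"
  by (intro real_polynomial_function.intros(1) bounded_linear_inner_left)

lemma real_polynomial_function_nth [intro]:
  "real_polynomial_function (\<lambda>x::'a::real_normed_vector ^ 'n::finite. f (x $ i))"
  if "real_polynomial_function f"
proof -
  have "polynomial_function (\<lambda>x::'a ^ 'n. x $ i)"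
    by (simp add: bounded_linear_vec_nth polynomial_function_bounded_linear)
  from real_polynomial_function_compose [OF this that] show ?thesis
    by (simp add: o_def)
qed

lemma real_polynomial_function_entry:
  "real_polynomial_function (\<lambda>\<Phi> :: real ^ 'c::finite ^ 'r::finite ^ 'n::finite. \<Phi> $ i $ r $ c)"
proof -
  have "real_polynomial_function (\<lambda>v :: real ^ 'c. v $ c)"
    by (intro real_polynomial_function.intros bounded_linear_vec_nth)
  then have "real_polynomial_function (\<lambda>A :: real ^ 'c ^ 'r. A $ r $ c)"
    by (rule real_polynomial_function_nth [of "\<lambda>v. v $ c"])
  then show ?thesis
    by (rule real_polynomial_function_nth [of "\<lambda>A. A $ r $ c"])
qed

lemma real_polynomial_function_compose_linear:
  assumes "real_polynomial_function p" "bounded_linear l"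
  shows "real_polynomial_function (\<lambda>x. p (l x))"
  using real_polynomial_function_compose [OF polynomial_function_bounded_linear [OF assms(2)] assms(1)]
  by (simp add: o_def)

lemma real_polynomial_function_det:
  assumes "\<And>i j. real_polynomial_function (\<lambda>x. A x $ i $ j)"
  shows "real_polynomial_function (\<lambda>x. det (A x :: real ^ 'm::finite ^ 'm))"
  unfolding det_def
  by (auto intro!: real_polynomial_function_sum real_polynomial_function_prod assms finite_permutations)

lemma real_polynomial_function_matrix_mult:
  assumes "\<And>i j. real_polynomial_function (\<lambda>x. A x $ i $ j)"
    and "\<And>i j. real_polynomial_function (\<lambda>x. B x $ i $ j)"
  shows "real_polynomial_function (\<lambda>x. (A x ** (B x :: real ^ 'm::finite ^ 'm::finite)) $ i $ j)"
  unfolding matrix_matrix_mult_def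
  by (auto intro!: assms)

text \<open>A line from a point of the open set to an arbitrary point reduces this to the finiteness
  of the number of roots in one variable.\<close>

lemma real_polynomial_function_zero_on_open:
  fixes p :: "'a::euclidean_space \<Rightarrow> real"
  assumes p: "real_polynomial_function p" and U: "open U" "x0 \<in> U"
    and zero: "\<And>x. x \<in> U \<Longrightarrow> p x = 0"
  shows "p y = 0"
proof -
  define l where "l t = x0 + t *\<^sub>R (y - x0)" for t :: real
  have "polynomial_function l"
    unfolding l_def
    by (intro polynomial_function_add polynomial_function_const polynomial_function_bounded_linear
        bounded_linear_scaleR_left)
  then have "real_polynomial_function (p \<circ> l)"
    using p by blast
  then obtain a n where a: "p \<circ> l = (\<lambda>t. \<Sum>i\<le>n. a i * t ^ i)"
    using real_polynomial_function_iff_sum by blast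
  have "continuous (at 0) l"
    unfolding l_def by (intro continuous_intros)
  then have "\<forall>\<^sub>F t in at 0. l t \<in> U"
    using U topological_tendstoD [of l "l 0" "at 0" U] unfolding continuous_within
    by (simp add: l_def)
  then obtain e where e: "e > 0" "\<And>t. t \<noteq> 0 \<Longrightarrow> \<bar>t\<bar> < e \<Longrightarrow> l t \<in> U"
    by (auto simp: eventually_at dist_real_def)
  have "{0<..<e} \<subseteq> {t. (\<Sum>i\<le>n. a i * t ^ i) = 0}"
  proof
    fix t assume "t \<in> {0<..<e}"
    then have "p (l t) = 0" using e(2)[of t] zero by auto
    then show "t \<in> {t. (\<Sum>i\<le>n. a i * t ^ i) = 0}"
      using fun_cong [OF a, of t] by simp
  qed
  then have "infinite {t. (\<Sum>i\<le>n. a i * t ^ i) = 0}"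
    using e(1) infinite_super infinite_Ioo by metis
  then have "\<forall>i\<le>n. a i = 0"
    using polyfun_finite_roots [of a n] by blast
  then have "(p \<circ> l) 1 = 0"
    by (simp add: a)
  then show ?thesis
    by (simp add: l_def)
qed

lemma real_polynomial_function_mult_nonzero:
  fixes p q :: "'a::euclidean_space \<Rightarrow> real"
  assumes "real_polynomial_function p" "real_polynomial_function q"
    and "p x \<noteq> 0" "q y \<noteq> 0"
  shows "\<exists>z. p z * q z \<noteq> 0"
proof (rule ccontr)
  assume "\<not> ?thesis"
  then have "q z = 0" if "z \<in> {z. p z \<noteq> 0}" for z
    using that by auto
  moreover have "open {z. p z \<noteq> 0}"
    using assms(1) by (intro open_Collect_neq continuous_on_const continuous_on_polymonial_function)
      (simp_all add: real_polynomial_function_eq)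
  ultimately have "q y = 0"
    using assms by (intro real_polynomial_function_zero_on_open [of q "{z. p z \<noteq> 0}" x y]) auto
  with assms show False by simp
qed

lemma real_polynomial_function_prod_nonzero:
  fixes p :: "'i \<Rightarrow> 'a::euclidean_space \<Rightarrow> real"
  assumes "finite I"
    and "\<And>i. i \<in> I \<Longrightarrow> real_polynomial_function (p i)"
    and "\<And>i. i \<in> I \<Longrightarrow> \<exists>x. p i x \<noteq> 0"
  shows "\<exists>x. (\<Prod>i\<in>I. p i x) \<noteq> 0"
  using assms
proof (induction I)
  case (insert i I)
  then obtain x where "(\<Prod>i\<in>I. p i x) \<noteq> 0"
    by blast
  moreover obtain y where "p i y \<noteq> 0"
    using insert.prems(2) by blast
  moreover have "real_polynomial_function (\<lambda>x. \<Prod>i\<in>I. p i x)"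
    using insert by (intro real_polynomial_function_prod) auto
  ultimately show ?case
    using insert real_polynomial_function_mult_nonzero [of "p i" "\<lambda>x. \<Prod>i\<in>I. p i x" y x] by auto
qed auto

section \<open>Algebraic dependence of rational functions\<close>

text \<open>One equation eliminates one unknown.\<close>

lemma underdetermined_system_solvable:
  fixes A :: "'k \<Rightarrow> 'i \<Rightarrow> real"
  assumes "finite K" "finite I" "card K < card I"
  shows "\<exists>c. (\<exists>i\<in>I. c i \<noteq> 0) \<and> (\<forall>k\<in>K. (\<Sum>i\<in>I. A k i * c i) = 0)"
  using assms
proof (induction K arbitrary: I A)
  case empty
  then have "I \<noteq> {}" by auto
  then show ?case by (intro exI [of _ "\<lambda>_. 1"]) auto
next
  case (insert k K)
  show ?case
  proof (cases "\<forall>i\<in>I. A k i = 0")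
    case True
    obtain c where "(\<exists>i\<in>I. c i \<noteq> 0) \<and> (\<forall>k\<in>K. (\<Sum>i\<in>I. A k i * c i) = 0)"
      using insert.IH [of I A] insert.prems insert.hyps by auto
    with True show ?thesis by (intro exI [of _ c]) auto
  next
    case False
    then obtain i0 where i0: "i0 \<in> I" "A k i0 \<noteq> 0" by auto
    define B where "B l i = A l i - A l i0 * A k i / A k i0" for l i
    obtain c where c: "\<exists>i\<in>I - {i0}. c i \<noteq> 0"
      "\<And>l. l \<in> K \<Longrightarrow> (\<Sum>i\<in>I - {i0}. B l i * c i) = 0"
      using insert.IH [of "I - {i0}" B] insert.prems insert.hyps i0
      by (auto simp del: card_Diff_insert simp: card_Diff_singleton less_diff_conv)
    define d where "d = c(i0 := - (\<Sum>i\<in>I - {i0}. A k i * c i) / A k i0)"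
    have split: "(\<Sum>i\<in>I. A l i * d i) = A l i0 * d i0 + (\<Sum>i\<in>I - {i0}. A l i * c i)" for l
      using insert.prems i0 by (subst sum.remove [of I i0]) (auto simp: d_def)
    have "(\<Sum>i\<in>I. A l i * d i) = 0" if "l \<in> K" for l
    proof -
      have "0 = (\<Sum>i\<in>I - {i0}. A l i * c i - A l i0 / A k i0 * (A k i * c i))"
        unfolding c(2)[OF that, symmetric] B_def by (simp add: algebra_simps)
      also have "\<dots> = (\<Sum>i\<in>I. A l i * d i)"
        unfolding split sum_subtractf sum_distrib_left [symmetric] by (simp add: d_def)
      finally show ?thesis by simp
    qed
    moreover have "(\<Sum>i\<in>I. A k i * d i) = 0"
      unfolding split using i0 by (simp add: d_def)
    moreover have "\<exists>i\<in>I. d i \<noteq> 0"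
      using c(1) by (auto simp: d_def)
    ultimately show ?thesis by auto
  qed
qed

abbreviation exponents :: "'i set \<Rightarrow> nat \<Rightarrow> ('i \<Rightarrow> nat) set" where
  "exponents I e \<equiv> PiE I (\<lambda>_. {..e})"

text \<open>One variable is split off at a time, since a polynomial in one variable that vanishes
  everywhere has no nonzero coefficient.\<close>

lemma monomials_independent:
  fixes c :: "('i \<Rightarrow> nat) \<Rightarrow> real"
  assumes "finite I"
    and "\<And>y. (\<Sum>\<beta>\<in>exponents I e. c \<beta> * (\<Prod>i\<in>I. y i ^ \<beta> i)) = 0"
    and "\<beta> \<in> exponents I e"
  shows "c \<beta> = 0"
  using assms
proof (induction I arbitrary: c \<beta>)
  case empty
  then show ?case by auto
next
  case (insert i I)
  define d where "d y j = (\<Sum>\<gamma>\<in>exponents I e. c (\<gamma>(i := j)) * (\<Prod>l\<in>I. y l ^ \<gamma> l))"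
    for y :: "'i \<Rightarrow> real" and j
  have inj: "inj_on (\<lambda>(j, \<gamma>). \<gamma>(i := j)) ({..e} \<times> exponents I e)"
  proof (rule inj_onI, clarsimp)
    fix j \<gamma> j' \<gamma>'
    assume *: "\<gamma> \<in> exponents I e" "\<gamma>' \<in> exponents I e" "\<gamma>(i := j) = \<gamma>'(i := j')"
    have "j = j'" using fun_cong [OF *(3), of i] by simp
    moreover have "\<gamma> l = \<gamma>' l" for l
      using fun_cong [OF *(3), of l] PiE_arb [OF *(1), of l] PiE_arb [OF *(2), of l] insert.hyps
      by (cases "l = i") auto
    ultimately show "j = j' \<and> \<gamma> = \<gamma>'" by auto
  qed
  have "(\<Sum>j\<le>e. d y j * z ^ j) = 0" for y z
  proof -
    have "0 = (\<Sum>\<beta>\<in>exponents (insert i I) e. c \<beta> * (\<Prod>l\<in>insert i I. (y(i := z)) l ^ \<beta> l))"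
      using insert.prems(1) by simp
    also have "\<dots> = (\<Sum>(j, \<gamma>)\<in>{..e} \<times> exponents I e.
        c (\<gamma>(i := j)) * (\<Prod>l\<in>insert i I. (y(i := z)) l ^ (\<gamma>(i := j)) l))"
      unfolding PiE_insert_eq
      by (subst sum.reindex [OF inj]) (simp add: case_prod_unfold)
    also have "\<dots> = (\<Sum>j\<le>e. \<Sum>\<gamma>\<in>exponents I e. c (\<gamma>(i := j)) * (\<Prod>l\<in>I. y l ^ \<gamma> l) * z ^ j)"
      unfolding sum.cartesian_product [symmetric]
    proof (intro sum.cong refl)
      fix j \<gamma>
      have "(\<Prod>l\<in>I. (y(i := z)) l ^ (\<gamma>(i := j)) l) = (\<Prod>l\<in>I. y l ^ \<gamma> l)"
        using insert.hyps by (intro prod.cong) auto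
      then show "c (\<gamma>(i := j)) * (\<Prod>l\<in>insert i I. (y(i := z)) l ^ (\<gamma>(i := j)) l) =
          c (\<gamma>(i := j)) * (\<Prod>l\<in>I. y l ^ \<gamma> l) * z ^ j"
        using insert.hyps by simp
    qed
    also have "\<dots> = (\<Sum>j\<le>e. d y j * z ^ j)"
      by (simp add: d_def sum_distrib_right)
    finally show ?thesis by simp
  qed
  then have "d y j = 0" if "j \<le> e" for y j
    using Transcendental.polyfun_eq_0 [of "d y" e] that by auto
  then have "c (\<gamma>(i := j)) = 0" if "j \<le> e" "\<gamma> \<in> exponents I e" for j \<gamma>
    using insert.IH [of "\<lambda>\<gamma>. c (\<gamma>(i := j))" \<gamma>] that by (simp add: d_def)
  moreover obtain j \<gamma> where "\<beta> = \<gamma>(i := j)" "j \<le> e" "\<gamma> \<in> exponents I e"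
    using insert.prems(2) unfolding PiE_insert_eq by auto
  ultimately show ?case by blast
qed

text \<open>The degree is bounded in each variable separately: the dimension of the space of such
  polynomials is then a plain power.\<close>

definition polynomial_in :: "('s \<Rightarrow> real) set \<Rightarrow> nat \<Rightarrow> ('s \<Rightarrow> real) \<Rightarrow> bool" where
  "polynomial_in X e f \<longleftrightarrow>
     (\<exists>c. \<forall>s. f s = (\<Sum>\<alpha>\<in>exponents X e. c \<alpha> * (\<Prod>x\<in>X. x s ^ \<alpha> x)))"

lemma polynomial_inI:
  "(\<And>s. f s = (\<Sum>\<alpha>\<in>exponents X e. c \<alpha> * (\<Prod>x\<in>X. x s ^ \<alpha> x))) \<Longrightarrow> polynomial_in X e f"
  unfolding polynomial_in_def by blast

context
  fixes X :: "('s \<Rightarrow> real) set"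
  assumes fin: "finite X"
begin

lemma polynomial_in_sum:
  assumes "\<And>i. i \<in> I \<Longrightarrow> polynomial_in X e (f i)"
  shows "polynomial_in X e (\<lambda>s. \<Sum>i\<in>I. a i * f i s)"
proof -
  have "\<forall>i\<in>I. \<exists>c. \<forall>s. f i s = (\<Sum>\<alpha>\<in>exponents X e. c \<alpha> * (\<Prod>x\<in>X. x s ^ \<alpha> x))"
    using assms unfolding polynomial_in_def by (rule ballI)
  from bchoice [OF this] obtain c where
    c: "\<And>i s. i \<in> I \<Longrightarrow> f i s = (\<Sum>\<alpha>\<in>exponents X e. c i \<alpha> * (\<Prod>x\<in>X. x s ^ \<alpha> x))"
    by blast
  have "(\<Sum>i\<in>I. a i * f i s) =
      (\<Sum>\<alpha>\<in>exponents X e. (\<Sum>i\<in>I. a i * c i \<alpha>) * (\<Prod>x\<in>X. x s ^ \<alpha> x))" for s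
  proof -
    have "(\<Sum>i\<in>I. a i * f i s) =
        (\<Sum>i\<in>I. \<Sum>\<alpha>\<in>exponents X e. a i * c i \<alpha> * (\<Prod>x\<in>X. x s ^ \<alpha> x))"
      by (simp add: c sum_distrib_left mult.assoc)
    also have "\<dots> = (\<Sum>\<alpha>\<in>exponents X e. \<Sum>i\<in>I. a i * c i \<alpha> * (\<Prod>x\<in>X. x s ^ \<alpha> x))"
      by (rule sum.swap)
    finally show ?thesis by (simp add: sum_distrib_right)
  qed
  then show ?thesis
    by (rule polynomial_inI)
qed

lemma polynomial_in_monomial:
  assumes "\<And>x. x \<in> X \<Longrightarrow> \<alpha> x \<le> e"
  shows "polynomial_in X e (\<lambda>s. \<Prod>x\<in>X. x s ^ \<alpha> x)"
proof -
  let ?\<alpha> = "restrict \<alpha> X"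
  have mem: "?\<alpha> \<in> exponents X e" and fin': "finite (exponents X e)"
    using assms fin by (auto intro: finite_PiE)
  show ?thesis
    unfolding polynomial_in_def
  proof (intro exI allI)
    fix s
    have "(\<Sum>\<beta>\<in>exponents X e. (if \<beta> = ?\<alpha> then 1 else 0) * (\<Prod>x\<in>X. x s ^ \<beta> x)) =
        (\<Sum>\<beta>\<in>exponents X e. if \<beta> = ?\<alpha> then (\<Prod>x\<in>X. x s ^ \<beta> x) else 0)"
      by (intro sum.cong) auto
    also have "\<dots> = (\<Prod>x\<in>X. x s ^ ?\<alpha> x)"
      using mem fin' by (simp only: sum.delta if_True)
    also have "\<dots> = (\<Prod>x\<in>X. x s ^ \<alpha> x)"
      by (intro prod.cong) auto
    finally show "(\<Prod>x\<in>X. x s ^ \<alpha> x) =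
        (\<Sum>\<beta>\<in>exponents X e. (if \<beta> = ?\<alpha> then 1 else 0) * (\<Prod>x\<in>X. x s ^ \<beta> x))"
      by (rule sym)
  qed
qed

lemma polynomial_in_const: "polynomial_in X e (\<lambda>_. a)"
proof -
  have "polynomial_in X e (\<lambda>s. \<Prod>x\<in>X. x s ^ 0)"
    by (rule polynomial_in_monomial) simp
  then obtain c where c: "\<And>s. (\<Prod>x\<in>X. x s ^ 0) = (\<Sum>\<alpha>\<in>exponents X e. c \<alpha> * (\<Prod>x\<in>X. x s ^ \<alpha> x))"
    unfolding polynomial_in_def by blast
  have "a = (\<Sum>\<alpha>\<in>exponents X e. (a * c \<alpha>) * (\<Prod>x\<in>X. x s ^ \<alpha> x))" for s
    unfolding mult.assoc sum_distrib_left [symmetric] c [symmetric] by simp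
  then show ?thesis
    by (rule polynomial_inI)
qed

lemma polynomial_in_gen:
  assumes "x \<in> X"
  shows "polynomial_in X 1 x"
proof -
  define \<alpha> where "\<alpha> z = (if z = x then 1 else 0 :: nat)" for z
  have eq: "(\<lambda>s. \<Prod>z\<in>X. z s ^ \<alpha> z) = x"
  proof
    fix s
    have "(\<Prod>z\<in>X. z s ^ \<alpha> z) = (\<Prod>z\<in>X. if z = x then x s else 1)"
      by (rule prod.cong) (simp_all add: \<alpha>_def)
    also have "\<dots> = x s" using assms fin by (simp only: prod.delta if_True)
    finally show "(\<Prod>z\<in>X. z s ^ \<alpha> z) = x s" .
  qed
  have "polynomial_in X 1 (\<lambda>s. \<Prod>z\<in>X. z s ^ \<alpha> z)"
    by (rule polynomial_in_monomial) (simp add: \<alpha>_def)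
  with arg_cong [OF eq, of "polynomial_in X 1"] show ?thesis by (rule iffD1)
qed

lemma polynomial_in_mult:
  assumes "polynomial_in X e f" "polynomial_in X e' g"
  shows "polynomial_in X (e + e') (\<lambda>s. f s * g s)"
proof -
  obtain c where c: "\<And>s. f s = (\<Sum>\<alpha>\<in>exponents X e. c \<alpha> * (\<Prod>x\<in>X. x s ^ \<alpha> x))"
    using assms(1) unfolding polynomial_in_def by blast
  obtain d where d: "\<And>s. g s = (\<Sum>\<alpha>\<in>exponents X e'. d \<alpha> * (\<Prod>x\<in>X. x s ^ \<alpha> x))"
    using assms(2) unfolding polynomial_in_def by blast
  have "(\<lambda>s. f s * g s) = (\<lambda>s. \<Sum>p\<in>exponents X e \<times> exponents X e'.
      (c (fst p) * d (snd p)) * (\<Prod>x\<in>X. x s ^ (fst p x + snd p x)))"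
    unfolding c d sum_product sum.cartesian_product
    by (intro ext sum.cong) (auto simp: power_add prod.distrib)
  from arg_cong [OF this, of "polynomial_in X (e + e')"]
  show ?thesis
  proof (rule iffD2)
    show "polynomial_in X (e + e') (\<lambda>s. \<Sum>p\<in>exponents X e \<times> exponents X e'.
      (c (fst p) * d (snd p)) * (\<Prod>x\<in>X. x s ^ (fst p x + snd p x)))"
      by (intro polynomial_in_sum polynomial_in_monomial) (auto simp: PiE_def Pi_def intro: add_mono)
  qed
qed

lemma polynomial_in_add:
  assumes "polynomial_in X e f" "polynomial_in X e g"
  shows "polynomial_in X e (\<lambda>s. f s + g s)"
proof -
  obtain c where c: "\<And>s. f s = (\<Sum>\<alpha>\<in>exponents X e. c \<alpha> * (\<Prod>x\<in>X. x s ^ \<alpha> x))"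
    using assms(1) unfolding polynomial_in_def by blast
  obtain d where d: "\<And>s. g s = (\<Sum>\<alpha>\<in>exponents X e. d \<alpha> * (\<Prod>x\<in>X. x s ^ \<alpha> x))"
    using assms(2) unfolding polynomial_in_def by blast
  have "f s + g s = (\<Sum>\<alpha>\<in>exponents X e. (c \<alpha> + d \<alpha>) * (\<Prod>x\<in>X. x s ^ \<alpha> x))" for s
    unfolding c d distrib_right sum.distrib by (rule refl)
  then show ?thesis
    by (rule polynomial_inI)
qed

lemma polynomial_in_power:
  assumes "polynomial_in X e f"
  shows "polynomial_in X (n * e) (\<lambda>s. f s ^ n)"
proof (induction n)
  case (Suc n)
  then show ?case using polynomial_in_mult [OF assms Suc] by simp
qed (simp add: polynomial_in_const)

lemma polynomial_in_prod:
  assumes "finite I" "\<And>i. i \<in> I \<Longrightarrow> polynomial_in X (e i) (f i)"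
  shows "polynomial_in X (\<Sum>i\<in>I. e i) (\<lambda>s. \<Prod>i\<in>I. f i s)"
  using assms
proof (induction I)
  case (insert i I)
  then show ?case using polynomial_in_mult [of "e i" "f i"] by simp
qed (simp add: polynomial_in_const)

end

text \<open>Rational functions of the members of \<open>X\<close>.  They are closed under \<open>inverse\<close> only where there
  is no zero on \<open>S\<close>, so that numerators and denominators can be cleared on all of \<open>S\<close>; by \<open>cong\<close>
  only the values on \<open>S\<close> matter, and so equations that hold on \<open>S\<close> can be solved for a function.\<close>

inductive rational_in :: "'s set \<Rightarrow> ('s \<Rightarrow> real) set \<Rightarrow> ('s \<Rightarrow> real) \<Rightarrow> bool" for S X where
  const: "rational_in S X (\<lambda>_. a)"
| gen: "x \<in> X \<Longrightarrow> rational_in S X x"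
| add: "rational_in S X f \<Longrightarrow> rational_in S X g \<Longrightarrow> rational_in S X (\<lambda>s. f s + g s)"
| mult: "rational_in S X f \<Longrightarrow> rational_in S X g \<Longrightarrow> rational_in S X (\<lambda>s. f s * g s)"
| inverse: "rational_in S X f \<Longrightarrow> (\<And>s. s \<in> S \<Longrightarrow> f s \<noteq> 0) \<Longrightarrow> rational_in S X (\<lambda>s. inverse (f s))"
| cong: "rational_in S X f \<Longrightarrow> (\<And>s. s \<in> S \<Longrightarrow> g s = f s) \<Longrightarrow> rational_in S X g"

lemma rational_in_uminus: "rational_in S X f \<Longrightarrow> rational_in S X (\<lambda>s. - f s)"
  using rational_in.mult [OF rational_in.const [of S X "-1"]] by fastforce

lemma rational_in_diff:
  "rational_in S X f \<Longrightarrow> rational_in S X g \<Longrightarrow> rational_in S X (\<lambda>s. f s - g s)"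
  using rational_in.add [OF _ rational_in_uminus] by fastforce

lemma rational_in_divide:
  "rational_in S X f \<Longrightarrow> rational_in S X g \<Longrightarrow> (\<And>s. s \<in> S \<Longrightarrow> g s \<noteq> 0) \<Longrightarrow>
    rational_in S X (\<lambda>s. f s / g s)"
  unfolding divide_inverse by (intro rational_in.mult rational_in.inverse)

lemma rational_in_sum:
  "(\<And>i. i \<in> I \<Longrightarrow> rational_in S X (f i)) \<Longrightarrow> rational_in S X (\<lambda>s. \<Sum>i\<in>I. f i s)"
  by (induction I rule: infinite_finite_induct) (auto intro: rational_in.const rational_in.add)

lemma rational_in_quotient:
  assumes "rational_in S X f" and fin: "finite X"
  shows "\<exists>e p q. polynomial_in X e p \<and> polynomial_in X e q \<and>
      (\<forall>s\<in>S. q s \<noteq> 0 \<and> f s = p s / q s)"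
  using assms(1)
proof induction
  case (const a)
  show ?case
    by (rule exI [of _ 0], rule exI [of _ "\<lambda>_. a"], rule exI [of _ "\<lambda>_. 1"])
      (simp add: polynomial_in_const fin)
next
  case (gen x)
  show ?case
    by (rule exI [of _ 1], rule exI [of _ x], rule exI [of _ "\<lambda>_. 1"])
      (simp add: polynomial_in_const polynomial_in_gen [OF fin gen] fin del: One_nat_def)
next
  case (add f g)
  then obtain e p q e' p' q' where **:
    "polynomial_in X e p" "polynomial_in X e q" "\<forall>s\<in>S. q s \<noteq> 0 \<and> f s = p s / q s"
    "polynomial_in X e' p'" "polynomial_in X e' q'" "\<forall>s\<in>S. q' s \<noteq> 0 \<and> g s = p' s / q' s"
    by blast
  show ?case
    by (rule exI [of _ "e + e'"], rule exI [of _ "\<lambda>s. p s * q' s + q s * p' s"],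
        rule exI [of _ "\<lambda>s. q s * q' s"],
        insert **, auto intro!: polynomial_in_add polynomial_in_mult fin simp: add_frac_eq)
next
  case (mult f g)
  then obtain e p q e' p' q' where **:
    "polynomial_in X e p" "polynomial_in X e q" "\<forall>s\<in>S. q s \<noteq> 0 \<and> f s = p s / q s"
    "polynomial_in X e' p'" "polynomial_in X e' q'" "\<forall>s\<in>S. q' s \<noteq> 0 \<and> g s = p' s / q' s"
    by blast
  show ?case
    by (rule exI [of _ "e + e'"], rule exI [of _ "\<lambda>s. p s * p' s"],
        rule exI [of _ "\<lambda>s. q s * q' s"],
        insert **, auto intro!: polynomial_in_mult fin)
next
  case (inverse f)
  then obtain e p q where **:
    "polynomial_in X e p" "polynomial_in X e q" "\<forall>s\<in>S. q s \<noteq> 0 \<and> f s = p s / q s"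
    by blast
  show ?case
    by (rule exI [of _ e], rule exI [of _ q], rule exI [of _ p],
        insert ** inverse.hyps, auto simp: field_simps)
next
  case (cong f g)
  then show ?case by fastforce
qed

text \<open>Let \<open>n\<close> be the number of coordinates of \<open>f\<close>, and \<open>a < n\<close> the number of functions in \<open>X\<close>.
  After multiplication by a power of a common denominator, the \<open>(D + 1) ^ n\<close> monomials of degree at
  most \<open>D\<close> in each of the \<open>n\<close> coordinates lie in a space of dimension \<open>O(D ^ a)\<close>, so for large
  \<open>D\<close> they are linearly dependent.\<close>

theorem algebraic_dependence:
  fixes f :: "'s \<Rightarrow> 'a::euclidean_space"
  assumes fin: "finite X" and card: "card X < DIM('a)"
    and f: "\<And>b. b \<in> Basis \<Longrightarrow> rational_in S X (\<lambda>s. f s \<bullet> b)"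
  obtains p where "real_polynomial_function p" "\<exists>y. p y \<noteq> 0" "\<And>s. s \<in> S \<Longrightarrow> p (f s) = 0"
proof -
  let ?B = "Basis :: 'a set"
  obtain e p q where *: "\<And>b. b \<in> ?B \<Longrightarrow> polynomial_in X (e b) (p b)"
    "\<And>b. b \<in> ?B \<Longrightarrow> polynomial_in X (e b) (q b)"
    "\<And>b s. b \<in> ?B \<Longrightarrow> s \<in> S \<Longrightarrow> q b s \<noteq> 0" "\<And>b s. b \<in> ?B \<Longrightarrow> s \<in> S \<Longrightarrow> f s \<bullet> b = p b s / q b s"
    using rational_in_quotient [OF f fin] by metis
  \<comment> \<open>a common denominator \<open>Q\<close>, with numerators \<open>P b\<close>, all of degree at most \<open>E\<close>\<close>
  define E where "E = (\<Sum>b\<in>?B. e b)"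
  define Q where "Q s = (\<Prod>b\<in>?B. q b s)" for s
  define P where "P b s = p b s * (\<Prod>b'\<in>?B - {b}. q b' s)" for b s
  have Q: "polynomial_in X E Q"
    unfolding Q_def [abs_def] E_def by (intro polynomial_in_prod fin finite_Basis *)
  have Q0: "Q s \<noteq> 0" if "s \<in> S" for s
    using *(3) that by (simp add: Q_def)
  have P: "polynomial_in X E (P b)" if "b \<in> ?B" for b
  proof -
    have "E = e b + (\<Sum>b'\<in>?B - {b}. e b')"
      unfolding E_def using that by (simp add: sum.remove)
    then show ?thesis
      unfolding P_def using that by (auto intro!: polynomial_in_mult polynomial_in_prod fin *)
  qed
  have PQ: "f s \<bullet> b * Q s = P b s" if "b \<in> ?B" "s \<in> S" for b s
    unfolding P_def Q_def using *(3,4) that by (simp add: prod.remove [of ?B b])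
  define n where "n = DIM('a)"
  \<comment> \<open>this \<open>D\<close> is so large that \<open>(E * n * D + 1) ^ a \<le> (C * (D + 1)) ^ a = D * (D + 1) ^ a < (D + 1) ^ n\<close>
    for \<open>a = card X\<close>\<close>
  define C where "C = E * n + 1"
  define D where "D = C ^ card X"
  define mono where "mono \<beta> s = (\<Prod>b\<in>?B. P b s ^ \<beta> b * Q s ^ (D - \<beta> b))" for \<beta> s
  have mono: "polynomial_in X (E * n * D) (mono \<beta>)" if "\<beta> \<in> exponents ?B D" for \<beta>
  proof -
    have "polynomial_in X (\<Sum>b\<in>?B. \<beta> b * E + (D - \<beta> b) * E) (mono \<beta>)"
      unfolding mono_def [abs_def]
      by (intro polynomial_in_prod polynomial_in_mult polynomial_in_power fin finite_Basis P Q)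
    moreover have "(\<Sum>b\<in>?B. \<beta> b * E + (D - \<beta> b) * E) = (\<Sum>b\<in>?B. D * E)"
      using that by (intro sum.cong) (auto simp: add_mult_distrib [symmetric] PiE_def Pi_def)
    ultimately show ?thesis by (simp add: n_def mult_ac)
  qed
  then have "\<forall>\<beta>\<in>exponents ?B D. \<exists>c. \<forall>s.
      mono \<beta> s = (\<Sum>\<alpha>\<in>exponents X (E * n * D). c \<alpha> * (\<Prod>x\<in>X. x s ^ \<alpha> x))"
    unfolding polynomial_in_def by (rule ballI)
  from bchoice [OF this] obtain A' where A': "\<And>\<beta> s. \<beta> \<in> exponents ?B D \<Longrightarrow>
      mono \<beta> s = (\<Sum>\<alpha>\<in>exponents X (E * n * D). A' \<beta> \<alpha> * (\<Prod>x\<in>X. x s ^ \<alpha> x))"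
    by blast
  define A where "A \<alpha> \<beta> = A' \<beta> \<alpha>" for \<alpha> \<beta>
  note A = A' [folded A_def]
  have "card (exponents X (E * n * D)) = (E * n * D + 1) ^ card X"
    using fin by (simp add: card_PiE)
  also have "\<dots> \<le> (C * (D + 1)) ^ card X"
    by (intro power_mono) (auto simp: C_def algebra_simps)
  also have "\<dots> = D * (D + 1) ^ card X"
    by (simp only: D_def power_mult_distrib)
  also have "\<dots> < (D + 1) ^ Suc (card X)"
    by simp
  also have "\<dots> \<le> (D + 1) ^ n"
    using card by (intro power_increasing) (auto simp: n_def)
  also have "\<dots> = card (exponents ?B D)"
    by (simp add: card_PiE n_def)
  finally have less: "card (exponents X (E * n * D)) < card (exponents ?B D)" .
  have "finite (exponents X (E * n * D))" "finite (exponents ?B D)"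
    using fin by (auto intro: finite_PiE)
  from underdetermined_system_solvable [OF this less, of A] obtain c where c: "\<exists>\<beta>\<in>exponents ?B D. c \<beta> \<noteq> 0"
    "\<And>\<alpha>. \<alpha> \<in> exponents X (E * n * D) \<Longrightarrow> (\<Sum>\<beta>\<in>exponents ?B D. A \<alpha> \<beta> * c \<beta>) = 0"
    by blast
  define r where "r y = (\<Sum>\<beta>\<in>exponents ?B D. c \<beta> * (\<Prod>b\<in>?B. (y \<bullet> b) ^ \<beta> b))" for y :: 'a
  show thesis
  proof
    show "real_polynomial_function r"
      unfolding r_def
      by (intro real_polynomial_function_basic real_polynomial_function_inner finite_PiE) auto
    show "\<exists>y. r y \<noteq> 0"
    proof (rule ccontr)
      assume "\<not> ?thesis"
      then have "r (\<Sum>b\<in>?B. y b *\<^sub>R b) = 0" for y by simp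
      then have "(\<Sum>\<beta>\<in>exponents ?B D. c \<beta> * (\<Prod>b\<in>?B. y b ^ \<beta> b)) = 0" for y
        unfolding r_def by (simp add: inner_sum_left_Basis)
      then have "c \<beta> = 0" if "\<beta> \<in> exponents ?B D" for \<beta>
        using that by (rule monomials_independent [OF finite_Basis])
      with c(1) show False by blast
    qed
    show "r (f s) = 0" if s: "s \<in> S" for s
    proof -
      have "r (f s) * Q s ^ (n * D) = (\<Sum>\<beta>\<in>exponents ?B D. c \<beta> * mono \<beta> s)"
        unfolding r_def sum_distrib_right
      proof (intro sum.cong refl)
        fix \<beta> assume \<beta>: "\<beta> \<in> exponents ?B D"
        have "(\<Prod>b\<in>?B. (f s \<bullet> b) ^ \<beta> b) * Q s ^ (n * D) = (\<Prod>b\<in>?B. (f s \<bullet> b) ^ \<beta> b * Q s ^ D)"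
          by (simp add: prod.distrib n_def power_mult [symmetric] mult.commute)
        also have "\<dots> = mono \<beta> s"
          unfolding mono_def
        proof (intro prod.cong refl)
          fix b assume b: "b \<in> ?B"
          then have "Q s ^ D = Q s ^ \<beta> b * Q s ^ (D - \<beta> b)"
            using PiE_mem [OF \<beta> b] by (simp add: power_add [symmetric])
          then show "(f s \<bullet> b) ^ \<beta> b * Q s ^ D = P b s ^ \<beta> b * Q s ^ (D - \<beta> b)"
            by (simp add: PQ [OF b s, symmetric] power_mult_distrib)
        qed
        finally show "c \<beta> * (\<Prod>b\<in>?B. (f s \<bullet> b) ^ \<beta> b) * Q s ^ (n * D) = c \<beta> * mono \<beta> s"
          by simp
      qed
      also have "\<dots> = (\<Sum>\<beta>\<in>exponents ?B D. \<Sum>\<alpha>\<in>exponents X (E * n * D).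
          A \<alpha> \<beta> * c \<beta> * (\<Prod>x\<in>X. x s ^ \<alpha> x))"
        by (intro sum.cong refl) (simp add: A sum_distrib_left mult_ac)
      also have "\<dots> = (\<Sum>\<alpha>\<in>exponents X (E * n * D).
          (\<Sum>\<beta>\<in>exponents ?B D. A \<alpha> \<beta> * c \<beta>) * (\<Prod>x\<in>X. x s ^ \<alpha> x))"
        by (subst sum.swap) (simp add: sum_distrib_right)
      also have "\<dots> = 0"
        using c(2) by simp
      finally show ?thesis
        using Q0 [OF s] by simp
    qed
  qed
qed

section \<open>Orthogonal projections onto the span of some columns\<close>

lemma matrix_add_rdistrib: "(A + B) ** C = A ** C + B ** (C :: real ^ 'm::finite ^ 'm)"
  by (vector matrix_matrix_mult_def sum.distrib [symmetric] field_simps)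

lemma matrix_diff_ldistrib: "A ** (B - C) = A ** B - A ** (C :: real ^ 'm::finite ^ 'm)"
  by (vector matrix_matrix_mult_def sum_subtractf [symmetric] field_simps)

lemma matrix_diff_rdistrib: "(A - B) ** C = A ** C - B ** (C :: real ^ 'm::finite ^ 'm)"
  by (vector matrix_matrix_mult_def sum_subtractf [symmetric] field_simps)

lemma matrix_mult_zero [simp]: "A ** 0 = 0" "0 ** A = (0 :: real ^ 'm::finite ^ 'm)"
  by (vector matrix_matrix_mult_def)+

lemma transpose_add: "transpose (A + B) = transpose A + transpose (B :: real ^ 'm ^ 'm)"
  and transpose_diff: "transpose (A - B) = transpose A - transpose B"
  by (vector transpose_def)+

lemma inner_matrix_transpose: "(A *v x) \<bullet> y = x \<bullet> (transpose A *v (y :: real ^ 'm::finite))"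
  by (metis dot_lmul_matrix inner_commute transpose_matrix_vector transpose_transpose)

lemma
  fixes A :: "real ^ 'm::finite ^ 'm"
  assumes "det A \<noteq> 0"
  shows mult_matrix_inv: "A ** matrix_inv A = mat 1"
    and matrix_inv_mult: "matrix_inv A ** A = mat 1"
proof -
  have "\<exists>B. A ** B = mat 1 \<and> B ** A = mat 1"
    using assms unfolding invertible_det_nz [symmetric] invertible_def .
  from someI_ex [OF this] show "A ** matrix_inv A = mat 1" "matrix_inv A ** A = mat 1"
    unfolding matrix_inv_def by auto
qed

lemma det_nonzero_if_right_inverse:
  fixes A :: "real ^ 'm::finite ^ 'm"
  assumes "A ** B = mat 1"
  shows "det A \<noteq> 0"
  using assms invertible_det_nz invertible_right_inverse by blast

lemma matrix_inv_eq_if_right_inverse: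
  fixes A :: "real ^ 'm::finite ^ 'm"
  assumes "A ** B = mat 1"
  shows "matrix_inv A = B"
  by (metis assms det_nonzero_if_right_inverse matrix_inv_mult matrix_mul_assoc matrix_mul_lid
      matrix_mul_rid)

lemma det_nonzero_if_kernel_trivial:
  fixes A :: "real ^ 'm::finite ^ 'm"
  assumes "\<And>x. A *v x = 0 \<Longrightarrow> x = 0"
  shows "det A \<noteq> 0"
proof -
  have "\<exists>B. B ** A = mat 1"
    unfolding matrix_left_invertible_ker using assms by simp
  then show ?thesis
    unfolding invertible_det_nz [symmetric] invertible_left_inverse .
qed

text \<open>By Cramer's rule the entries of the inverse are these polynomials divided by the determinant.
  This gives both the continuity of the inverse and polynomial forms of equations in which it
  occurs.\<close>

definition adjugate :: "real ^ 'm ^ 'm \<Rightarrow> real ^ 'm ^ 'm" where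
  "adjugate A = (\<chi> i j. det (\<chi> r c. if c = i then (if r = j then 1 else 0) else A $ r $ c))"

lemma matrix_inv_eq_adjugate:
  fixes A :: "real ^ 'm::finite ^ 'm"
  assumes "det A \<noteq> 0"
  shows "matrix_inv A $ i $ j = adjugate A $ i $ j / det A"
proof -
  have "A *v (matrix_inv A *v axis j 1) = axis j 1"
    using mult_matrix_inv [OF assms] by (simp add: matrix_vector_mul_assoc)
  then have "matrix_inv A *v axis j 1 =
      (\<chi> k. det (\<chi> r c. if c = k then axis j 1 $ r else A $ r $ c) / det A)"
    using cramer [OF assms] by blast
  moreover have "matrix_inv A $ i $ j = (matrix_inv A *v axis j 1) $ i"
    by (simp add: matrix_vector_mult_basis column_def)
  ultimately show ?thesis
    by (simp add: adjugate_def axis_def cong: if_cong)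
qed

definition coord_proj :: "'m set \<Rightarrow> real ^ 'm ^ 'm" where
  "coord_proj J = (\<chi> i j. if i = j \<and> i \<in> J then 1 else 0)"

lemma coord_mult_nth: "(coord_proj J ** A) $ i $ j = (if i \<in> J then A $ i $ j else 0)"
proof -
  have "(coord_proj J ** A) $ i $ j = (\<Sum>k\<in>UNIV. if k = i then (if i \<in> J then A $ i $ j else 0) else 0)"
    unfolding matrix_matrix_mult_def coord_proj_def vec_lambda_beta by (rule sum.cong) auto
  then show ?thesis by simp
qed

lemma mult_coord_nth: "(A ** coord_proj J) $ i $ j = (if j \<in> J then A $ i $ j else 0)"
proof -
  have "(A ** coord_proj J) $ i $ j = (\<Sum>k\<in>UNIV. if k = j then (if j \<in> J then A $ i $ j else 0) else 0)"
    unfolding matrix_matrix_mult_def coord_proj_def vec_lambda_beta by (rule sum.cong) auto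
  then show ?thesis by simp
qed

lemma coord_vector_nth: "(coord_proj J *v x) $ i = (if i \<in> J then x $ i else 0)"
proof -
  have "(coord_proj J *v x) $ i = (\<Sum>k\<in>UNIV. if k = i then (if i \<in> J then x $ i else 0) else 0)"
    unfolding matrix_vector_mult_def coord_proj_def vec_lambda_beta by (rule sum.cong) auto
  then show ?thesis by simp
qed

lemma coord_idem: "coord_proj J ** coord_proj J = coord_proj J"
  by (simp add: vec_eq_iff coord_mult_nth) (simp add: coord_proj_def)

lemma coord_coord_Compl: "coord_proj J ** coord_proj (- J) = 0" "coord_proj (- J) ** coord_proj J = 0"
  by (simp add: vec_eq_iff coord_mult_nth, simp add: coord_proj_def)+

lemma coord_add_Compl: "coord_proj J + coord_proj (- J) = mat 1"
  by (simp add: vec_eq_iff coord_proj_def mat_def)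

lemma transpose_coord: "transpose (coord_proj J) = coord_proj J"
  by (auto simp: vec_eq_iff coord_proj_def transpose_def)

lemma trace_coord: "trace (coord_proj (J :: 'm::finite set)) = card J"
  by (simp add: trace_def coord_proj_def sum.If_cases)

lemma GrassmannianD:
  assumes "P \<in> Grassmannian k"
  shows "P ** P = P" "transpose P = P" "trace P = k"
  using assms unfolding Grassmannian_def by auto

text \<open>If \<open>P Q = Q\<close> then \<open>P - Q\<close> is an orthogonal projection too, and one with trace \<open>0\<close> is \<open>0\<close>,
  since its trace is the sum of the squares of its entries.\<close>

lemma Grassmannian_eqI:
  fixes P Q :: "real ^ 'm::finite ^ 'm"
  assumes P: "P \<in> Grassmannian k" and Q: "Q \<in> Grassmannian k" and "P ** Q = Q"
  shows "P = Q"
proof -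
  note * = GrassmannianD [OF P] GrassmannianD [OF Q]
  have "Q ** P = Q"
    using arg_cong [OF assms(3), of transpose] * by (simp add: matrix_transpose_mul)
  then have "transpose (P - Q) ** (P - Q) = P - Q"
    using * assms(3) by (simp add: transpose_diff matrix_diff_ldistrib matrix_diff_rdistrib)
  then have "trace (transpose (P - Q) ** (P - Q)) = 0"
    using * by (simp add: trace_sub)
  then have "(\<Sum>j\<in>UNIV. \<Sum>i\<in>UNIV. ((P - Q) $ i $ j)\<^sup>2) = 0"
    by (simp add: trace_def matrix_matrix_mult_def transpose_def power2_eq_square)
  then have "(P - Q) $ i $ j = 0" for i j
    by (simp add: sum_nonneg sum_nonneg_eq_0_iff)
  then show ?thesis
    by (simp add: vec_eq_iff)
qed

definition independent_columns :: "'m set \<Rightarrow> real ^ 'm ^ 'm \<Rightarrow> bool" where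
  "independent_columns J T \<longleftrightarrow> (\<forall>x. T *v (coord_proj J *v x) = 0 \<longrightarrow> coord_proj J *v x = 0)"

text \<open>The Gram matrix of the columns in \<open>J\<close>, completed by an identity block to an \<open>M \<times> M\<close> matrix
  that is invertible if these columns are independent.\<close>

definition gram :: "'m set \<Rightarrow> real ^ 'm ^ 'm \<Rightarrow> real ^ 'm ^ 'm" where
  "gram J T = coord_proj J ** transpose T ** T ** coord_proj J + coord_proj (- J)"

text \<open>The formula \<open>V (V' V)^{-1} V'\<close> for the orthogonal projection onto the span of the columns of
  \<open>V\<close>, with \<open>V'\<close> the transpose of \<open>V\<close>.\<close>

definition column_projection :: "'m set \<Rightarrow> real ^ 'm ^ 'm \<Rightarrow> real ^ 'm ^ 'm" where
  "column_projection J T = T ** coord_proj J ** matrix_inv (gram J T) ** coord_proj J ** transpose T"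

lemma independent_columns_if_det:
  fixes T :: "real ^ 'm::finite ^ 'm"
  assumes "det T \<noteq> 0"
  shows "independent_columns J T"
  by (metis assms independent_columns_def matrix_inv_mult matrix_vector_mul_assoc
      matrix_vector_mul_lid matrix_vector_mult_0_right)

lemma det_gram:
  fixes T :: "real ^ 'm::finite ^ 'm"
  assumes "independent_columns J T"
  shows "det (gram J T) \<noteq> 0"
proof (rule det_nonzero_if_kernel_trivial)
  fix x assume "gram J T *v x = 0"
  then have "0 = x \<bullet> (gram J T *v x)" by simp
  also have "\<dots> = (T *v (coord_proj J *v x)) \<bullet> (T *v (coord_proj J *v x)) + (coord_proj (- J) *v x) \<bullet> (coord_proj (- J) *v x)"
  proof -
    have "gram J T *v x = coord_proj J *v (transpose T *v (T *v (coord_proj J *v x))) + coord_proj (- J) *v (coord_proj (- J) *v x)"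
      by (simp only: gram_def matrix_vector_mult_add_rdistrib matrix_vector_mul_assoc [symmetric])
        (simp only: matrix_vector_mul_assoc coord_idem)
    moreover have "x \<bullet> (coord_proj K *v z) = (coord_proj K *v x) \<bullet> z" for K z
      by (simp only: inner_matrix_transpose transpose_coord)
    moreover have "y \<bullet> (transpose T *v z) = (T *v y) \<bullet> z" for y z
      by (simp only: inner_matrix_transpose)
    ultimately show ?thesis
      by (simp only: inner_add_right)
  qed
  finally have "T *v (coord_proj J *v x) = 0" "coord_proj (- J) *v x = 0"
    by (metis inner_ge_zero add_nonneg_eq_0_iff inner_eq_zero_iff)+
  moreover have "x = coord_proj J *v x + coord_proj (- J) *v x"
    by (simp add: matrix_vector_mult_add_rdistrib [symmetric] coord_add_Compl)
  ultimately show "x = 0"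
    using assms unfolding independent_columns_def by (metis add.right_neutral)
qed

context
  fixes J :: "'m::finite set" and T :: "real ^ 'm ^ 'm"
  assumes indep: "independent_columns J T"
begin

private abbreviation (input) "E \<equiv> coord_proj J"
private abbreviation (input) "F \<equiv> coord_proj (- J)"
private abbreviation (input) "H \<equiv> gram J T"
private abbreviation (input) "H' \<equiv> matrix_inv (gram J T)"

lemma coord_mult_gram: "E ** H = E ** transpose T ** T ** E" "H ** E = E ** transpose T ** T ** E"
  unfolding gram_def matrix_add_ldistrib matrix_add_rdistrib
  by (simp_all add: matrix_mul_assoc [symmetric] coord_idem coord_coord_Compl)
    (simp add: matrix_mul_assoc coord_idem)

lemma coord_Compl_mult_gram: "F ** H = F"
  unfolding gram_def matrix_add_ldistrib
  by (simp add: matrix_mul_assoc coord_idem coord_coord_Compl)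

lemma gram_inverse: "H ** H' = mat 1" "H' ** H = mat 1"
  using mult_matrix_inv matrix_inv_mult det_gram [OF indep] by auto

lemma transpose_gram_inverse: "transpose H' = H'"
proof -
  have "transpose H = H"
    by (simp add: gram_def transpose_add matrix_transpose_mul transpose_coord matrix_mul_assoc)
  then have "H ** transpose H' = mat 1"
    using arg_cong [OF gram_inverse(2), of transpose] by (simp add: matrix_transpose_mul)
  then show ?thesis
    using matrix_inv_eq_if_right_inverse by metis
qed

lemma column_projection_fixes: "column_projection J T ** T ** E = T ** E"
proof -
  have "column_projection J T ** T ** E = T ** E ** H' ** (E ** transpose T ** T ** E)"
    by (simp add: column_projection_def matrix_mul_assoc)
  also have "\<dots> = T ** E ** (H' ** H) ** E"
    unfolding coord_mult_gram(2) [symmetric] by (simp add: matrix_mul_assoc)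
  finally show ?thesis
    by (simp add: gram_inverse matrix_mul_assoc [symmetric] coord_idem)
qed

lemma column_projection_idem: "column_projection J T ** column_projection J T = column_projection J T"
proof -
  have "column_projection J T ** column_projection J T =
      (column_projection J T ** T ** E) ** H' ** E ** transpose T"
    by (subst (2) column_projection_def) (simp add: matrix_mul_assoc)
  then show ?thesis
    unfolding column_projection_fixes by (simp add: column_projection_def)
qed

lemma column_projection_in_Grassmannian: "column_projection J T \<in> Grassmannian (card J)"
proof -
  have "transpose (column_projection J T) = column_projection J T"
    by (simp add: column_projection_def matrix_transpose_mul transpose_coord
        transpose_gram_inverse matrix_mul_assoc)
  moreover have "trace (column_projection J T) = trace (H' ** (E ** transpose T ** T ** E))"
    unfolding column_projection_def
    by (metis (no_types) trace_mul_sym matrix_mul_assoc)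
  then have "trace (column_projection J T) = card J"
    unfolding coord_mult_gram(2) [symmetric]
    by (simp add: matrix_mul_assoc gram_inverse trace_coord)
  ultimately show ?thesis
    unfolding Grassmannian_def using column_projection_idem by simp
qed

lemma column_projection_unique:
  assumes "P \<in> Grassmannian (card J)" "P ** T ** E = T ** E"
  shows "P = column_projection J T"
  using assms(1) column_projection_in_Grassmannian
proof (rule Grassmannian_eqI)
  show "P ** column_projection J T = column_projection J T"
    using assms(2) by (simp add: column_projection_def matrix_mul_assoc)
qed

end

section \<open>Graph charts of the Grassmannian\<close>

text \<open>A subspace that projects isomorphically onto the coordinates in \<open>J\<close> is the graph of a
  linear map from these coordinates to the others.  Its matrix \<open>a\<close> is kept as a square matrix,
  which is zero outside the block with rows off \<open>J\<close> and columns in \<open>J\<close>, so that the subspace is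
  spanned by the columns of \<open>1 + a\<close> in \<open>J\<close>.\<close>

definition off_block :: "'m set \<Rightarrow> real ^ 'm ^ 'm \<Rightarrow> bool" where
  "off_block J a \<longleftrightarrow> (\<forall>i j. a $ i $ j \<noteq> 0 \<longrightarrow> i \<notin> J \<and> j \<in> J)"

definition graph_projection :: "'m set \<Rightarrow> real ^ 'm ^ 'm \<Rightarrow> real ^ 'm ^ 'm" where
  "graph_projection J a = column_projection J (mat 1 + a)"

definition chart_block :: "'m set \<Rightarrow> real ^ 'm ^ 'm \<Rightarrow> real ^ 'm ^ 'm" where
  "chart_block J P = coord_proj J ** P ** coord_proj J + coord_proj (- J)"

definition chart :: "'m set \<Rightarrow> real ^ 'm ^ 'm \<Rightarrow> real ^ 'm ^ 'm" where
  "chart J P = P ** coord_proj J ** matrix_inv (chart_block J P) - coord_proj J"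

lemma off_blockD:
  fixes J :: "'m::finite set"
  assumes "off_block J a"
  shows "coord_proj J ** a = 0" "a ** coord_proj J = a" "(mat 1 + a) ** coord_proj J = coord_proj J + a"
    "coord_proj J ** (mat 1 + a) = coord_proj J" "coord_proj J ** transpose (mat 1 + a) = coord_proj J + transpose a"
    "transpose (mat 1 + a) ** coord_proj J = coord_proj J"
proof -
  show 1: "coord_proj J ** a = 0"
    using assms by (auto simp: vec_eq_iff coord_mult_nth off_block_def)
  show 2: "a ** coord_proj J = a"
    using assms by (auto simp: vec_eq_iff mult_coord_nth off_block_def)
  show 3: "(mat 1 + a) ** coord_proj J = coord_proj J + a"
    by (simp add: matrix_add_rdistrib 2)
  show 4: "coord_proj J ** (mat 1 + a) = coord_proj J"
    by (simp add: matrix_add_ldistrib 1)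
  show "coord_proj J ** transpose (mat 1 + a) = coord_proj J + transpose a"
    using arg_cong [OF 3, of transpose] by (simp add: matrix_transpose_mul transpose_coord transpose_add)
  show "transpose (mat 1 + a) ** coord_proj J = coord_proj J"
    using arg_cong [OF 4, of transpose] by (simp add: matrix_transpose_mul transpose_coord)
qed

lemma off_block_independent:
  fixes J :: "'m::finite set"
  assumes "off_block J a"
  shows "independent_columns J (mat 1 + a)"
  unfolding independent_columns_def
proof (intro allI impI)
  fix x assume "(mat 1 + a) *v (coord_proj J *v x) = 0"
  then have "coord_proj J *v ((mat 1 + a) *v (coord_proj J *v x)) = 0"
    by simp
  then show "coord_proj J *v x = 0"
    by (simp add: matrix_vector_mul_assoc matrix_mul_assoc off_blockD(4) [OF assms] coord_idem)
qed

lemma graph_projection_in_Grassmannian: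
  fixes J :: "'m::finite set"
  shows "off_block J a \<Longrightarrow> graph_projection J a \<in> Grassmannian (card J)"
  unfolding graph_projection_def
  by (intro column_projection_in_Grassmannian off_block_independent)

text \<open>The block of the projection onto the graph is the inverse of the Gram matrix, so the columns
  of \<open>1 + a\<close> in \<open>J\<close> can be recovered from the projection.\<close>

lemma
  fixes J :: "'m::finite set"
  assumes a: "off_block J a"
  shows det_chart_block_graph_projection: "det (chart_block J (graph_projection J a)) \<noteq> 0"
    and chart_graph_projection: "chart J (graph_projection J a) = a"
proof -
  let ?T = "mat 1 + a" and ?E = "coord_proj J" and ?F = "coord_proj (- J)"
  let ?H = "gram J ?T"
  let ?H' = "matrix_inv ?H"
  note indep = off_block_independent [OF a]
  have comm: "?E ** ?H = ?H ** ?E"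
    by (simp only: coord_mult_gram [OF indep])
  have P: "graph_projection J a ** ?E = ?T ** ?E ** ?H' ** ?E"
    unfolding graph_projection_def column_projection_def matrix_mul_assoc [symmetric]
      off_blockD(6) [OF a]
    by (simp add: coord_idem)
  have K: "chart_block J (graph_projection J a) = ?E ** ?H' ** ?E + ?F"
    unfolding chart_block_def matrix_mul_assoc [symmetric] P
    by (simp add: matrix_mul_assoc off_blockD(4) [OF a] coord_idem)
  have "chart_block J (graph_projection J a) ** ?H = ?E ** ?H' ** (?E ** ?H) + ?F ** ?H"
    by (simp add: K matrix_add_rdistrib matrix_mul_assoc)
  also have "\<dots> = ?E ** (?H' ** ?H) ** ?E + ?F"
    unfolding comm coord_Compl_mult_gram [OF indep] by (simp add: matrix_mul_assoc)
  also have "\<dots> = mat 1"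
    by (simp add: gram_inverse [OF indep] coord_idem coord_add_Compl)
  finally have inv: "chart_block J (graph_projection J a) ** ?H = mat 1" .
  then show "det (chart_block J (graph_projection J a)) \<noteq> 0"
    by (rule det_nonzero_if_right_inverse)
  have "graph_projection J a ** ?E ** matrix_inv (chart_block J (graph_projection J a)) =
      ?T ** ?E ** ?H' ** (?E ** ?H)"
    unfolding matrix_inv_eq_if_right_inverse [OF inv] P by (simp add: matrix_mul_assoc)
  also have "\<dots> = ?T ** ?E ** (?H' ** ?H) ** ?E"
    unfolding comm by (simp add: matrix_mul_assoc)
  also have "\<dots> = ?E + a"
    by (simp add: gram_inverse [OF indep] matrix_mul_assoc [symmetric] matrix_add_rdistrib
        coord_idem off_blockD(2,3) [OF a])
  finally show "chart J (graph_projection J a) = a"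
    by (simp add: chart_def)
qed

lemma
  fixes P :: "real ^ 'm::finite ^ 'm"
  assumes P: "P \<in> Grassmannian (card J)" and det: "det (chart_block J P) \<noteq> 0"
  shows off_block_chart: "off_block J (chart J P)"
    and graph_projection_chart: "graph_projection J (chart J P) = P"
proof -
  let ?E = "coord_proj J" and ?F = "coord_proj (- J)" and ?K = "chart_block J P"
  let ?K' = "matrix_inv ?K" and ?a = "chart J P"
  note K' = mult_matrix_inv [OF det] matrix_inv_mult [OF det]
  have "?F ** ?K = ?F" "?K ** ?F = ?F"
    by (simp_all add: chart_block_def matrix_add_ldistrib matrix_add_rdistrib matrix_mul_assoc
        coord_coord_Compl coord_idem) (simp add: matrix_mul_assoc [symmetric] coord_coord_Compl)
  then have F: "?F ** ?K' = ?F" "?K' ** ?F = ?F"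
    by (metis K' matrix_mul_assoc matrix_mul_lid matrix_mul_rid)+
  have "?E ** P ** ?E = ?K - ?F"
    by (simp add: chart_block_def)
  then have "?E ** ?a = (?K - ?F) ** ?K' - ?E"
    by (simp add: chart_def matrix_diff_ldistrib matrix_mul_assoc coord_idem)
  also have "\<dots> = 0"
    by (simp add: matrix_diff_rdistrib K' F coord_add_Compl [of J, symmetric])
  finally have 1: "?E ** ?a = 0" .
  have "?a ** ?F = P ** ?E ** (?K' ** ?F) - ?E ** ?F"
    by (simp add: chart_def matrix_diff_rdistrib matrix_mul_assoc)
  also have "\<dots> = 0"
    by (simp add: F matrix_mul_assoc [symmetric] coord_coord_Compl)
  finally have 2: "?a ** ?F = 0" .
  show a: "off_block J ?a"
    unfolding off_block_def
  proof (intro allI impI conjI)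
    fix i j assume *: "?a $ i $ j \<noteq> 0"
    show "i \<notin> J"
      using * arg_cong [OF 1, of "\<lambda>A. A $ i $ j"] by (auto simp: coord_mult_nth)
    show "j \<in> J"
      using * arg_cong [OF 2, of "\<lambda>A. A $ i $ j"] by (auto simp: mult_coord_nth split: if_splits)
  qed
  have "(mat 1 + ?a) ** ?E = P ** ?E ** ?K'"
    unfolding off_blockD(3) [OF a] by (simp add: chart_def)
  then have "P ** (mat 1 + ?a) ** ?E = (mat 1 + ?a) ** ?E"
    by (metis GrassmannianD(1) [OF P] matrix_mul_assoc)
  then show "graph_projection J ?a = P"
    unfolding graph_projection_def
    using column_projection_unique [OF off_block_independent [OF a] P] by simp
qed

text \<open>The image of \<open>P\<close> lies in the graph of \<open>a\<close> if and only if \<open>P = (1 + a) E P\<close>, where \<open>E\<close> is the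
  coordinate projection; the right-hand side is the transposed equation.  It is polynomial in \<open>P\<close> and
  linear in \<open>a\<close>.\<close>

lemma graph_projection_eq_iff:
  fixes P :: "real ^ 'm::finite ^ 'm"
  assumes P: "P \<in> Grassmannian (card J)" and a: "off_block J a"
  shows "graph_projection J a = P \<longleftrightarrow> P = P ** (coord_proj J + transpose a)"
proof
  let ?T = "mat 1 + a" and ?E = "coord_proj J"
  note indep = off_block_independent [OF a]
  assume "graph_projection J a = P"
  then have P_eq: "P = ?T ** ?E ** matrix_inv (gram J ?T) ** ?E ** transpose ?T"
    by (simp add: graph_projection_def column_projection_def)
  have "P ** (?E + transpose a) = P ** ?E ** transpose ?T"
    by (simp add: off_blockD(5) [OF a, symmetric] matrix_mul_assoc)
  also have "P ** ?E = ?T ** ?E ** matrix_inv (gram J ?T) ** ?E"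
    unfolding P_eq matrix_mul_assoc [symmetric] off_blockD(6) [OF a] by (simp add: coord_idem)
  finally show "P = P ** (?E + transpose a)"
    using P_eq by simp
next
  let ?T = "mat 1 + a" and ?E = "coord_proj J"
  note indep = off_block_independent [OF a]
  assume *: "P = P ** (coord_proj J + transpose a)"
  have "transpose (coord_proj J + transpose a) = ?T ** ?E"
    by (simp add: transpose_add transpose_coord off_blockD(3) [OF a])
  then have TEP: "?T ** ?E ** P = P"
    using arg_cong [OF *, of transpose] by (simp add: matrix_transpose_mul GrassmannianD [OF P])
  have "graph_projection J a ** (?T ** ?E ** P) = ?T ** ?E ** P"
    using column_projection_fixes [OF indep]
    by (simp add: graph_projection_def matrix_mul_assoc)
  then show "graph_projection J a = P"
    unfolding TEP by (intro Grassmannian_eqI [OF graph_projection_in_Grassmannian [OF a] P])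
qed

text \<open>\<open>P\<close> and the projection onto the graph have the same image, which is spanned by the columns of
  \<open>1 + a\<close> in \<open>J\<close>.  Hence they are equal, and so are their ranks.\<close>

lemma Grassmannian_card_eq:
  fixes P :: "real ^ 'm::finite ^ 'm"
  assumes P: "P \<in> Grassmannian k" and det: "det (chart_block J P) \<noteq> 0"
    and a: "off_block J a" and eq: "P = P ** (coord_proj J + transpose a)"
  shows "card J = k"
proof -
  let ?T = "mat 1 + a" and ?E = "coord_proj J" and ?K = "chart_block J P"
  note indep = off_block_independent [OF a] and P' = GrassmannianD [OF P]
  have "transpose (coord_proj J + transpose a) = ?T ** ?E"
    by (simp add: transpose_add transpose_coord off_blockD(3) [OF a])
  then have TEP: "?T ** ?E ** P = P"
    using arg_cong [OF eq, of transpose] by (simp add: matrix_transpose_mul P')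
  have "?E ** ?K = ?E ** P ** ?E"
    by (simp add: chart_block_def matrix_add_ldistrib matrix_mul_assoc coord_idem coord_coord_Compl)
  then have "?T ** ?E ** ?K = P ** ?E"
    by (metis TEP matrix_mul_assoc)
  then have TE: "?T ** ?E = P ** ?E ** matrix_inv ?K"
    by (metis mult_matrix_inv [OF det] matrix_mul_assoc matrix_mul_rid)
  then have "P ** ?T ** ?E = ?T ** ?E"
    by (metis P'(1) matrix_mul_assoc)
  then have "P ** graph_projection J a = graph_projection J a"
    by (simp add: graph_projection_def column_projection_def matrix_mul_assoc)
  moreover have "P ** graph_projection J a = P"
  proof -
    have "graph_projection J a ** (?T ** ?E ** P) = ?T ** ?E ** P"
      using column_projection_fixes [OF indep]
      by (simp add: graph_projection_def matrix_mul_assoc)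
    from arg_cong [OF this [unfolded TEP], of transpose] show ?thesis
      by (simp add: matrix_transpose_mul P' GrassmannianD [OF graph_projection_in_Grassmannian [OF a]])
  qed
  ultimately have "graph_projection J a = P" by simp
  then show ?thesis
    using GrassmannianD(3) [OF graph_projection_in_Grassmannian [OF a]] P'(3) by simp
qed

lemma chart_block_kernel:
  fixes P :: "real ^ 'm::finite ^ 'm"
  assumes "det (chart_block J P) \<noteq> 0" and "\<And>i. i \<notin> J \<Longrightarrow> x $ i = 0" and "P *v x = 0"
  shows "x = 0"
proof -
  have "coord_proj J *v x = x" "coord_proj (- J) *v x = 0"
    using assms(2) by (auto simp: vec_eq_iff coord_vector_nth)
  then have "chart_block J P *v x = 0"
    using assms(3)
    by (simp add: chart_block_def matrix_vector_mult_add_rdistrib matrix_vector_mul_assoc [symmetric])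
  then have "matrix_inv (chart_block J P) *v (chart_block J P *v x) = 0"
    by simp
  then show ?thesis
    by (simp add: matrix_vector_mul_assoc matrix_inv_mult [OF assms(1)])
qed

lemma det_chart_block_if_independent:
  fixes P :: "real ^ 'm::finite ^ 'm"
  assumes P: "P \<in> Grassmannian k"
    and indep: "\<And>x. (\<And>i. i \<notin> J \<Longrightarrow> x $ i = 0) \<Longrightarrow> P *v x = 0 \<Longrightarrow> x = 0"
  shows "det (chart_block J P) \<noteq> 0"
proof (rule det_nonzero_if_kernel_trivial)
  fix x assume *: "chart_block J P *v x = 0"
  have **: "chart_block J P *v x = coord_proj J *v (P *v (coord_proj J *v x)) + coord_proj (- J) *v x"
    by (simp add: chart_block_def matrix_vector_mult_add_rdistrib matrix_vector_mul_assoc matrix_mul_assoc)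
  have x0: "x $ i = 0" if "i \<notin> J" for i
    using arg_cong [OF *, of "\<lambda>y. y $ i"] that by (simp add: ** coord_vector_nth)
  then have x: "coord_proj J *v x = x" "coord_proj (- J) *v x = 0"
    by (auto simp: vec_eq_iff coord_vector_nth)
  then have z: "coord_proj J *v (P *v x) = 0"
    using * ** by simp
  have "(P *v x) \<bullet> (P *v x) = (P *v x) \<bullet> x"
    by (metis GrassmannianD(1,2) [OF P] inner_matrix_transpose inner_commute matrix_vector_mul_assoc)
  also have "\<dots> = x \<bullet> (coord_proj J *v (P *v x))"
    by (metis inner_commute inner_matrix_transpose transpose_coord x(1))
  finally have "P *v x = 0"
    using z by simp
  with x0 show "x = 0" by (rule indep)
qed

section \<open>Schubert cells\<close>

lemma in_span_image:
  assumes "finite S" "x \<in> span (f ` S)"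
  shows "\<exists>c. x = (\<Sum>s\<in>S. c s *\<^sub>R f s)"
proof -
  let ?V = "{\<Sum>s\<in>S. c s *\<^sub>R f s | c. True}"
  have "subspace ?V"
    unfolding subspace_def
  proof (intro conjI ballI allI)
    show "0 \<in> ?V"
      by (intro CollectI exI [of _ "\<lambda>_. 0"]) simp
    show "u + v \<in> ?V" if uv: "u \<in> ?V" "v \<in> ?V" for u v
    proof -
      from uv obtain c d where "u = (\<Sum>s\<in>S. c s *\<^sub>R f s)" "v = (\<Sum>s\<in>S. d s *\<^sub>R f s)"
        by auto
      then show ?thesis
        by (intro CollectI exI [of _ "\<lambda>s. c s + d s"]) (simp add: scaleR_add_left sum.distrib)
    qed
    show "r *\<^sub>R u \<in> ?V" if u: "u \<in> ?V" for r u
    proof -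
      from u obtain c where "u = (\<Sum>s\<in>S. c s *\<^sub>R f s)"
        by auto
      then show ?thesis
        by (intro CollectI exI [of _ "\<lambda>s. r * c s"]) (simp add: scaleR_sum_right)
    qed
  qed
  moreover have "f ` S \<subseteq> ?V"
  proof (intro image_subsetI CollectI)
    fix t assume "t \<in> S"
    then have "f t = (\<Sum>s\<in>S. (if s = t then 1 else 0) *\<^sub>R f s)"
      using assms(1) by (simp add: if_distrib [of "\<lambda>c. c *\<^sub>R _"] cong: if_cong)
    then show "\<exists>c. f t = (\<Sum>s\<in>S. c s *\<^sub>R f s) \<and> True"
      by (intro exI [of _ "\<lambda>s. if s = t then 1 else 0"]) simp
  qed
  ultimately show ?thesis
    using span_minimal assms(2) by blast
qed

lemma mult_axis_nth: "(A *v axis j 1) $ i = A $ i $ j" for A :: "real ^ 'm::finite ^ 'm"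
  by (simp add: matrix_vector_mult_basis column_def)

lemma axis_one_nth: "axis j (1 :: real) $ i = (if i = j then 1 else 0)"
  by (simp add: axis_def)

text \<open>The echelon form with pivots \<open>J\<close>: on the image of \<open>P\<close>, a coordinate off \<open>J\<close> is a linear
  function of the coordinates in \<open>J\<close> that come before it.\<close>

definition in_Schubert_cell :: "('m \<Rightarrow> nat) \<Rightarrow> 'm set \<Rightarrow> real ^ 'm ^ 'm \<Rightarrow> bool" where
  "in_Schubert_cell ord J P \<longleftrightarrow> det (chart_block J P) \<noteq> 0 \<and>
     (\<forall>i j. chart J P $ i $ j \<noteq> 0 \<longrightarrow> ord j < ord i)"

text \<open>The pivots \<open>J\<close> are the columns of \<open>P\<close> that are not in the span of the earlier ones; every
  other column is a combination of the earlier pivot columns.\<close>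

lemma Schubert_cell_exists:
  fixes P :: "real ^ 'm::finite ^ 'm"
  assumes P: "P \<in> Grassmannian k" and ord: "inj ord"
  shows "\<exists>J. card J = k \<and> in_Schubert_cell ord J P"
proof -
  let ?col = "\<lambda>i. P *v axis i 1"
  define J where "J = {j. ?col j \<notin> span (?col ` {i. ord i < ord j})}"
  have before: "?col i \<in> span (?col ` {j \<in> J. ord j < ord i})" if "i \<notin> J"
    "\<And>l. ord l < ord i \<Longrightarrow> ?col l \<in> span (?col ` {j \<in> J. ord j \<le> ord l})" for i
  proof -
    have "?col i \<in> span (?col ` {l. ord l < ord i})"
      using that(1) by (simp add: J_def)
    also have "\<dots> \<subseteq> span (?col ` {j \<in> J. ord j < ord i})"
    proof (intro span_minimal subspace_span image_subsetI)
      fix l assume "l \<in> {l. ord l < ord i}"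
      then show "?col l \<in> span (?col ` {j \<in> J. ord j < ord i})"
        using that(2)[of l] span_mono [of "?col ` {j \<in> J. ord j \<le> ord l}" "?col ` {j \<in> J. ord j < ord i}"]
        by force
    qed
    finally show ?thesis .
  qed
  have le: "?col i \<in> span (?col ` {j \<in> J. ord j \<le> ord i})" for i
  proof (induction "ord i" arbitrary: i rule: less_induct)
    case less
    show ?case
    proof (cases "i \<in> J")
      case True
      then show ?thesis by (intro span_base) auto
    next
      case False
      with before less have "?col i \<in> span (?col ` {j \<in> J. ord j < ord i})"
        by blast
      moreover have "span (?col ` {j \<in> J. ord j < ord i}) \<subseteq> span (?col ` {j \<in> J. ord j \<le> ord i})"
        by (intro span_mono) auto
      ultimately show ?thesis by blast
    qed
  qed
  have "\<forall>i\<in>- J. \<exists>c. ?col i = (\<Sum>j\<in>{j \<in> J. ord j < ord i}. c j *\<^sub>R ?col j)"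
    using before le by (intro ballI in_span_image) auto
  from bchoice [OF this] obtain c where
    c: "\<And>i. i \<notin> J \<Longrightarrow> ?col i = (\<Sum>j\<in>{j \<in> J. ord j < ord i}. c i j *\<^sub>R ?col j)"
    by auto
  define a where "a = (\<chi> i j. if i \<notin> J \<and> j \<in> J \<and> ord j < ord i then c i j else 0)"
  have a: "off_block J a"
    by (auto simp: off_block_def a_def)
  have eq: "P = P ** (coord_proj J + transpose a)"
  proof -
    have "P *v axis i 1 = (P ** (coord_proj J + transpose a)) *v axis i 1" for i
    proof (cases "i \<in> J")
      case True
      then have "(coord_proj J + transpose a) *v axis i 1 = axis i 1"
        by (auto simp: vec_eq_iff mult_axis_nth axis_one_nth coord_proj_def transpose_def a_def)
      then show ?thesis
        by (simp add: matrix_vector_mul_assoc [symmetric])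
    next
      case False
      have "(coord_proj J + transpose a) *v axis i 1 = (\<Sum>j\<in>{j \<in> J. ord j < ord i}. c i j *\<^sub>R axis j 1)"
        using False
        by (auto simp: vec_eq_iff mult_axis_nth axis_one_nth coord_proj_def transpose_def a_def
            if_distrib cong: if_cong)
      then have "(P ** (coord_proj J + transpose a)) *v axis i 1 =
          P *v (\<Sum>j\<in>{j \<in> J. ord j < ord i}. c i j *\<^sub>R axis j 1)"
        by (simp add: matrix_vector_mul_assoc [symmetric])
      also have "\<dots> = (\<Sum>j\<in>{j \<in> J. ord j < ord i}. c i j *\<^sub>R ?col j)"
        by (simp add: linear_sum [OF matrix_vector_mul_linear] matrix_vector_mult_scaleR)
      finally show ?thesis
        using c [OF False] by simp
    qed
    then show ?thesis
      by (metis mult_axis_nth vec_eq_iff)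
  qed
  have "x = 0" if supp: "\<And>i. i \<notin> J \<Longrightarrow> x $ i = 0" and "P *v x = 0" for x
  proof (rule ccontr)
    assume "x \<noteq> 0"
    then obtain i where "x $ i \<noteq> 0"
      by (auto simp: vec_eq_iff)
    moreover have "\<forall>i. x $ i \<noteq> 0 \<longrightarrow> ord i < Suc (Max (range ord))"
      by (simp add: less_Suc_eq_le)
    ultimately have "\<exists>m. x $ m \<noteq> 0 \<and> (\<forall>i. x $ i \<noteq> 0 \<longrightarrow> ord i \<le> ord m)"
      by (rule Lattices_Big.ex_has_greatest_nat)
    then obtain m where m: "x $ m \<noteq> 0" "\<And>i. x $ i \<noteq> 0 \<Longrightarrow> ord i \<le> ord m"
      by blast
    have "0 = (\<Sum>i\<in>UNIV. x $ i *\<^sub>R ?col i)"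
      using that(2) unfolding matrix_mult_sum [of P x]
      by (simp add: matrix_vector_mult_basis scalar_mult_eq_scaleR)
    also have "\<dots> = x $ m *\<^sub>R ?col m + (\<Sum>i\<in>UNIV - {m}. x $ i *\<^sub>R ?col i)"
      by (simp add: sum.remove)
    finally have "x $ m *\<^sub>R ?col m = - (\<Sum>i\<in>UNIV - {m}. x $ i *\<^sub>R ?col i)"
      by (metis eq_neg_iff_add_eq_0)
    then have "(1 / x $ m) *\<^sub>R (x $ m *\<^sub>R ?col m) =
        (1 / x $ m) *\<^sub>R - (\<Sum>i\<in>UNIV - {m}. x $ i *\<^sub>R ?col i)"
      by (rule arg_cong)
    then have "?col m = (1 / x $ m) *\<^sub>R - (\<Sum>i\<in>UNIV - {m}. x $ i *\<^sub>R ?col i)"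
      using m(1) by simp
    also have "\<dots> \<in> span (?col ` {i. ord i < ord m})"
    proof (rule span_scale, rule span_neg, rule span_sum)
      fix i assume "i \<in> UNIV - {m}"
      show "x $ i *\<^sub>R ?col i \<in> span (?col ` {i. ord i < ord m})"
      proof (cases "x $ i = 0")
        case False
        then have "ord i < ord m"
          using m(2) \<open>i \<in> UNIV - {m}\<close> ord by (metis Diff_iff injD insertI1 order_le_imp_less_or_eq)
        then show ?thesis by (intro span_scale span_base) auto
      qed (simp add: span_zero)
    qed
    finally have "m \<notin> J" by (simp add: J_def)
    with supp m(1) show False by blast
  qed
  then have det: "det (chart_block J P) \<noteq> 0"
    by (rule det_chart_block_if_independent [OF P])
  have card: "card J = k"
    using Grassmannian_card_eq [OF P det a eq] .
  then have "graph_projection J a = P"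
    using graph_projection_eq_iff [OF _ a] P eq by blast
  then have "chart J P = a"
    using chart_graph_projection [OF a] by simp
  then have "in_Schubert_cell ord J P"
    using det by (auto simp: in_Schubert_cell_def a_def split: if_splits)
  with card show ?thesis by blast
qed

text \<open>The first index in which two sets of pivots differ would be a pivot that depends on
  earlier pivots.\<close>

lemma Schubert_cell_unique:
  fixes P :: "real ^ 'm::finite ^ 'm"
  assumes P: "P \<in> Grassmannian (card J)" "P \<in> Grassmannian (card J')"
    and J: "in_Schubert_cell ord J P" and J': "in_Schubert_cell ord J' P"
  shows "J = J'"
proof -
  have False if P: "P \<in> Grassmannian (card J)"
    and J: "in_Schubert_cell ord J P" and J': "in_Schubert_cell ord J' P"
    and m: "m \<notin> J" "m \<in> J'" and least: "\<And>j. ord j < ord m \<Longrightarrow> j \<in> J \<longleftrightarrow> j \<in> J'"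
    for J J' :: "'m set" and m
  proof -
    let ?a = "chart J P"
    have det: "det (chart_block J P) \<noteq> 0"
      using J by (simp add: in_Schubert_cell_def)
    have a: "off_block J ?a"
      by (rule off_block_chart [OF P det])
    have eq: "P = P ** (coord_proj J + transpose ?a)"
      using graph_projection_chart [OF P det] graph_projection_eq_iff [OF P a] by simp
    define x where "x = axis m 1 - (coord_proj J + transpose ?a) *v axis m 1"
    have x: "x $ j = (if j = m then 1 else 0) - ?a $ m $ j" for j
      using m(1)
      by (auto simp: x_def mult_axis_nth axis_one_nth coord_proj_def transpose_def)
    have "P *v x = P *v axis m 1 - (P ** (coord_proj J + transpose ?a)) *v axis m 1"
      by (simp add: x_def matrix_vector_mult_diff_distrib matrix_vector_mul_assoc)
    then have "P *v x = 0"
      using eq by simp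
    moreover have "x $ j = 0" if "j \<notin> J'" for j
    proof -
      have "?a $ m $ j = 0"
        using that J a least [of j] unfolding in_Schubert_cell_def off_block_def by blast
      then show ?thesis
        using that m(2) x [of j] by auto
    qed
    ultimately have "x = 0"
      using chart_block_kernel J' unfolding in_Schubert_cell_def by blast
    moreover have "?a $ m $ m = 0"
      using a m(1) unfolding off_block_def by blast
    ultimately show False
      using x [of m] by simp
  qed
  note main = this
  show ?thesis
  proof (rule ccontr)
    assume "J \<noteq> J'"
    then have "\<exists>m. (m \<in> J) \<noteq> (m \<in> J')" by blast
    then obtain m where m: "(m \<in> J) \<noteq> (m \<in> J')"
      "\<And>j. ord j < ord m \<Longrightarrow> \<not> (j \<in> J) \<noteq> (j \<in> J')"
      using ex_has_least_nat [of "\<lambda>m. (m \<in> J) \<noteq> (m \<in> J')" _ ord] by (metis not_less)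
    show False
    proof (cases "m \<in> J")
      case True
      then show False using main [OF P(2) J' J, of m] m by blast
    next
      case False
      then show False using main [OF P(1) J J', of m] m by blast
    qed
  qed
qed

section \<open>Frames whose measurements are not injective\<close>

lemma rational_in_mono: "rational_in S X f \<Longrightarrow> X \<subseteq> Y \<Longrightarrow> rational_in S Y f"
  by (induction rule: rational_in.induct) (auto intro: rational_in.intros)

lemma rational_in_inner:
  fixes f g :: "'s \<Rightarrow> real ^ 'm::finite"
  assumes "\<And>r. rational_in S X (\<lambda>s. f s $ r)" "\<And>r. rational_in S X (\<lambda>s. g s $ r)"
  shows "rational_in S X (\<lambda>s. f s \<bullet> g s)"
  unfolding inner_vec_def inner_real_def by (intro rational_in_sum rational_in.mult assms)

lemma solve_linear_coordinate:
  fixes x y :: "real ^ 'm::finite"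
  assumes "x \<bullet> y = d" "y $ e \<noteq> 0"
  shows "x $ e = (d - (\<Sum>r\<in>UNIV - {e}. x $ r * y $ r)) / y $ e"
proof -
  have "d = x $ e * y $ e + (\<Sum>r\<in>UNIV - {e}. x $ r * y $ r)"
    using assms(1) by (simp add: inner_vec_def sum.remove [of UNIV e])
  then show ?thesis
    using assms(2) by (simp add: field_simps)
qed

lemma rational_in_coordinate:
  fixes x y :: "'s \<Rightarrow> real ^ 'm::finite"
  assumes "\<And>r. r \<noteq> e \<Longrightarrow> rational_in S X (\<lambda>s. x s $ r)" "\<And>r. rational_in S X (\<lambda>s. y s $ r)"
    and "rational_in S X d"
    and "\<And>s. s \<in> S \<Longrightarrow> x s \<bullet> y s = d s" "\<And>s. s \<in> S \<Longrightarrow> y s $ e \<noteq> 0"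
  shows "rational_in S X (\<lambda>s. x s $ r)"
proof (cases "r = e")
  case True
  have "rational_in S X (\<lambda>s. (d s - (\<Sum>r\<in>UNIV - {e}. x s $ r * y s $ r)) / y s $ e)"
    using assms by (intro rational_in_divide rational_in_diff rational_in_sum rational_in.mult) auto
  then have "rational_in S X (\<lambda>s. x s $ e)"
    by (rule rational_in.cong) (rule solve_linear_coordinate, use assms in auto)
  with True show ?thesis by simp
qed (use assms in auto)

text \<open>\<open>T c\<close> is the orthogonal projection of \<open>v\<close> onto the span of the columns of \<open>T\<close> in \<open>J\<close>, and
  it is orthogonal to \<open>u\<close>.\<close>

definition orthogonal_witness ::
    "'m set \<Rightarrow> real ^ 'm ^ 'm \<Rightarrow> real ^ 'm \<Rightarrow> real ^ 'm \<Rightarrow> real ^ 'm \<Rightarrow> bool" where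
  "orthogonal_witness J T u v c \<longleftrightarrow> (\<forall>j. j \<notin> J \<longrightarrow> c $ j = 0) \<and> u \<bullet> (T *v c) = 0 \<and>
     (\<forall>j\<in>J. column j T \<bullet> (v - T *v c) = 0)"

text \<open>Nonzero vectors \<open>u\<close>, \<open>v\<close> impose one equation on the matrix \<open>T\<close>.  The point is that its
  solutions can be parametrized rationally, over the coordinates of \<open>u\<close> and \<open>v\<close>, by fewer parameters
  than \<open>T\<close> has entries.  There are
  three types of solutions: the projection \<open>w\<close> of \<open>v\<close> vanishes, \<open>w = v\<close>, or neither.  In the last
  case \<open>w\<close> is the point other than \<open>0\<close> at which the line that it spans meets the sphere
  \<open>w \<bullet> w = w \<bullet> v\<close>, and so a rational function of the ratios of its coordinates.\<close>

context
  fixes S :: "'s set" and X :: "('s \<Rightarrow> real) set" and J :: "'m::finite set"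
    and T :: "'s \<Rightarrow> real ^ 'm ^ 'm" and u v c :: "'s \<Rightarrow> real ^ 'm"
  assumes J: "1 \<le> card J" "card J \<le> CARD('m) - 1"
    and u: "\<And>r. rational_in S X (\<lambda>s. u s $ r)" and v: "\<And>r. rational_in S X (\<lambda>s. v s $ r)"
    and witness: "\<And>s. s \<in> S \<Longrightarrow> orthogonal_witness J (T s) (u s) (v s) (c s)"
begin

private abbreviation (input) "w s \<equiv> T s *v c s"
private abbreviation (input) "entry \<equiv> \<lambda>(r, l) s. T s $ r $ l"

lemma column_nth: "column l (T s) $ r = T s $ r $ l"
  by (simp add: column_def)

lemma rational_in_last_column:
  assumes T: "\<And>r l. l \<noteq> j \<Longrightarrow> rational_in S Y (\<lambda>s. T s $ r $ l)"
    and c: "\<And>l. l \<in> J \<Longrightarrow> rational_in S Y (\<lambda>s. c s $ l)"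
    and w: "\<And>r. rational_in S Y (\<lambda>s. w s $ r)"
    and cj: "\<And>s. s \<in> S \<Longrightarrow> c s $ j \<noteq> 0"
  shows "rational_in S Y (\<lambda>s. T s $ r $ l)"
proof -
  have c': "rational_in S Y (\<lambda>s. c s $ l)" for l
  proof (cases "l \<in> J")
    case False
    show ?thesis
      by (rule rational_in.cong [OF rational_in.const [of _ _ 0]])
        (use False witness in \<open>auto simp: orthogonal_witness_def\<close>)
  qed (rule c)
  show ?thesis
    by (rule rational_in_coordinate [of j S Y "\<lambda>s. T s $ r" c "\<lambda>s. w s $ r"])
      (use T c' w cj in \<open>auto simp: matrix_vector_mul_component\<close>)
qed

lemma parametrize_zero:
  assumes "\<And>s. s \<in> S \<Longrightarrow> w s = 0" "\<And>s. s \<in> S \<Longrightarrow> v s $ a' = 1"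
  shows "\<exists>Y. finite Y \<and> card Y \<le> CARD('m) * CARD('m) - 1 \<and>
    (\<forall>r l. rational_in S (X \<union> Y) (\<lambda>s. T s $ r $ l))"
proof -
  obtain j where j: "j \<in> J"
    using J(1) by (metis card.empty ex_in_conv not_one_le_zero)
  define Y where "Y = entry ` (UNIV - {(a', j)})"
  have gen: "rational_in S (X \<union> Y) (\<lambda>s. T s $ r $ l)" if "(r, l) \<noteq> (a', j)" for r l
    by (intro rational_in.gen) (use that in \<open>force simp: Y_def\<close>)
  have "rational_in S (X \<union> Y) (\<lambda>s. column j (T s) $ r)" for r
  proof (rule rational_in_coordinate [of a' S "X \<union> Y" "\<lambda>s. column j (T s)" v "\<lambda>s. 0"])
    show "column j (T s) \<bullet> v s = 0" if "s \<in> S" for s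
      using witness [OF that] assms(1) [OF that] j by (auto simp: orthogonal_witness_def)
  qed (use gen assms(2) in \<open>auto simp: column_nth intro: rational_in.const rational_in_mono [OF v]\<close>)
  then have "rational_in S (X \<union> Y) (\<lambda>s. T s $ r $ l)" for r l
    using gen by (cases "l = j") (auto simp: column_nth)
  moreover have "card Y \<le> CARD('m) * CARD('m) - 1"
    unfolding Y_def by (rule order_trans [OF card_image_le]) (simp_all add: card_Diff_singleton)
  ultimately show ?thesis
    by (intro exI [of _ Y]) (simp add: Y_def)
qed

lemma parametrize_full:
  assumes "\<And>s. s \<in> S \<Longrightarrow> v s = w s" "\<And>s. s \<in> S \<Longrightarrow> c s $ j \<noteq> 0"
  shows "\<exists>Y. finite Y \<and> card Y \<le> CARD('m) * CARD('m) - 1 \<and>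
    (\<forall>r l. rational_in S (X \<union> Y) (\<lambda>s. T s $ r $ l))"
proof -
  \<comment> \<open>the \<open>M\<close> entries of column \<open>j\<close> are replaced by at most \<open>M - 1\<close> coefficients\<close>
  define A :: "('m \<times> 'm) set" where "A = UNIV - UNIV \<times> {j}"
  define Y where "Y = entry ` A \<union> (\<lambda>l s. c s $ l) ` J"
  have "rational_in S (X \<union> Y) (\<lambda>s. T s $ r $ l)" for r l
  proof (rule rational_in_last_column)
    show "rational_in S (X \<union> Y) (\<lambda>s. T s $ r $ l)" if "l \<noteq> j" for r l
      by (intro rational_in.gen) (use that in \<open>force simp: Y_def A_def\<close>)
    show "rational_in S (X \<union> Y) (\<lambda>s. c s $ l)" if "l \<in> J" for l
      by (intro rational_in.gen) (use that in \<open>auto simp: Y_def\<close>)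
    show "rational_in S (X \<union> Y) (\<lambda>s. w s $ r)" for r
      by (rule rational_in.cong [OF rational_in_mono [OF v]]) (use assms(1) in auto)
  qed (rule assms(2))
  moreover have "card Y \<le> CARD('m) * CARD('m) - 1"
  proof -
    have "card A = CARD('m) * CARD('m) - CARD('m)"
      unfolding A_def by (simp add: card_Diff_subset)
    moreover have "card Y \<le> card A + card J"
      unfolding Y_def by (intro order_trans [OF card_Un_le] add_mono card_image_le) auto
    moreover have "CARD('m) * 1 \<le> CARD('m) * CARD('m)"
      by (intro mult_le_mono) (simp_all add: Suc_le_eq)
    ultimately show ?thesis
      using J by linarith
  qed
  ultimately show ?thesis
    by (intro exI [of _ Y]) (simp add: Y_def)
qed

lemma parametrize_generic:
  assumes ab: "a \<noteq> b" and jJ: "j \<in> J"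
    and ua: "\<And>s. s \<in> S \<Longrightarrow> u s $ a = 1" and wb: "\<And>s. s \<in> S \<Longrightarrow> w s $ b \<noteq> 0"
    and ne: "\<And>s. s \<in> S \<Longrightarrow> (v s - w s) $ e \<noteq> 0" and cj: "\<And>s. s \<in> S \<Longrightarrow> c s $ j \<noteq> 0"
  shows "\<exists>Y. finite Y \<and> card Y \<le> CARD('m) * CARD('m) - 1 \<and>
    (\<forall>r l. rational_in S (X \<union> Y) (\<lambda>s. T s $ r $ l))"
proof -
  \<comment> \<open>For \<open>k = card J\<close>, the \<open>M\<close> entries of column \<open>j\<close> and the \<open>k - 1\<close> entries in row \<open>e\<close> of the other
    columns in \<open>J\<close> are replaced by \<open>k\<close> coefficients and \<open>M - 2\<close> ratios of coordinates of \<open>w\<close>; of the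
    other two ratios, \<open>u \<bullet> w = 0\<close> determines the one at \<open>a\<close>, and the one at \<open>b\<close> is \<open>1\<close>.\<close>
  define A :: "('m \<times> 'm) set" where "A = UNIV - (UNIV \<times> {j} \<union> {e} \<times> (J - {j}))"
  define p where "p s = (1 / w s $ b) *\<^sub>R w s" for s
  define Y where "Y = entry ` A \<union> (\<lambda>l s. c s $ l) ` J \<union> (\<lambda>r s. p s $ r) ` (UNIV - {a, b})"
  have gen: "rational_in S (X \<union> Y) (\<lambda>s. T s $ r $ l)" if "(r, l) \<in> A" for r l
    by (intro rational_in.gen) (use that in \<open>force simp: Y_def\<close>)
  have c: "rational_in S (X \<union> Y) (\<lambda>s. c s $ l)" if "l \<in> J" for l
    by (intro rational_in.gen) (use that in \<open>auto simp: Y_def\<close>)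
  have u': "rational_in S (X \<union> Y) (\<lambda>s. u s $ r)" and v': "rational_in S (X \<union> Y) (\<lambda>s. v s $ r)" for r
    by (auto intro: rational_in_mono [OF u] rational_in_mono [OF v])
  have p: "rational_in S (X \<union> Y) (\<lambda>s. p s $ r)" for r
  proof (rule rational_in_coordinate [of a S "X \<union> Y" p u "\<lambda>s. 0"])
    show "p s \<bullet> u s = 0" if "s \<in> S" for s
      using witness [OF that] by (simp add: p_def orthogonal_witness_def inner_commute)
    show "rational_in S (X \<union> Y) (\<lambda>s. p s $ r)" if "r \<noteq> a" for r
    proof (cases "r = b")
      case True
      show ?thesis
        by (rule rational_in.cong [OF rational_in.const [of _ _ 1]]) (use True wb in \<open>auto simp: p_def\<close>)
    next
      case False
      with that show ?thesis
        by (intro rational_in.gen) (auto simp: Y_def)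
    qed
  qed (use ua u' in \<open>auto intro: rational_in.const\<close>)
  have p0: "p s \<bullet> p s \<noteq> 0" if "s \<in> S" for s
    using wb [OF that] by (auto simp: p_def)
  have wv: "w s \<bullet> (v s - w s) = 0" if "s \<in> S" for s
  proof -
    have "w s = (\<Sum>l\<in>UNIV. c s $ l *\<^sub>R column l (T s))"
      by (simp add: matrix_mult_sum scalar_mult_eq_scaleR)
    from arg_cong [OF this, of "\<lambda>x. x \<bullet> (v s - w s)"]
    have "w s \<bullet> (v s - w s) = (\<Sum>l\<in>UNIV. c s $ l * (column l (T s) \<bullet> (v s - w s)))"
      unfolding inner_sum_left inner_scaleR_left .
    also have "\<dots> = 0"
      using witness [OF that] by (intro sum.neutral) (auto simp: orthogonal_witness_def)
    finally show ?thesis .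
  qed
  have wb_eq: "w s $ b = (p s \<bullet> v s) / (p s \<bullet> p s)" if "s \<in> S" for s
  proof -
    have "w s \<bullet> v s = w s $ b * (p s \<bullet> v s)" "w s \<bullet> w s = w s $ b * (w s $ b * (p s \<bullet> p s))"
      using wb [OF that] by (simp_all add: p_def)
    then have "w s $ b * (p s \<bullet> v s) = w s $ b * (w s $ b * (p s \<bullet> p s))"
      using wv [OF that] by (simp add: inner_diff_right)
    then have "p s \<bullet> v s = w s $ b * (p s \<bullet> p s)"
      using wb [OF that] by simp
    then show ?thesis
      using p0 [OF that] by (simp add: field_simps)
  qed
  have w: "rational_in S (X \<union> Y) (\<lambda>s. w s $ r)" for r
  proof -
    have "rational_in S (X \<union> Y) (\<lambda>s. (p s \<bullet> v s) / (p s \<bullet> p s) * p s $ r)"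
      using p0 by (intro rational_in.mult rational_in_divide rational_in_inner p v')
    then show ?thesis
    proof (rule rational_in.cong)
      fix s assume s: "s \<in> S"
      show "w s $ r = (p s \<bullet> v s) / (p s \<bullet> p s) * p s $ r"
        using wb [OF s] unfolding wb_eq [OF s, symmetric] by (simp add: p_def)
    qed
  qed
  have "rational_in S (X \<union> Y) (\<lambda>s. T s $ r $ l)" if "l \<noteq> j" for r l
  proof (cases "l \<in> J")
    case True
    have "rational_in S (X \<union> Y) (\<lambda>s. column l (T s) $ r)"
    proof (rule rational_in_coordinate [of e S "X \<union> Y" "\<lambda>s. column l (T s)" "\<lambda>s. v s - w s" "\<lambda>s. 0"])
      show "rational_in S (X \<union> Y) (\<lambda>s. column l (T s) $ r)" if "r \<noteq> e" for r
        unfolding column_nth using that \<open>l \<noteq> j\<close> by (intro gen) (auto simp: A_def)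
      show "rational_in S (X \<union> Y) (\<lambda>s. (v s - w s) $ r)" for r
        unfolding vector_minus_component by (intro rational_in_diff v' w)
      show "column l (T s) \<bullet> (v s - w s) = 0" if "s \<in> S" for s
        using witness [OF that] True by (simp add: orthogonal_witness_def)
    qed (use ne in \<open>auto intro: rational_in.const\<close>)
    then show ?thesis by (simp add: column_nth)
  next
    case False
    with that show ?thesis by (intro gen) (auto simp: A_def)
  qed
  then have "rational_in S (X \<union> Y) (\<lambda>s. T s $ r $ l)" for r l
    by (rule rational_in_last_column [OF _ c w cj])
  moreover have "card Y \<le> CARD('m) * CARD('m) - 1"
  proof -
    have "card (UNIV \<times> {j} \<union> {e} \<times> (J - {j})) = CARD('m) + (card J - 1)"
      using jJ by (subst card_Un_disjoint) (auto simp: card_cartesian_product)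
    then have "card A = CARD('m) * CARD('m) - (CARD('m) + (card J - 1))"
      unfolding A_def by (subst card_Diff_subset) auto
    moreover have "card (UNIV - {a, b}) = CARD('m) - 2"
      using ab by (subst card_Diff_subset) auto
    moreover have "card Y \<le> card A + card J + card (UNIV - {a, b})"
      unfolding Y_def by (intro order_trans [OF card_Un_le] add_mono card_image_le) auto
    moreover have "2 * CARD('m) \<le> CARD('m) * CARD('m)" "CARD('m) \<ge> 2"
      using J by (auto intro!: mult_le_mono1)
    ultimately show ?thesis
      using J by linarith
  qed
  ultimately show ?thesis
    by (intro exI [of _ Y]) (simp add: Y_def)
qed

end

text \<open>The matrices of bad tuples: a common \<open>u\<close> is orthogonal to all projections of a common \<open>v\<close>.\<close>

definition degenerate :: "('n \<Rightarrow> 'm set) \<Rightarrow> real ^ 'm ^ 'm ^ 'n \<Rightarrow> bool" where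
  "degenerate J T \<longleftrightarrow> (\<exists>u v c. u \<noteq> 0 \<and> v \<noteq> 0 \<and> (\<forall>i. orthogonal_witness (J i) (T $ i) u v (c $ i)))"

text \<open>A label consists of indices of coordinates that do not vanish: \<open>b\<close> for the projection \<open>w\<close>,
  \<open>e\<close> for \<open>v - w\<close> and \<open>j\<close> for the coefficients; \<open>None\<close> stands for the zero vector.\<close>

definition has_label ::
    "'m \<Rightarrow> 'm option \<times> 'm option \<times> 'm \<Rightarrow> real ^ 'm \<Rightarrow> real ^ 'm \<Rightarrow> real ^ 'm \<Rightarrow> bool" where
  "has_label a l v w c \<longleftrightarrow> (case l of (\<beta>, \<epsilon>, j) \<Rightarrow>
     (case \<beta> of None \<Rightarrow> w = 0
      | Some b \<Rightarrow> b \<noteq> a \<and> w $ b \<noteq> 0 \<and> c $ j \<noteq> 0 \<and>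
          (case \<epsilon> of None \<Rightarrow> v = w | Some e \<Rightarrow> (v - w) $ e \<noteq> 0)))"

type_synonym ('m, 'n) configuration =
  "(real ^ 'm ^ 'm ^ 'n) \<times> (real ^ 'm) \<times> (real ^ 'm) \<times> (real ^ 'm ^ 'n)"

definition stratum :: "('n::finite \<Rightarrow> 'm::finite set) \<Rightarrow> 'm \<Rightarrow> 'm \<Rightarrow> ('n \<Rightarrow> 'm option \<times> 'm option \<times> 'm) \<Rightarrow>
    ('m, 'n) configuration set" where
  "stratum J a a' l = {(T, u, v, c). u $ a = 1 \<and> v $ a' = 1 \<and>
     (\<forall>i. orthogonal_witness (J i) (T $ i) u v (c $ i) \<and> has_label a (l i) v (T $ i *v c $ i) (c $ i))}"

lemma has_label_exists:
  fixes u v w c :: "real ^ 'm::finite"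
  assumes "u $ a = 1" "u \<bullet> w = 0" "w \<noteq> 0 \<Longrightarrow> c \<noteq> 0"
  shows "\<exists>l. has_label a l v w c"
proof (cases "w = 0")
  case True
  then show ?thesis
    by (intro exI [of _ "(None, None, undefined)"]) (simp add: has_label_def)
next
  case False
  have "\<exists>b. b \<noteq> a \<and> w $ b \<noteq> 0"
  proof (rule ccontr)
    assume "\<not> ?thesis"
    then have z: "w $ r = 0" if "r \<noteq> a" for r
      using that by blast
    have "w $ a = (0 - (\<Sum>r\<in>UNIV - {a}. w $ r * u $ r)) / u $ a"
      by (rule solve_linear_coordinate) (use assms in \<open>auto simp: inner_commute\<close>)
    then have "w $ a = 0"
      using z by simp
    with z have "w = 0" by (metis vec_eq_iff zero_index)
    with False show False ..
  qed
  then obtain b where b: "b \<noteq> a" "w $ b \<noteq> 0" by blast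
  obtain j where j: "c $ j \<noteq> 0"
    using assms(3) [OF False] by (metis vec_eq_iff zero_index)
  show ?thesis
  proof (cases "v = w")
    case True
    with b j show ?thesis
      by (intro exI [of _ "(Some b, None, j)"]) (simp add: has_label_def)
  next
    case False
    then obtain e where "(v - w) $ e \<noteq> 0"
      by (metis right_minus_eq vec_eq_iff zero_index)
    with b j show ?thesis
      by (intro exI [of _ "(Some b, Some e, j)"]) (simp add: has_label_def)
  qed
qed

lemma degenerate_in_stratum:
  fixes T :: "real ^ 'm::finite ^ 'm ^ 'n::finite"
  assumes "degenerate J T"
  shows "\<exists>a a' l u v c. (T, u, v, c) \<in> stratum J a a' l"
proof -
  obtain u v c where uv: "u \<noteq> 0" "v \<noteq> 0" and wit: "\<And>i. orthogonal_witness (J i) (T $ i) u v (c $ i)"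
    using assms unfolding degenerate_def by blast
  obtain a where a: "u $ a \<noteq> 0"
    using uv(1) by (metis vec_eq_iff zero_index)
  obtain a' where a': "v $ a' \<noteq> 0"
    using uv(2) by (metis vec_eq_iff zero_index)
  define u' where "u' = (1 / u $ a) *\<^sub>R u"
  define v' where "v' = (1 / v $ a') *\<^sub>R v"
  define c' where "c' = (1 / v $ a') *\<^sub>R c"
  have Tc: "T $ i *v c' $ i = (1 / v $ a') *\<^sub>R (T $ i *v c $ i)" for i
    by (simp add: c'_def matrix_vector_mult_scaleR)
  have wit': "orthogonal_witness (J i) (T $ i) u' v' (c' $ i)" for i
    using wit [of i] unfolding orthogonal_witness_def Tc
    by (simp add: u'_def v'_def c'_def scaleR_diff_right [symmetric])
  have ua: "u' $ a = 1" and va: "v' $ a' = 1"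
    using a a' by (simp_all add: u'_def v'_def)
  have "\<exists>l. has_label a l v' (T $ i *v c' $ i) (c' $ i)" for i
    using wit' [of i] by (intro has_label_exists [OF ua]) (auto simp: orthogonal_witness_def)
  then have "\<forall>i. \<exists>l. has_label a l v' (T $ i *v c' $ i) (c' $ i)"
    by blast
  from choice [OF this] obtain l where "\<forall>i. has_label a (l i) v' (T $ i *v c' $ i) (c' $ i)"
    by blast
  with wit' ua va have "(T, u', v', c') \<in> stratum J a a' l"
    by (simp add: stratum_def)
  then show ?thesis by blast
qed

text \<open>The parameters are \<open>M - 1\<close> coordinates each of \<open>u\<close> and \<open>v\<close>, the remaining one being \<open>1\<close>, and
  \<open>M^2 - 1\<close> for each of the \<open>N\<close> matrices.  Their number \<open>2 (M - 1) + N (M^2 - 1)\<close> is less than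
  \<open>N M^2\<close>, the number of matrix entries, if and only if \<open>N \<ge> 2 M - 1\<close>.\<close>

lemma stratum_polynomial:
  fixes J :: "'n::finite \<Rightarrow> 'm::finite set"
  assumes N: "CARD('n) \<ge> 2 * CARD('m) - 1"
    and J: "\<And>i. 1 \<le> card (J i) \<and> card (J i) \<le> CARD('m) - 1"
  obtains p :: "real ^ 'm ^ 'm ^ 'n \<Rightarrow> real"
    where "real_polynomial_function p" "\<exists>T. p T \<noteq> 0" "\<And>s. s \<in> stratum J a a' l \<Longrightarrow> p (fst s) = 0"
proof -
  let ?S = "stratum J a a' l"
  define T where "T s = fst s" for s :: "('m, 'n) configuration"
  define u where "u s = fst (snd s)" for s :: "('m, 'n) configuration"
  define v where "v s = fst (snd (snd s))" for s :: "('m, 'n) configuration"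
  define c where "c s = snd (snd (snd s))" for s :: "('m, 'n) configuration"
  have S: "u s $ a = 1" "v s $ a' = 1" "orthogonal_witness (J i) (T s $ i) (u s) (v s) (c s $ i)"
    "has_label a (l i) (v s) (T s $ i *v c s $ i) (c s $ i)" if "s \<in> ?S" for s i
    using that by (auto simp: stratum_def T_def u_def v_def c_def)
  define X where "X = (\<lambda>r s. u s $ r) ` (UNIV - {a}) \<union> (\<lambda>r s. v s $ r) ` (UNIV - {a'})"
  have u: "rational_in ?S X (\<lambda>s. u s $ r)" for r
  proof (cases "r = a")
    case True
    show ?thesis
      by (rule rational_in.cong [OF rational_in.const [of _ _ 1]]) (use True S in auto)
  qed (auto intro: rational_in.gen simp: X_def)
  have v: "rational_in ?S X (\<lambda>s. v s $ r)" for r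
  proof (cases "r = a'")
    case True
    show ?thesis
      by (rule rational_in.cong [OF rational_in.const [of _ _ 1]]) (use True S in auto)
  qed (auto intro: rational_in.gen simp: X_def)
  have "\<exists>Y. finite Y \<and> card Y \<le> CARD('m) * CARD('m) - 1 \<and>
    (\<forall>r m. rational_in ?S (X \<union> Y) (\<lambda>s. T s $ i $ r $ m))" for i
  proof -
    obtain \<beta> \<epsilon> j where li: "l i = (\<beta>, \<epsilon>, j)"
      by (cases "l i")
    note * = J [of i, THEN conjunct1] J [of i, THEN conjunct2] u v S(3) [of _ i]
    show ?thesis
    proof (cases \<beta>)
      case None
      show ?thesis
      proof (rule parametrize_zero [where T = "\<lambda>s. T s $ i" and c = "\<lambda>s. c s $ i", OF *])
        show "T s $ i *v c s $ i = 0" if "s \<in> ?S" for s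
          using S(4) [OF that, of i] None li by (simp add: has_label_def)
      qed (use S in auto)
    next
      case b: (Some b)
      show ?thesis
      proof (cases \<epsilon>)
        case None
        show ?thesis
        proof (rule parametrize_full [where T = "\<lambda>s. T s $ i" and c = "\<lambda>s. c s $ i", OF *])
          show "v s = T s $ i *v c s $ i" "c s $ i $ j \<noteq> 0" if "s \<in> ?S" for s
            using S(4) [OF that, of i] b None li by (auto simp: has_label_def)
        qed auto
      next
        case (Some e)
        have label: "a \<noteq> b" "(T s $ i *v c s $ i) $ b \<noteq> 0" "c s $ i $ j \<noteq> 0"
          "(v s - T s $ i *v c s $ i) $ e \<noteq> 0" if "s \<in> ?S" for s
          using S(4) [OF that, of i] b Some li by (auto simp: has_label_def)
        show ?thesis
        proof (cases "?S = {}")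
          case True
          then show ?thesis
            by (intro exI [of _ "{}"]) (auto intro: rational_in.cong [OF rational_in.const])
        next
          case False
          then obtain s0 where "s0 \<in> ?S" by blast
          then have "a \<noteq> b" "j \<in> J i"
            using label(1,3) [of s0] S(3) [of s0 i] by (auto simp: orthogonal_witness_def)
          show ?thesis
            by (rule parametrize_generic [where T = "\<lambda>s. T s $ i" and c = "\<lambda>s. c s $ i",
                  OF * \<open>a \<noteq> b\<close> \<open>j \<in> J i\<close> S(1) label(2,4,3)])
        qed
      qed
    qed
  qed
  then have "\<forall>i. \<exists>Y. finite Y \<and> card Y \<le> CARD('m) * CARD('m) - 1 \<and>
    (\<forall>r m. rational_in ?S (X \<union> Y) (\<lambda>s. T s $ i $ r $ m))"
    by blast
  from choice [OF this] obtain Y where Y: "\<And>i. finite (Y i)" "\<And>i. card (Y i) \<le> CARD('m) * CARD('m) - 1"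
    "\<And>i r m. rational_in ?S (X \<union> Y i) (\<lambda>s. T s $ i $ r $ m)"
    by blast
  let ?Z = "X \<union> (\<Union>i. Y i)"
  have "card X \<le> (CARD('m) - 1) + (CARD('m) - 1)"
    unfolding X_def by (intro order_trans [OF card_Un_le] add_mono order_trans [OF card_image_le]) auto
  moreover have "card (\<Union>i. Y i) \<le> CARD('n) * (CARD('m) * CARD('m)) - CARD('n)"
  proof -
    have "card (\<Union>i. Y i) \<le> (\<Sum>i\<in>UNIV. card (Y i))"
      by (rule card_UN_le) simp
    also have "\<dots> \<le> (\<Sum>i\<in>(UNIV :: 'n set). CARD('m) * CARD('m) - 1)"
      by (intro sum_mono Y)
    also have "\<dots> = CARD('n) * (CARD('m) * CARD('m)) - CARD('n)"
      by (simp add: diff_mult_distrib2)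
    finally show ?thesis .
  qed
  moreover have "CARD('n) \<le> CARD('n) * (CARD('m) * CARD('m))"
    by simp
  moreover have "CARD('m) \<ge> 1" "CARD('n) \<ge> 1"
    by (simp_all add: Suc_le_eq)
  moreover have "card ?Z \<le> card X + card (\<Union>i. Y i)"
    by (rule card_Un_le)
  ultimately have "card ?Z < CARD('n) * (CARD('m) * CARD('m))"
    using N by linarith
  then have card: "card ?Z < DIM(real ^ 'm ^ 'm ^ 'n)"
    by simp
  have rat: "rational_in ?S ?Z (\<lambda>s. T s \<bullet> b)" if "b \<in> Basis" for b
  proof -
    from that obtain i r m where b: "b = axis i (axis r (axis m 1))"
      by (auto simp: Basis_vec_def)
    have "rational_in ?S ?Z (\<lambda>s. T s $ i $ r $ m)"
      by (rule rational_in_mono [OF Y(3)]) auto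
    then show ?thesis
      by (simp add: b inner_axis)
  qed
  have fin: "finite ?Z"
    using Y(1) by (simp add: X_def)
  show thesis
  proof (rule algebraic_dependence [OF fin card rat])
    fix p assume p: "real_polynomial_function p" "\<exists>y. p y \<noteq> 0" "\<And>s. s \<in> ?S \<Longrightarrow> p (T s) = 0"
    show thesis
      by (rule that [OF p(1,2)]) (use p(3) in \<open>simp add: T_def\<close>)
  qed
qed

theorem degenerate_polynomial:
  fixes J :: "'n::finite \<Rightarrow> 'm::finite set"
  assumes "CARD('n) \<ge> 2 * CARD('m) - 1"
    and "\<And>i. 1 \<le> card (J i) \<and> card (J i) \<le> CARD('m) - 1"
  obtains q :: "real ^ 'm ^ 'm ^ 'n \<Rightarrow> real"
    where "real_polynomial_function q" "\<exists>T. q T \<noteq> 0" "\<And>T. degenerate J T \<Longrightarrow> q T = 0"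
proof -
  have "\<forall>x. \<exists>p. real_polynomial_function p \<and> (\<exists>T. p T \<noteq> 0) \<and>
      (\<forall>s \<in> stratum J (fst x) (fst (snd x)) (snd (snd x)). p (fst s) = 0)"
  proof
    fix x :: "'m \<times> 'm \<times> ('n \<Rightarrow> 'm option \<times> 'm option \<times> 'm)"
    obtain p where "real_polynomial_function p" "\<exists>T. p T \<noteq> 0"
      "\<And>s. s \<in> stratum J (fst x) (fst (snd x)) (snd (snd x)) \<Longrightarrow> p (fst s) = 0"
      by (rule stratum_polynomial [where J = J and a = "fst x" and a' = "fst (snd x)"
            and l = "snd (snd x)", OF assms]) (rule that)
    then show "\<exists>p. real_polynomial_function p \<and> (\<exists>T. p T \<noteq> 0) \<and>
        (\<forall>s \<in> stratum J (fst x) (fst (snd x)) (snd (snd x)). p (fst s) = 0)"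
      by blast
  qed
  from choice [OF this] obtain p where p: "\<And>x. real_polynomial_function (p x)" "\<And>x. \<exists>T. p x T \<noteq> 0"
    "\<And>x s. s \<in> stratum J (fst x) (fst (snd x)) (snd (snd x)) \<Longrightarrow> p x (fst s) = 0"
    by blast
  let ?I = "UNIV :: ('m \<times> 'm \<times> ('n \<Rightarrow> 'm option \<times> 'm option \<times> 'm)) set"
  show thesis
  proof
    show "real_polynomial_function (\<lambda>T. \<Prod>x\<in>?I. p x T)"
      by (intro real_polynomial_function_prod p) simp
    show "\<exists>T. (\<Prod>x\<in>?I. p x T) \<noteq> 0"
      by (intro real_polynomial_function_prod_nonzero p) simp
    fix T assume "degenerate J T"
    then obtain a a' l u v c where "(T, u, v, c) \<in> stratum J a a' l"
      using degenerate_in_stratum by blast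
    then have "p (a, a', l) T = 0"
      using p(3) [of "(T, u, v, c)" "(a, a', l)"] by simp
    then show "(\<Prod>x\<in>?I. p x T) = 0"
      by (intro prod_zero) auto
  qed
qed

section \<open>Genericity\<close>

lemma continuous_on_matrixI:
  assumes "\<And>i j. continuous_on S (\<lambda>x. A x $ i $ j)"
  shows "continuous_on S (A :: 'a::topological_space \<Rightarrow> real ^ 'm::finite ^ 'n::finite)"
proof -
  have "continuous_on S (\<lambda>x. \<chi> i j. A x $ i $ j)"
    by (intro continuous_on_vec_lambda assms)
  then show ?thesis by simp
qed

lemma continuous_on_entry:
  assumes "continuous_on S (A :: 'a::topological_space \<Rightarrow> real ^ 'm::finite ^ 'n::finite)"
  shows "continuous_on S (\<lambda>x. A x $ i $ j)"
  by (intro continuous_on_component assms)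

lemma continuous_on_matrix_mult:
  fixes A B :: "'a::topological_space \<Rightarrow> real ^ 'm::finite ^ 'm"
  assumes "continuous_on S A" "continuous_on S B"
  shows "continuous_on S (\<lambda>x. A x ** B x)"
proof (rule continuous_on_matrixI)
  fix i j
  show "continuous_on S (\<lambda>x. (A x ** B x) $ i $ j)"
    unfolding matrix_matrix_mult_def vec_lambda_beta
    by (intro continuous_intros continuous_on_entry assms)
qed

lemma continuous_on_transpose:
  fixes A :: "'a::topological_space \<Rightarrow> real ^ 'm::finite ^ 'm"
  assumes "continuous_on S A"
  shows "continuous_on S (\<lambda>x. transpose (A x))"
  unfolding transpose_def by (rule continuous_on_matrixI) (simp add: continuous_on_entry assms)

lemma continuous_on_det:
  fixes A :: "'a::topological_space \<Rightarrow> real ^ 'm::finite ^ 'm"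
  assumes "\<And>i j. continuous_on S (\<lambda>x. A x $ i $ j)"
  shows "continuous_on S (\<lambda>x. det (A x))"
  unfolding det_def by (intro continuous_intros assms)

lemma continuous_on_matrix_inv:
  fixes A :: "'a::topological_space \<Rightarrow> real ^ 'm::finite ^ 'm"
  assumes A: "continuous_on S A" and det: "\<And>x. x \<in> S \<Longrightarrow> det (A x) \<noteq> 0"
  shows "continuous_on S (\<lambda>x. matrix_inv (A x))"
proof (rule continuous_on_matrixI)
  fix i j
  have "continuous_on S (\<lambda>x. det (\<chi> r c. if c = i then (if r = j then 1 else 0) else A x $ r $ c))"
  proof (rule continuous_on_det)
    fix r c
    show "continuous_on S (\<lambda>x. (\<chi> r c. if c = i then (if r = j then 1 else 0) else A x $ r $ c) $ r $ c)"
      by (cases "c = i") (simp_all add: continuous_on_entry A)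
  qed
  then have adj: "continuous_on S (\<lambda>x. adjugate (A x) $ i $ j)"
    by (simp add: adjugate_def)
  have "continuous_on S (\<lambda>x. adjugate (A x) $ i $ j / det (A x))"
    by (intro continuous_on_divide adj continuous_on_det continuous_on_entry A) (use det in auto)
  then show "continuous_on S (\<lambda>x. matrix_inv (A x) $ i $ j)"
    by (rule continuous_on_eq) (simp add: matrix_inv_eq_adjugate det)
qed

lemma continuous_on_column_projection:
  fixes T :: "'a::topological_space \<Rightarrow> real ^ 'm::finite ^ 'm"
  assumes T: "continuous_on S T" and indep: "\<And>x. x \<in> S \<Longrightarrow> independent_columns J (T x)"
  shows "continuous_on S (\<lambda>x. column_projection J (T x))"
  unfolding column_projection_def
  by (intro continuous_on_matrix_mult continuous_on_transpose continuous_on_matrix_inv T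
      continuous_on_const det_gram indep)
    (unfold gram_def, intro continuous_on_add continuous_on_matrix_mult continuous_on_transpose T
      continuous_on_const)

lemma continuous_on_chart_block:
  fixes P :: "'a::topological_space \<Rightarrow> real ^ 'm::finite ^ 'm"
  assumes "continuous_on S P"
  shows "continuous_on S (\<lambda>x. chart_block J (P x))"
  unfolding chart_block_def
  by (intro continuous_on_add continuous_on_matrix_mult assms continuous_on_const)

lemma continuous_on_chart:
  fixes P :: "'a::topological_space \<Rightarrow> real ^ 'm::finite ^ 'm"
  assumes "continuous_on S P" and "\<And>x. x \<in> S \<Longrightarrow> det (chart_block J (P x)) \<noteq> 0"
  shows "continuous_on S (\<lambda>x. chart J (P x))"
  unfolding chart_def
  by (intro continuous_on_diff continuous_on_matrix_mult continuous_on_matrix_inv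
      continuous_on_chart_block assms continuous_on_const)

text \<open>A polynomial map in \<open>\<Phi>\<close>.  Where the matrix at \<open>i\<close> is invertible, its columns in \<open>J i\<close> form a
  basis of the image of the projection \<open>\<Phi> $ i\<close> of rank \<open>card (J i)\<close>.  Conversely, every tuple \<open>T\<close> of
  invertible matrices is the frame for \<open>G = T\<close> of the projections onto its columns.\<close>

definition frame :: "('n \<Rightarrow> 'm set) \<Rightarrow> real ^ 'm ^ 'm ^ 'n \<Rightarrow> real ^ 'm ^ 'm ^ 'n \<Rightarrow> real ^ 'm ^ 'm ^ 'n"
  where "frame J G \<Phi> = (\<chi> i. \<Phi> $ i ** G $ i ** coord_proj (J i) + G $ i ** coord_proj (- J i))"

lemma orthogonal_witness_exists:
  fixes P :: "real ^ 'm::finite ^ 'm"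
  assumes P: "P \<in> Grassmannian (card J)" and T: "P ** T ** coord_proj J = T ** coord_proj J" "det T \<noteq> 0"
    and uv: "u \<bullet> (P *v v) = 0"
  shows "\<exists>c. orthogonal_witness J T u v c"
proof -
  define c where "c = coord_proj J *v (matrix_inv (gram J T) *v (coord_proj J *v (transpose T *v v)))"
  have "P = column_projection J T"
    by (rule column_projection_unique [OF independent_columns_if_det [OF T(2)] P T(1)])
  then have Tc: "T *v c = P *v v"
    unfolding c_def column_projection_def
    by (simp only: matrix_vector_mul_assoc matrix_mul_assoc)
  have "column j T \<bullet> (v - P *v v) = 0" if j: "j \<in> J" for j
  proof -
    have "coord_proj J *v axis j 1 = axis j 1"
      using j by (auto simp: vec_eq_iff coord_vector_nth axis_def)
    then have t: "column j T = (T ** coord_proj J) *v axis j 1"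
      by (metis matrix_vector_mul_assoc matrix_vector_mult_basis)
    then have "column j T = P *v column j T"
      using T(1) by (simp add: matrix_vector_mul_assoc matrix_mul_assoc)
    then have "column j T \<bullet> (v - P *v v) = (P *v column j T) \<bullet> (v - P *v v)"
      by (rule arg_cong)
    also have "\<dots> = column j T \<bullet> (P *v (v - P *v v))"
      by (simp only: inner_matrix_transpose GrassmannianD(2) [OF P])
    also have "P *v (v - P *v v) = 0"
      by (simp add: matrix_vector_mult_diff_distrib matrix_vector_mul_assoc GrassmannianD(1) [OF P])
    finally show ?thesis by simp
  qed
  moreover have "c $ j = 0" if "j \<notin> J" for j
    using that by (simp add: c_def coord_vector_nth)
  ultimately have "orthogonal_witness J T u v c"
    using uv by (simp add: orthogonal_witness_def Tc)
  then show ?thesis ..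
qed

text \<open>Two vectors \<open>x\<close>, \<open>y\<close> with the same measurements satisfy
  \<open>(x - y) \<bullet> P (x + y) = P x \<bullet> P x - P y \<bullet> P y = 0\<close> for every projection \<open>P\<close> of the tuple.\<close>

lemma not_injective_orthogonal:
  fixes \<Phi> :: "real ^ 'm::finite ^ 'm ^ 'n::finite"
  assumes \<Phi>: "\<Phi> \<in> Grassmannian_product k"
    and "\<not> inj_on (measurement_map \<Phi>) nonzero_mod_sign"
  shows "\<exists>u v. u \<noteq> 0 \<and> v \<noteq> 0 \<and> (\<forall>i. u \<bullet> (\<Phi> $ i *v v) = 0)"
proof -
  obtain X Y where XY: "X \<in> nonzero_mod_sign" "Y \<in> nonzero_mod_sign" "X \<noteq> Y"
    "measurement_map \<Phi> X = measurement_map \<Phi> Y"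
    using assms(2) unfolding inj_on_def by blast
  obtain x where x: "x \<noteq> 0" "X = sign_rel `` {x}"
    using XY(1) unfolding nonzero_mod_sign_def by (auto elim!: quotientE)
  obtain y where y: "y \<noteq> 0" "Y = sign_rel `` {y}"
    using XY(2) unfolding nonzero_mod_sign_def by (auto elim!: quotientE)
  have eq: "measurements \<Phi> x = measurements \<Phi> y"
    using XY(4) x y by (simp add: measurement_map_class)
  have "sign_rel `` {x} = {x, - x}" "sign_rel `` {y} = {y, - y}"
    using x(1) y(1) by (auto simp: sign_rel_def)
  then have ne: "x - y \<noteq> 0" "x + y \<noteq> 0"
    using XY(3) x(2) y(2) by (auto simp: eq_neg_iff_add_eq_0 [symmetric])
  have "(x - y) \<bullet> (\<Phi> $ i *v (x + y)) = 0" for i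
  proof -
    let ?P = "\<Phi> $ i"
    have P: "?P \<in> Grassmannian (k i)"
      using \<Phi> by (simp add: Grassmannian_product_def)
    have *: "z \<bullet> (?P *v z') = (?P *v z) \<bullet> (?P *v z')" for z z'
      by (simp only: inner_matrix_transpose GrassmannianD(1,2) [OF P] matrix_vector_mul_assoc)
    have "(?P *v x) \<bullet> (?P *v x) = (?P *v y) \<bullet> (?P *v y)"
      using arg_cong [OF eq, of "\<lambda>m. m $ i"] by (simp add: measurements_def)
    then show ?thesis
      by (subst *) (simp add: matrix_vector_mult_diff_distrib matrix_vector_right_distrib
          inner_diff_left inner_diff_right inner_add_right inner_commute)
  qed
  with ne show ?thesis by blast
qed

lemma degenerate_frame:
  fixes \<Phi> :: "real ^ 'm::finite ^ 'm ^ 'n::finite"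
  assumes \<Phi>: "\<Phi> \<in> Grassmannian_product k" and J: "\<And>i. card (J i) = k i"
    and "\<not> inj_on (measurement_map \<Phi>) nonzero_mod_sign"
    and det: "\<And>i. det (frame J G \<Phi> $ i) \<noteq> 0"
  shows "degenerate J (frame J G \<Phi>)"
proof -
  obtain u v where uv: "u \<noteq> 0" "v \<noteq> 0" "\<And>i. u \<bullet> (\<Phi> $ i *v v) = 0"
    using not_injective_orthogonal [OF assms(1,3)] by blast
  have "\<exists>c. orthogonal_witness (J i) (frame J G \<Phi> $ i) u v c" for i
  proof (rule orthogonal_witness_exists [OF _ _ det uv(3)])
    show P: "\<Phi> $ i \<in> Grassmannian (card (J i))"
      using \<Phi> by (simp add: Grassmannian_product_def J)
    have TE: "frame J G \<Phi> $ i ** coord_proj (J i) = \<Phi> $ i ** G $ i ** coord_proj (J i)"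
      by (simp add: frame_def matrix_add_rdistrib matrix_mul_assoc [symmetric] coord_idem
          coord_coord_Compl)
    then show "\<Phi> $ i ** frame J G \<Phi> $ i ** coord_proj (J i) = frame J G \<Phi> $ i ** coord_proj (J i)"
      by (metis GrassmannianD(1) [OF P] matrix_mul_assoc)
  qed
  then have "\<forall>i. \<exists>c. orthogonal_witness (J i) (frame J G \<Phi> $ i) u v c" ..
  from choice [OF this] obtain c where "\<And>i. orthogonal_witness (J i) (frame J G \<Phi> $ i) u v (c i)"
    by blast
  then show ?thesis
    unfolding degenerate_def using uv(1,2)
    by (intro exI [of _ u] exI [of _ v] exI [of _ "\<chi> i. c i"]) simp
qed

lemma real_polynomial_function_frame:
  "real_polynomial_function (\<lambda>\<Phi> :: real ^ 'm::finite ^ 'm ^ 'n::finite. frame J G \<Phi> $ i $ r $ c)"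
  unfolding frame_def vec_lambda_beta vector_add_component
  by (intro real_polynomial_function_basic real_polynomial_function_matrix_mult
      real_polynomial_function_entry)

lemma real_polynomial_function_compose_frame:
  fixes q :: "real ^ 'm::finite ^ 'm ^ 'n::finite \<Rightarrow> real"
  assumes "real_polynomial_function q"
  shows "real_polynomial_function (\<lambda>\<Phi>. q (frame J G \<Phi>))"
proof -
  have "polynomial_function (frame J G :: _ \<Rightarrow> real ^ 'm ^ 'm ^ 'n)"
    unfolding polynomial_function_iff_Basis_inner
    by (auto simp: Basis_vec_def inner_axis real_polynomial_function_frame)
  from real_polynomial_function_compose [OF this assms] show ?thesis
    by (simp add: o_def)
qed

lemma frame_column_projections:
  fixes T :: "real ^ 'm::finite ^ 'm ^ 'n::finite"
  assumes "\<And>i. det (T $ i) \<noteq> 0"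
  shows "frame J T (\<chi> i. column_projection (J i) (T $ i)) = T"
proof -
  have "frame J T (\<chi> i. column_projection (J i) (T $ i)) $ i = T $ i" for i
    using column_projection_fixes [OF independent_columns_if_det [OF assms], of "J i" i]
    by (simp add: frame_def matrix_add_ldistrib [symmetric] coord_add_Compl)
  then show ?thesis
    by (simp add: vec_eq_iff)
qed

lemma graph_matrix_det:
  fixes a :: "real ^ 'm::finite ^ 'm"
  assumes "off_block J a"
  shows "det (mat 1 + a) \<noteq> 0"
proof (rule det_nonzero_if_right_inverse)
  have "a ** a = (a ** coord_proj J) ** a"
    by (simp only: off_blockD(2) [OF assms])
  also have "\<dots> = 0"
    by (simp add: matrix_mul_assoc [symmetric] off_blockD(1) [OF assms])
  finally show "(mat 1 + a) ** (mat 1 - a) = mat 1"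
    by (simp add: matrix_add_rdistrib matrix_diff_ldistrib)
qed

lemma chart_exists:
  fixes P :: "real ^ 'm::finite ^ 'm"
  assumes "P \<in> Grassmannian k"
  shows "\<exists>J. card J = k \<and> det (chart_block J P) \<noteq> 0"
proof -
  obtain ord :: "'m \<Rightarrow> nat" where "inj ord"
    using finite_imp_inj_to_nat_seg [of "UNIV :: 'm set"] by auto
  then obtain J where "card J = k" "in_Schubert_cell ord J P"
    using Schubert_cell_exists [OF assms] by blast
  then show ?thesis
    unfolding in_Schubert_cell_def by blast
qed

lemma charts_exist:
  fixes \<Phi> :: "real ^ 'm::finite ^ 'm ^ 'n::finite"
  assumes "\<Phi> \<in> Grassmannian_product k"
  obtains J where "\<And>i. card (J i) = k i" "\<And>i. det (chart_block (J i) (\<Phi> $ i)) \<noteq> 0"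
proof -
  have "\<forall>i. \<exists>J. card J = k i \<and> det (chart_block J (\<Phi> $ i)) \<noteq> 0"
    using assms chart_exists unfolding Grassmannian_product_def by blast
  from choice [OF this] show thesis
    using that by blast
qed

text \<open>Since \<open>T\<close> is recovered from the projections onto its columns in \<open>J\<close> by \<open>frame J T\<close>, a
  polynomial in \<open>T\<close> that does not vanish identically gives polynomials in \<open>\<Phi>\<close> that do not vanish
  on any open part of the product of Grassmannians.\<close>

lemma frame_nonzero_near:
  fixes \<Phi>\<^sub>0 :: "real ^ 'm::finite ^ 'm ^ 'n::finite"
  assumes \<Phi>\<^sub>0: "\<Phi>\<^sub>0 \<in> Grassmannian_product k" "\<Phi>\<^sub>0 \<in> V" "open V"
    and J: "\<And>i. card (J i) = k i" "\<And>i. det (chart_block (J i) (\<Phi>\<^sub>0 $ i)) \<noteq> 0"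
    and q: "real_polynomial_function q" "\<exists>T. q T \<noteq> 0"
  shows "\<exists>\<Phi> G. \<Phi> \<in> Grassmannian_product k \<and> \<Phi> \<in> V \<and> q (frame J G \<Phi>) \<noteq> 0"
proof -
  define D where "D = {T :: real ^ 'm ^ 'm ^ 'n. \<forall>i. det (T $ i) \<noteq> 0}"
  define \<pi> where "\<pi> T = (\<chi> i. column_projection (J i) (T $ i))" for T :: "real ^ 'm ^ 'm ^ 'n"
  have "D = (\<Inter>i. {T. det (T $ i) \<noteq> 0})"
    by (auto simp: D_def)
  moreover have "open {T :: real ^ 'm ^ 'm ^ 'n. det (T $ i) \<noteq> 0}" for i
    by (intro open_Collect_neq continuous_on_const continuous_on_det continuous_on_component
        continuous_on_id)
  ultimately have "open D"
    by (simp add: open_INT)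
  have cont: "continuous_on D \<pi>"
    unfolding \<pi>_def [abs_def]
    by (intro continuous_on_vec_lambda continuous_on_column_projection continuous_on_component
        continuous_on_id independent_columns_if_det) (simp add: D_def)
  have \<pi>: "\<pi> T \<in> Grassmannian_product k" if "T \<in> D" for T
    using that column_projection_in_Grassmannian [OF independent_columns_if_det, of _ "J _"] J(1)
    unfolding Grassmannian_product_def D_def \<pi>_def by fastforce
  define T\<^sub>0 where "T\<^sub>0 = (\<chi> i. mat 1 + chart (J i) (\<Phi>\<^sub>0 $ i))"
  have G: "\<Phi>\<^sub>0 $ i \<in> Grassmannian (card (J i))" for i
    using \<Phi>\<^sub>0(1) by (simp add: Grassmannian_product_def J)
  have "T\<^sub>0 \<in> D"
    using graph_matrix_det [OF off_block_chart [OF G J(2)]] by (simp add: D_def T\<^sub>0_def)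
  moreover have "\<pi> T\<^sub>0 = \<Phi>\<^sub>0"
    using graph_projection_chart [OF G J(2)]
    by (simp add: \<pi>_def T\<^sub>0_def graph_projection_def vec_eq_iff)
  ultimately have "T\<^sub>0 \<in> D \<inter> \<pi> -` V"
    using \<Phi>\<^sub>0(2) by simp
  moreover have "open (D \<inter> \<pi> -` V)"
    by (rule continuous_open_preimage [OF cont \<open>open D\<close> \<Phi>\<^sub>0(3)])
  ultimately obtain T where T: "T \<in> D" "\<pi> T \<in> V" "q T \<noteq> 0"
    using real_polynomial_function_zero_on_open [OF q(1), of "D \<inter> \<pi> -` V" T\<^sub>0] q(2) by blast
  have "frame J T (\<pi> T) = T"
    using frame_column_projections [of T J] T(1) by (simp add: D_def \<pi>_def)
  with T \<pi> show ?thesis by metis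
qed

text \<open>\<open>Z\<close> is cut out by the polynomials that vanish on degenerate frames, for all \<open>J\<close> and \<open>G\<close>.  The
  determinants as additional factors take care of frames that do not span the images.  All \<open>J\<close> are
  used, so that near any tuple one of them gives a chart.\<close>

theorem generic_injectivity:
  fixes k :: "'n::finite \<Rightarrow> nat"
  assumes N: "CARD('n) \<ge> 2 * CARD('m::finite) - 1"
    and k: "\<And>i. 1 \<le> k i \<and> k i \<le> CARD('m) - 1"
  obtains Z :: "(real ^ 'm ^ 'm ^ 'n) set" where "Zariski_closed Z"
    "\<And>V. open V \<Longrightarrow> V \<inter> Grassmannian_product k \<noteq> {} \<Longrightarrow> \<not> V \<inter> Grassmannian_product k \<subseteq> Z"
    "\<And>\<Phi>. \<Phi> \<in> Grassmannian_product k - Z \<Longrightarrow> inj_on (measurement_map \<Phi>) nonzero_mod_sign"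
proof -
  define Js where "Js = {J :: 'n \<Rightarrow> 'm set. \<forall>i. card (J i) = k i}"
  have "\<forall>J\<in>Js. \<exists>q :: real ^ 'm ^ 'm ^ 'n \<Rightarrow> real. real_polynomial_function q \<and> (\<exists>T. q T \<noteq> 0) \<and>
      (\<forall>T. degenerate J T \<longrightarrow> q T = 0)"
  proof
    fix J assume "J \<in> Js"
    then have "1 \<le> card (J i) \<and> card (J i) \<le> CARD('m) - 1" for i
      using k by (simp add: Js_def)
    then show "\<exists>q :: real ^ 'm ^ 'm ^ 'n \<Rightarrow> real. real_polynomial_function q \<and> (\<exists>T. q T \<noteq> 0) \<and>
        (\<forall>T. degenerate J T \<longrightarrow> q T = 0)"
      by (rule degenerate_polynomial [where J = J, OF N]) blast
  qed
  from bchoice [OF this] obtain q :: "_ \<Rightarrow> real ^ 'm ^ 'm ^ 'n \<Rightarrow> real"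
    where q: "\<And>J. J \<in> Js \<Longrightarrow> real_polynomial_function (q J)" "\<And>J. J \<in> Js \<Longrightarrow> \<exists>T. q J T \<noteq> 0"
      "\<And>J T. J \<in> Js \<Longrightarrow> degenerate J T \<Longrightarrow> q J T = 0"
    by blast
  define r where "r J T = q J T * (\<Prod>i\<in>UNIV. det (T $ i))" for J and T :: "real ^ 'm ^ 'm ^ 'n"
  have rpf_det: "real_polynomial_function (\<lambda>T :: real ^ 'm ^ 'm ^ 'n. \<Prod>i\<in>UNIV. det (T $ i))"
    by (intro real_polynomial_function_basic real_polynomial_function_det
        real_polynomial_function_entry) simp
  have r: "real_polynomial_function (r J)" "\<exists>T. r J T \<noteq> 0" if "J \<in> Js" for J
  proof -
    show "real_polynomial_function (r J)"
      unfolding r_def [abs_def] by (intro real_polynomial_function_basic q rpf_det that)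
    have "(\<Prod>i\<in>UNIV. det ((\<chi> i. mat 1 :: real ^ 'm ^ 'm ^ 'n) $ i)) \<noteq> 0"
      by simp
    then show "\<exists>T. r J T \<noteq> 0"
      using real_polynomial_function_mult_nonzero [OF q(1) [OF that] rpf_det] q(2) [OF that]
      unfolding r_def by blast
  qed
  define F where "F = {\<lambda>\<Phi>. r J (frame J G \<Phi>) | J G. J \<in> Js}"
  define Z where "Z = {\<Phi>. \<forall>f\<in>F. f \<Phi> = 0}"
  show thesis
  proof
    have "real_polynomial_function f" if "f \<in> F" for f
      using that r by (auto simp: F_def intro: real_polynomial_function_compose_frame)
    then show "Zariski_closed Z"
      unfolding Zariski_closed_def Z_def by blast
  next
    fix V :: "(real ^ 'm ^ 'm ^ 'n) set"
    assume V: "open V" "V \<inter> Grassmannian_product k \<noteq> {}"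
    then obtain \<Phi>\<^sub>0 where \<Phi>\<^sub>0: "\<Phi>\<^sub>0 \<in> Grassmannian_product k" "\<Phi>\<^sub>0 \<in> V" by blast
    obtain J where J: "\<And>i. card (J i) = k i" "\<And>i. det (chart_block (J i) (\<Phi>\<^sub>0 $ i)) \<noteq> 0"
      using charts_exist [OF \<Phi>\<^sub>0(1)] by blast
    then have "J \<in> Js" by (simp add: Js_def)
    from frame_nonzero_near [OF \<Phi>\<^sub>0 V(1) J r [OF this]]
    obtain \<Phi> G where *: "\<Phi> \<in> Grassmannian_product k" "\<Phi> \<in> V" "r J (frame J G \<Phi>) \<noteq> 0"
      by blast
    have F: "(\<lambda>\<Phi>. r J (frame J G \<Phi>)) \<in> F"
      unfolding F_def using \<open>J \<in> Js\<close> by blast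
    have "\<Phi> \<notin> Z"
    proof
      assume "\<Phi> \<in> Z"
      then have "\<forall>f\<in>F. f \<Phi> = 0"
        by (simp add: Z_def)
      from bspec [OF this F] *(3) show False by simp
    qed
    with * show "\<not> V \<inter> Grassmannian_product k \<subseteq> Z" by blast
  next
    fix \<Phi> assume *: "\<Phi> \<in> Grassmannian_product k - Z"
    then obtain f where f: "f \<in> F" "f \<Phi> \<noteq> 0"
      unfolding Z_def by blast
    then obtain J G where J: "J \<in> Js" and "f = (\<lambda>\<Phi>. r J (frame J G \<Phi>))"
      unfolding F_def by blast
    with f have ne: "r J (frame J G \<Phi>) \<noteq> 0"
      by simp
    then have "q J (frame J G \<Phi>) \<noteq> 0" "\<And>i. det (frame J G \<Phi> $ i) \<noteq> 0"
      by (auto simp: r_def)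
    then show "inj_on (measurement_map \<Phi>) nonzero_mod_sign"
      using degenerate_frame [of \<Phi> k J G] q(3) [OF J] J * by (auto simp: Js_def)
  qed
qed

section \<open>Cells that are open in the product of Grassmannians\<close>

definition coordinate_axes :: "('n \<times> 'm \<times> 'm) set \<Rightarrow> (real ^ 'm::finite ^ 'm ^ 'n::finite) set" where
  "coordinate_axes R = (\<lambda>(i, r, c). axis i (axis r (axis c 1))) ` R"

lemma coordinate_axes_subset_Basis: "coordinate_axes R \<subseteq> Basis"
  unfolding coordinate_axes_def Basis_vec_def by auto

lemma axes_eq_iff:
  "axis i (axis r (axis c (1 :: real))) = axis i' (axis r' (axis c' 1)) \<longleftrightarrow> i = i' \<and> r = r' \<and> c = c'"
  by (auto simp: axis_eq_axis axis_eq_0_iff)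

lemma card_coordinate_axes: "card (coordinate_axes R) = card R"
  unfolding coordinate_axes_def
  by (rule card_image) (auto simp: inj_on_def axes_eq_iff)

lemma axes_in_coordinate_axes [simp]:
  "axis i (axis r (axis c 1)) \<in> coordinate_axes R \<longleftrightarrow> (i, r, c) \<in> R"
  unfolding coordinate_axes_def by (auto simp: axes_eq_iff image_iff split: prod.splits)

lemma ball_Basis_matrix_tuple:
  "(\<forall>b\<in>Basis. Q b) \<longleftrightarrow> (\<forall>i r c. Q (axis i (axis r (axis c 1)) :: real ^ 'm::finite ^ 'm ^ 'n::finite))"
  unfolding Basis_vec_def by auto

lemma inner_axes: "x \<bullet> axis i (axis r (axis c 1)) = x $ i $ r $ c"
  by (simp add: inner_axis)

lemma span_coordinate_axes:
  "x \<in> span (coordinate_axes R) \<longleftrightarrow> (\<forall>i r c. (i, r, c) \<notin> R \<longrightarrow> x $ i $ r $ c = 0)"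
  unfolding span_substd_basis [OF coordinate_axes_subset_Basis] mem_Collect_eq
    ball_Basis_matrix_tuple [of "\<lambda>b. b \<notin> coordinate_axes R \<longrightarrow> x \<bullet> b = 0"]
  by (simp add: inner_axes)

lemma mem_open_cube_coordinate_axes:
  "x \<in> open_cube (coordinate_axes R) \<longleftrightarrow>
     (\<forall>i r c. if (i, r, c) \<in> R then 0 < x $ i $ r $ c \<and> x $ i $ r $ c < 1 else x $ i $ r $ c = 0)"
proof -
  have "x \<in> open_cube (coordinate_axes R) \<longleftrightarrow>
      (\<forall>b\<in>Basis. if b \<in> coordinate_axes R then 0 < x \<bullet> b \<and> x \<bullet> b < 1 else x \<bullet> b = 0)"
    using coordinate_axes_subset_Basis by (auto simp: open_cube_def)
  also have "\<dots> \<longleftrightarrow>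
     (\<forall>i r c. if (i, r, c) \<in> R then 0 < x $ i $ r $ c \<and> x $ i $ r $ c < 1 else x $ i $ r $ c = 0)"
    unfolding ball_Basis_matrix_tuple by (simp add: inner_axes)
  finally show ?thesis .
qed

lemma dim_span_Basis:
  fixes B :: "'a::euclidean_space set"
  assumes "B \<subseteq> Basis"
  shows "dim (span B) = card B"
  using dim_eq_card_independent [OF independent_mono [OF independent_Basis assms]] by simp

lemma openin_open_cube:
  fixes B :: "'a::euclidean_space set"
  assumes "B \<subseteq> Basis"
  shows "openin (top_of_set (span B)) (open_cube B)"
proof -
  have "finite B" using assms finite_Basis finite_subset by blast
  have "open (\<Inter>b\<in>B. {x. 0 < x \<bullet> b} \<inter> {x. x \<bullet> b < 1})"
    using \<open>finite B\<close>
    by (intro open_INT ballI open_Int open_Collect_less continuous_intros) auto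
  moreover have "open_cube B = span B \<inter> (\<Inter>b\<in>B. {x. 0 < x \<bullet> b} \<inter> {x. x \<bullet> b < 1})"
    unfolding open_cube_def span_substd_basis [OF assms] by auto
  ultimately show ?thesis
    by (simp only: openin_open_Int)
qed

lemma open_cube_nonempty:
  fixes B :: "'a::euclidean_space set"
  assumes "B \<subseteq> Basis"
  shows "open_cube B \<noteq> {}"
proof -
  have "finite B" using assms finite_Basis finite_subset by blast
  have "(\<Sum>b\<in>B. (1 / 2) *\<^sub>R b) \<bullet> b' = (if b' \<in> B then 1 / 2 else 0)" if "b' \<in> Basis" for b'
  proof -
    have "(\<Sum>b\<in>B. (1 / 2) *\<^sub>R b) \<bullet> b' = (\<Sum>b\<in>B. if b = b' then 1 / 2 else 0)"
      unfolding inner_sum_left using assms that by (intro sum.cong) (auto simp: inner_Basis)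
    then show ?thesis using \<open>finite B\<close> by simp
  qed
  then have "(\<Sum>b\<in>B. (1 / 2) *\<^sub>R b) \<in> open_cube B"
    using assms by (auto simp: open_cube_def)
  then show ?thesis by blast
qed

definition chart_entries :: "('n \<Rightarrow> 'm set) \<Rightarrow> ('n \<times> 'm \<times> 'm) set" where
  "chart_entries J = {(i, r, c). r \<notin> J i \<and> c \<in> J i}"

lemma card_chart_entries:
  fixes J :: "'n::finite \<Rightarrow> 'm::finite set"
  assumes "\<And>i. card (J i) = k i"
  shows "card (chart_entries J) = (\<Sum>i\<in>UNIV. (CARD('m) - k i) * k i)"
proof -
  have "chart_entries J = (SIGMA i:UNIV. (- J i) \<times> J i)"
    by (auto simp: chart_entries_def)
  then show ?thesis
    by (simp add: card_cartesian_product assms Compl_eq_Diff_UNIV card_Diff_subset)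
qed

text \<open>The charts make the product of Grassmannians a manifold, so by invariance of domain a subset
  that is homeomorphic to a cube of at least its dimension has interior points.\<close>

lemma semialgebraic_cell_interior:
  fixes C :: "(real ^ 'm::finite ^ 'm ^ 'n::finite) set"
  assumes C: "C \<subseteq> Grassmannian_product k" "semialgebraic_cell d C"
    and d: "(\<Sum>i\<in>UNIV. (CARD('m) - k i) * k i) \<le> d"
  shows "\<exists>V. open V \<and> V \<inter> Grassmannian_product k \<noteq> {} \<and> V \<inter> Grassmannian_product k \<subseteq> C"
proof -
  let ?X = "Grassmannian_product k :: (real ^ 'm ^ 'm ^ 'n) set"
  obtain B :: "(real ^ 'm ^ 'm ^ 'n) set" and f g where B: "B \<subseteq> Basis" "card B = d"
    and hom: "homeomorphism C (open_cube B) f g"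
    using C(2) unfolding semialgebraic_cell_def semialgebraic_homeomorphic_def by blast
  obtain x\<^sub>0 where x\<^sub>0: "x\<^sub>0 \<in> open_cube B"
    using open_cube_nonempty [OF B(1)] by blast
  have gC: "g x \<in> C" if "x \<in> open_cube B" for x
    using hom that by (auto simp: homeomorphism_def)
  obtain J where J: "\<And>i. card (J i) = k i" "\<And>i. det (chart_block (J i) (g x\<^sub>0 $ i)) \<noteq> 0"
    using charts_exist [of "g x\<^sub>0" k] gC [OF x\<^sub>0] C(1) by blast
  define V where "V = {\<Phi> :: real ^ 'm ^ 'm ^ 'n. \<forall>i. det (chart_block (J i) (\<Phi> $ i)) \<noteq> 0}"
  define h where "h \<Phi> = (\<chi> i. chart (J i) (\<Phi> $ i))" for \<Phi> :: "real ^ 'm ^ 'm ^ 'n"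
  have V_eq: "V = (\<Inter>i. {\<Phi>. det (chart_block (J i) (\<Phi> $ i)) \<noteq> 0})"
    by (auto simp: V_def)
  have "open V"
    unfolding V_eq
    by (intro open_INT ballI open_Collect_neq continuous_on_det continuous_on_entry
        continuous_on_chart_block continuous_on_component continuous_on_id continuous_on_const) simp
  have hcont: "continuous_on V h"
    unfolding h_def [abs_def]
    by (intro continuous_on_vec_lambda continuous_on_chart continuous_on_component continuous_on_id)
      (simp add: V_def)
  have G: "\<Phi> $ i \<in> Grassmannian (card (J i))" if "\<Phi> \<in> ?X" for \<Phi> i
    using that by (simp add: Grassmannian_product_def J(1))
  have hspan: "h \<Phi> \<in> span (coordinate_axes (chart_entries J))" if "\<Phi> \<in> ?X" "\<Phi> \<in> V" for \<Phi>
    unfolding span_coordinate_axes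
    using off_block_chart [OF G [OF that(1)]] that(2)
    unfolding off_block_def chart_entries_def h_def V_def by auto
  have hinj: "\<Phi> = \<Psi>" if "\<Phi> \<in> ?X" "\<Phi> \<in> V" "\<Psi> \<in> ?X" "\<Psi> \<in> V" "h \<Phi> = h \<Psi>" for \<Phi> \<Psi>
  proof -
    have "\<Phi> $ i = \<Psi> $ i" for i
    proof -
      have "chart (J i) (\<Phi> $ i) = chart (J i) (\<Psi> $ i)"
        using arg_cong [OF that(5), of "\<lambda>A. A $ i"] by (simp add: h_def)
      moreover have "det (chart_block (J i) (\<Phi> $ i)) \<noteq> 0" "det (chart_block (J i) (\<Psi> $ i)) \<noteq> 0"
        using that by (simp_all add: V_def)
      ultimately show ?thesis
        using graph_projection_chart [OF G [OF that(1)]] graph_projection_chart [OF G [OF that(3)]]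
        by metis
    qed
    then show ?thesis by (simp add: vec_eq_iff)
  qed
  define Q where "Q = open_cube B \<inter> g -` V"
  have gcont: "continuous_on (open_cube B) g"
    using hom by (simp add: homeomorphism_def)
  then have "openin (top_of_set (open_cube B)) Q"
    unfolding Q_def by (rule continuous_openin_preimage_gen [OF _ \<open>open V\<close>])
  then have Q: "openin (top_of_set (span B)) Q"
    using openin_open_cube [OF B(1)] openin_trans by blast
  have QX: "g x \<in> ?X" "g x \<in> V" if "x \<in> Q" for x
    using that gC C(1) by (auto simp: Q_def)
  have "openin (top_of_set (span (coordinate_axes (chart_entries J)))) ((h \<circ> g) ` Q)"
  proof (rule invariance_of_domain_subspaces [OF Q])
    show "dim (span (coordinate_axes (chart_entries J))) \<le> dim (span B)"
      using d dim_span_Basis [OF B(1)] dim_span_Basis [OF coordinate_axes_subset_Basis, of "chart_entries J"]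
      by (simp add: B(2) card_coordinate_axes card_chart_entries [OF J(1)])
    show "continuous_on Q (h \<circ> g)"
      by (intro continuous_on_compose continuous_on_subset [OF gcont] continuous_on_subset [OF hcont])
        (auto simp: Q_def)
    show "h \<circ> g \<in> Q \<rightarrow> span (coordinate_axes (chart_entries J))"
      using hspan QX by auto
    show "inj_on (h \<circ> g) Q"
    proof (rule inj_onI)
      fix x y assume xy: "x \<in> Q" "y \<in> Q" "(h \<circ> g) x = (h \<circ> g) y"
      then have "g x = g y"
        using hinj QX by auto
      moreover have "f (g x) = x" "f (g y) = y"
        using hom xy by (auto simp: Q_def homeomorphism_def)
      ultimately show "x = y" by metis
    qed
  qed auto
  then obtain W where W: "open W" "(h \<circ> g) ` Q = span (coordinate_axes (chart_entries J)) \<inter> W"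
    unfolding openin_open by blast
  show ?thesis
  proof (intro exI conjI)
    show "open (V \<inter> h -` W)"
      by (rule continuous_open_preimage [OF hcont \<open>open V\<close> W(1)])
    have "x\<^sub>0 \<in> Q"
      using x\<^sub>0 J(2) by (simp add: Q_def V_def)
    then have "g x\<^sub>0 \<in> V \<inter> h -` W \<inter> ?X"
      using W(2) QX [of x\<^sub>0] by auto
    then show "V \<inter> h -` W \<inter> ?X \<noteq> {}" by blast
    show "V \<inter> h -` W \<inter> ?X \<subseteq> C"
    proof
      fix \<Phi> assume \<Phi>: "\<Phi> \<in> V \<inter> h -` W \<inter> ?X"
      then have "h \<Phi> \<in> (h \<circ> g) ` Q"
        unfolding W(2) using hspan by auto
      then obtain x where x: "x \<in> Q" "h \<Phi> = h (g x)" by auto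
      then have "\<Phi> = g x"
        using hinj [of \<Phi> "g x"] QX [OF x(1)] \<Phi> by auto
      then show "\<Phi> \<in> C"
        using gC x(1) by (simp add: Q_def)
    qed
  qed
qed

section \<open>The cell decomposition by Schubert cells\<close>

lemma basic_semialgebraic_conj:
  assumes "basic_semialgebraic {x. P x}" "basic_semialgebraic {x. Q x}"
  shows "basic_semialgebraic {x. P x \<and> Q x}"
proof -
  obtain F G where 1: "finite F" "finite G" "\<forall>f \<in> F \<union> G. real_polynomial_function f"
    "{x. P x} = {x. (\<forall>f\<in>F. f x = 0) \<and> (\<forall>g\<in>G. g x > 0)}"
    using assms(1) unfolding basic_semialgebraic_def by blast
  obtain F' G' where 2: "finite F'" "finite G'" "\<forall>f \<in> F' \<union> G'. real_polynomial_function f"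
    "{x. Q x} = {x. (\<forall>f\<in>F'. f x = 0) \<and> (\<forall>g\<in>G'. g x > 0)}"
    using assms(2) unfolding basic_semialgebraic_def by blast
  show ?thesis
    unfolding basic_semialgebraic_def
  proof (intro exI conjI)
    show "finite (F \<union> F')" "finite (G \<union> G')"
      using 1 2 by auto
    show "\<forall>f \<in> (F \<union> F') \<union> (G \<union> G'). real_polynomial_function f"
      using 1(3) 2(3) by blast
    have "{x. P x \<and> Q x} = {x. P x} \<inter> {x. Q x}" by blast
    then show "{x. P x \<and> Q x} = {x. (\<forall>f\<in>F \<union> F'. f x = 0) \<and> (\<forall>g\<in>G \<union> G'. g x > 0)}"
      unfolding 1(4) 2(4) by blast
  qed
qed

lemma basic_semialgebraic_UNIV: "basic_semialgebraic UNIV"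
  unfolding basic_semialgebraic_def by (intro exI [of _ "{}"]) simp

lemma basic_semialgebraic_ball:
  assumes "finite I" "\<And>i. i \<in> I \<Longrightarrow> basic_semialgebraic {x. P i x}"
  shows "basic_semialgebraic {x. \<forall>i\<in>I. P i x}"
  using assms
proof (induction I)
  case (insert i I)
  then have "basic_semialgebraic {x. P i x \<and> (\<forall>i\<in>I. P i x)}"
    by (intro basic_semialgebraic_conj) auto
  then show ?case by simp
qed (simp add: basic_semialgebraic_UNIV)

lemma basic_semialgebraic_all:
  assumes "\<And>i :: 'i::finite. basic_semialgebraic {x. P i x}"
  shows "basic_semialgebraic {x. \<forall>i. P i x}"
  using basic_semialgebraic_ball [of UNIV P] assms by simp

lemma basic_semialgebraic_imp:
  assumes "A \<Longrightarrow> basic_semialgebraic {x. P x}"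
  shows "basic_semialgebraic {x. A \<longrightarrow> P x}"
  using assms by (cases A) (simp_all add: basic_semialgebraic_UNIV)

lemma basic_semialgebraic_eq:
  assumes "real_polynomial_function p" "real_polynomial_function q"
  shows "basic_semialgebraic {x. p x = q x}"
  unfolding basic_semialgebraic_def
  by (rule exI [of _ "{\<lambda>x. p x - q x}"], rule exI [of _ "{}"])
    (use real_polynomial_function_diff [OF assms] in auto)

lemma basic_semialgebraic_less:
  assumes "real_polynomial_function p" "real_polynomial_function q"
  shows "basic_semialgebraic {x. p x < q x}"
  unfolding basic_semialgebraic_def
  by (rule exI [of _ "{}"], rule exI [of _ "{\<lambda>x. q x - p x}"])
    (use real_polynomial_function_diff [OF assms(2,1)] in auto)

lemma basic_semialgebraic_Grassmannian:
  assumes P: "\<And>r c. real_polynomial_function (\<lambda>x. P x $ r $ c)"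
  shows "basic_semialgebraic {x. P x \<in> Grassmannian k}"
proof -
  have "P x \<in> Grassmannian k \<longleftrightarrow> (\<forall>r c. (P x ** P x) $ r $ c = P x $ r $ c) \<and>
      (\<forall>r c. P x $ r $ c = P x $ c $ r) \<and> (\<Sum>r\<in>UNIV. P x $ r $ r) = real k" for x
    unfolding Grassmannian_def by (simp add: vec_eq_iff transpose_def trace_def)
  then show ?thesis
    by simp (intro basic_semialgebraic_conj basic_semialgebraic_all basic_semialgebraic_eq
        real_polynomial_function_matrix_mult real_polynomial_function_basic P, simp)
qed

lemma semialgebraic_if_basic: "basic_semialgebraic S \<Longrightarrow> semialgebraic S"
  unfolding semialgebraic_def by (intro exI [of _ "{S}"]) simp

text \<open>A semialgebraic homeomorphism from the unit interval to the real line, and its inverse.\<close>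

definition stretch :: "real \<Rightarrow> real" where
  "stretch x = 1 / (1 - x) - 1 / x"

definition unstretch :: "real \<Rightarrow> real" where
  "unstretch y = 2 / (2 - y + sqrt (y\<^sup>2 + 4))"

lemma sqrt_gt: "sqrt (y\<^sup>2 + 4) > y"
  by (rule real_less_rsqrt) simp

lemma unstretch_bounds: "0 < unstretch y" "unstretch y < 1"
  using sqrt_gt [of y] by (simp_all add: unstretch_def)

lemma stretch_unstretch: "stretch (unstretch y) = y"
proof -
  define t where "t = sqrt (y\<^sup>2 + 4) - y"
  have t: "t > 0" using sqrt_gt [of y] by (simp add: t_def)
  have "(t + y)\<^sup>2 = y\<^sup>2 + 4"
    unfolding t_def by simp
  then have eq: "t * t + 2 * t * y = 4"
    by (simp add: power2_eq_square algebra_simps)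
  have "unstretch y = 2 / (2 + t)"
    by (simp add: unstretch_def t_def algebra_simps)
  moreover have "1 - 2 / (2 + t) = t / (2 + t)"
    using t by (simp add: field_simps)
  ultimately have "stretch (unstretch y) = (2 + t) / t - (2 + t) / 2"
    by (simp add: stretch_def)
  also have "\<dots> = (4 - t * t) / (2 * t)"
    using t by (simp add: field_simps)
  also have "\<dots> = y"
    using t eq by (simp add: field_simps)
  finally show ?thesis .
qed

lemma stretch_less:
  assumes "0 < x" "x < y" "y < 1"
  shows "stretch x < stretch y"
proof -
  have "1 / (1 - x) < 1 / (1 - y)" "1 / y < 1 / x"
    using assms by (simp_all add: divide_strict_left_mono)
  then show ?thesis
    by (simp add: stretch_def)
qed

lemma unstretch_stretch:
  assumes "0 < x" "x < 1"
  shows "unstretch (stretch x) = x"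
  using stretch_less [of x "unstretch (stretch x)"] stretch_less [of "unstretch (stretch x)" x]
    unstretch_bounds [of "stretch x"] stretch_unstretch [of "stretch x"] assms
  by (cases x "unstretch (stretch x)" rule: linorder_cases) auto

lemma continuous_on_unstretch: "continuous_on S unstretch"
proof -
  have "2 - y + sqrt (y\<^sup>2 + 4) \<noteq> 0" for y :: real
    using sqrt_gt [of y] by linarith
  then show ?thesis
    unfolding unstretch_def [abs_def] by (intro continuous_intros) auto
qed

lemma continuous_on_stretch: "continuous_on {0<..<1} stretch"
  unfolding stretch_def [abs_def] by (intro continuous_intros) auto

definition Schubert_entries :: "('m \<Rightarrow> nat) \<Rightarrow> ('n \<Rightarrow> 'm set) \<Rightarrow> ('n \<times> 'm \<times> 'm) set" where
  "Schubert_entries ord J = {(i, r, c). r \<notin> J i \<and> c \<in> J i \<and> ord c < ord r}"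

definition Schubert_cell ::
    "('m \<Rightarrow> nat) \<Rightarrow> ('n \<Rightarrow> 'm set) \<Rightarrow> (real ^ 'm ^ 'm ^ 'n) set" where
  "Schubert_cell ord J =
     {\<Phi>. \<forall>i. \<Phi> $ i \<in> Grassmannian (card (J i)) \<and> in_Schubert_cell ord (J i) (\<Phi> $ i)}"

lemma chart_nth:
  fixes P :: "real ^ 'm::finite ^ 'm"
  assumes "det (chart_block J P) \<noteq> 0"
  shows "chart J P $ r $ c = ((P ** coord_proj J ** adjugate (chart_block J P)) $ r $ c
    - det (chart_block J P) * coord_proj J $ r $ c) / det (chart_block J P)"
proof -
  have "(A ** matrix_inv (chart_block J P)) $ r $ c =
      (A ** adjugate (chart_block J P)) $ r $ c / det (chart_block J P)" for A
    by (simp add: matrix_matrix_mult_def matrix_inv_eq_adjugate [OF assms] sum_divide_distrib)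
  then show ?thesis
    using assms by (simp add: chart_def diff_divide_distrib)
qed

lemma basic_semialgebraic_Schubert_cell:
  "basic_semialgebraic (Schubert_cell ord J :: (real ^ 'm::finite ^ 'm ^ 'n::finite) set)"
proof -
  have eq: "in_Schubert_cell ord J P \<longleftrightarrow> 0 < (det (chart_block J P))\<^sup>2 \<and>
    (\<forall>r c. \<not> ord c < ord r \<longrightarrow> (P ** coord_proj J ** adjugate (chart_block J P)) $ r $ c =
      det (chart_block J P) * coord_proj J $ r $ c)" for J and P :: "real ^ 'm ^ 'm"
    unfolding in_Schubert_cell_def by (cases "det (chart_block J P) = 0") (auto simp: chart_nth)
  have K: "real_polynomial_function (\<lambda>\<Phi> :: real ^ 'm ^ 'm ^ 'n. chart_block (J i) (\<Phi> $ i) $ r $ c)" for i r c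
    unfolding chart_block_def vector_add_component
    by (intro real_polynomial_function_basic real_polynomial_function_matrix_mult
        real_polynomial_function_entry)
  have det: "real_polynomial_function (\<lambda>\<Phi> :: real ^ 'm ^ 'm ^ 'n. det (chart_block (J i) (\<Phi> $ i)))" for i
    by (intro real_polynomial_function_det K)
  have adj: "real_polynomial_function (\<lambda>\<Phi> :: real ^ 'm ^ 'm ^ 'n. adjugate (chart_block (J i) (\<Phi> $ i)) $ r $ c)"
    for i r c
    unfolding adjugate_def vec_lambda_beta
  proof (rule real_polynomial_function_det)
    fix r' c'
    show "real_polynomial_function (\<lambda>\<Phi> :: real ^ 'm ^ 'm ^ 'n.
        (\<chi> s t. if t = r then if s = c then 1 else 0 else chart_block (J i) (\<Phi> $ i) $ s $ t) $ r' $ c')"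
      by (cases "c' = r") (simp_all add: K real_polynomial_function_basic)
  qed
  show ?thesis
    unfolding Schubert_cell_def eq
    by (intro basic_semialgebraic_all basic_semialgebraic_conj basic_semialgebraic_imp
        basic_semialgebraic_Grassmannian basic_semialgebraic_less basic_semialgebraic_eq
        real_polynomial_function_basic real_polynomial_function_matrix_mult
        real_polynomial_function_entry det adj)
qed

text \<open>The coordinates of a Schubert cell are the entries of its graph matrices, moved from the real
  line to the interval \<open>(0,1)\<close> by \<open>stretch\<close>.\<close>

definition graph_matrix :: "('n \<times> 'm \<times> 'm) set \<Rightarrow> real ^ 'm ^ 'm ^ 'n \<Rightarrow> 'n \<Rightarrow> real ^ 'm ^ 'm" where
  "graph_matrix R x i = (\<chi> r c. if (i, r, c) \<in> R then stretch (x $ i $ r $ c) else 0)"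

text \<open>A common denominator of the entries of the graph matrices, and their numerators.\<close>

definition stretch_denominator :: "('n \<times> 'm \<times> 'm) set \<Rightarrow> real ^ 'm ^ 'm ^ 'n \<Rightarrow> real" where
  "stretch_denominator R x = (\<Prod>(i, r, c)\<in>R. x $ i $ r $ c * (1 - x $ i $ r $ c))"

definition stretch_numerator ::
    "('n \<times> 'm \<times> 'm) set \<Rightarrow> real ^ 'm ^ 'm ^ 'n \<Rightarrow> 'n \<Rightarrow> real ^ 'm ^ 'm" where
  "stretch_numerator R x i = (\<chi> r c. if (i, r, c) \<in> R
     then (2 * x $ i $ r $ c - 1) * stretch_denominator (R - {(i, r, c)}) x else 0)"

lemma off_block_graph_matrix:
  "off_block (J i) (graph_matrix (Schubert_entries ord J) x i)"
  by (auto simp: off_block_def graph_matrix_def Schubert_entries_def)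

lemma stretch_numerator_eq:
  fixes x :: "real ^ 'm::finite ^ 'm ^ 'n::finite"
  assumes x: "x \<in> open_cube (coordinate_axes R)"
  shows "stretch_denominator R x > 0"
    and "stretch_numerator R x i $ r $ c = stretch_denominator R x * graph_matrix R x i $ r $ c"
proof -
  have *: "0 < x $ i $ r $ c" "x $ i $ r $ c < 1" if "(i, r, c) \<in> R" for i r c
    using x that unfolding mem_open_cube_coordinate_axes by metis+
  show "stretch_denominator R x > 0"
    unfolding stretch_denominator_def by (intro prod_pos) (auto simp: *)
  show "stretch_numerator R x i $ r $ c = stretch_denominator R x * graph_matrix R x i $ r $ c"
  proof (cases "(i, r, c) \<in> R")
    case True
    have "stretch_denominator R x =
        x $ i $ r $ c * (1 - x $ i $ r $ c) * stretch_denominator (R - {(i, r, c)}) x"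
      unfolding stretch_denominator_def by (subst prod.remove [OF _ True]) auto
    moreover have "x $ i $ r $ c * (1 - x $ i $ r $ c) * stretch (x $ i $ r $ c) = 2 * x $ i $ r $ c - 1"
      using * [OF True] by (simp add: stretch_def field_simps)
    ultimately show ?thesis
      using True by (simp add: stretch_numerator_def graph_matrix_def mult_ac)
  qed (simp add: stretch_numerator_def graph_matrix_def)
qed

lemma matrix_mult_scaleR: "A ** (t *\<^sub>R B) = t *\<^sub>R (A ** (B :: real ^ 'm::finite ^ 'm))"
  by (simp add: vec_eq_iff matrix_matrix_mult_def sum_distrib_left mult_ac)

definition cube_to_cell ::
    "('m \<Rightarrow> nat) \<Rightarrow> ('n \<Rightarrow> 'm set) \<Rightarrow> real ^ 'm ^ 'm ^ 'n \<Rightarrow> real ^ 'm ^ 'm ^ 'n" where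
  "cube_to_cell ord J x = (\<chi> i. graph_projection (J i) (graph_matrix (Schubert_entries ord J) x i))"

definition cell_to_cube ::
    "('m \<Rightarrow> nat) \<Rightarrow> ('n \<Rightarrow> 'm set) \<Rightarrow> real ^ 'm ^ 'm ^ 'n \<Rightarrow> real ^ 'm ^ 'm ^ 'n" where
  "cell_to_cube ord J \<Phi> = (\<chi> i r c. if (i, r, c) \<in> Schubert_entries ord J
     then unstretch (chart (J i) (\<Phi> $ i) $ r $ c) else 0)"

lemma homeomorphism_Schubert_cell:
  fixes J :: "'n::finite \<Rightarrow> 'm::finite set"
  shows "homeomorphism (Schubert_cell ord J) (open_cube (coordinate_axes (Schubert_entries ord J)))
    (cell_to_cube ord J) (cube_to_cell ord J)"
proof -
  let ?R = "Schubert_entries ord J"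
  let ?Q = "open_cube (coordinate_axes ?R) :: (real ^ 'm ^ 'm ^ 'n) set"
  have Q: "0 < x $ i $ r $ c" "x $ i $ r $ c < 1" if "x \<in> ?Q" "(i, r, c) \<in> ?R" for x i r c
    using that unfolding mem_open_cube_coordinate_axes by metis+
  have Q0: "x $ i $ r $ c = 0" if "x \<in> ?Q" "(i, r, c) \<notin> ?R" for x i r c
    using that unfolding mem_open_cube_coordinate_axes by metis
  have cell: "\<Phi> $ i \<in> Grassmannian (card (J i))" "det (chart_block (J i) (\<Phi> $ i)) \<noteq> 0"
    if "\<Phi> \<in> Schubert_cell ord J" for \<Phi> i
    using that by (auto simp: Schubert_cell_def in_Schubert_cell_def)
  have zero: "chart (J i) (\<Phi> $ i) $ r $ c = 0"
    if "\<Phi> \<in> Schubert_cell ord J" "(i, r, c) \<notin> ?R" for \<Phi> i r c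
    using that off_block_chart [OF cell [OF that(1)]]
    unfolding Schubert_cell_def in_Schubert_cell_def Schubert_entries_def off_block_def by blast
  show ?thesis
  proof (rule homeomorphismI)
    show "continuous_on (Schubert_cell ord J) (cell_to_cube ord J)"
      unfolding cell_to_cube_def [abs_def]
    proof (intro continuous_on_vec_lambda)
      fix i r c
      have "continuous_on (Schubert_cell ord J) (\<lambda>\<Phi>. chart (J i) (\<Phi> $ i))"
        by (intro continuous_on_chart continuous_on_component continuous_on_id cell)
      then have "continuous_on (Schubert_cell ord J) (\<lambda>\<Phi>. unstretch (chart (J i) (\<Phi> $ i) $ r $ c))"
        using continuous_on_compose2 [OF continuous_on_unstretch [of UNIV] continuous_on_entry] by auto
      then show "continuous_on (Schubert_cell ord J)
          (\<lambda>\<Phi>. if (i, r, c) \<in> ?R then unstretch (chart (J i) (\<Phi> $ i) $ r $ c) else 0)"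
        by (cases "(i, r, c) \<in> ?R") simp_all
    qed
    show "continuous_on ?Q (cube_to_cell ord J)"
      unfolding cube_to_cell_def [abs_def] graph_projection_def
    proof (intro continuous_on_vec_lambda continuous_on_column_projection
        off_block_independent off_block_graph_matrix continuous_on_add continuous_on_const)
      fix i
      show "continuous_on ?Q (\<lambda>x. graph_matrix ?R x i)"
        unfolding graph_matrix_def
      proof (intro continuous_on_vec_lambda)
        fix r c
        show "continuous_on ?Q (\<lambda>x. if (i, r, c) \<in> ?R then stretch (x $ i $ r $ c) else 0)"
        proof (cases "(i, r, c) \<in> ?R")
          case True
          have "continuous_on ?Q (\<lambda>x. stretch (x $ i $ r $ c))"
            by (rule continuous_on_compose2 [OF continuous_on_stretch])
              (use Q True in \<open>auto intro!: continuous_on_component continuous_on_id\<close>)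
          with True show ?thesis by simp
        qed simp
      qed
    qed
    show "cell_to_cube ord J ` Schubert_cell ord J \<subseteq> ?Q"
      unfolding image_subset_iff mem_open_cube_coordinate_axes
      by (simp add: cell_to_cube_def unstretch_bounds)
    show "cube_to_cell ord J ` ?Q \<subseteq> Schubert_cell ord J"
    proof
      fix \<Phi> assume "\<Phi> \<in> cube_to_cell ord J ` ?Q"
      then obtain x where \<Phi>: "\<Phi> $ i = graph_projection (J i) (graph_matrix ?R x i)" for i
        by (auto simp: cube_to_cell_def)
      have "ord c < ord r" if "graph_matrix ?R x i $ r $ c \<noteq> 0" for i r c
        using that by (auto simp: graph_matrix_def Schubert_entries_def split: if_splits)
      then show "\<Phi> \<in> Schubert_cell ord J"
        unfolding Schubert_cell_def in_Schubert_cell_def mem_Collect_eq \<Phi>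
          chart_graph_projection [OF off_block_graph_matrix]
        by (intro allI conjI graph_projection_in_Grassmannian det_chart_block_graph_projection
            off_block_graph_matrix) blast
    qed
    show "cube_to_cell ord J (cell_to_cube ord J \<Phi>) = \<Phi>" if "\<Phi> \<in> Schubert_cell ord J" for \<Phi>
    proof -
      have "graph_matrix ?R (cell_to_cube ord J \<Phi>) i = chart (J i) (\<Phi> $ i)" for i
        using zero [OF that] by (auto simp: vec_eq_iff graph_matrix_def cell_to_cube_def stretch_unstretch)
      then have "cube_to_cell ord J (cell_to_cube ord J \<Phi>) $ i = \<Phi> $ i" for i
        using graph_projection_chart [OF cell [OF that]] by (simp add: cube_to_cell_def)
      then show ?thesis
        by (subst vec_eq_iff) blast
    qed
    show "cell_to_cube ord J (cube_to_cell ord J x) = x" if "x \<in> ?Q" for x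
      using Q [OF that] Q0 [OF that]
      by (simp add: vec_eq_iff cell_to_cube_def cube_to_cell_def
          chart_graph_projection [OF off_block_graph_matrix])
        (simp add: graph_matrix_def unstretch_stretch)
  qed
qed

text \<open>The last condition is the equation of \<open>graph_projection_eq_iff\<close> times the common denominator, so
  all conditions are polynomial.\<close>

lemma graph_Schubert_cell:
  fixes J :: "'n::finite \<Rightarrow> 'm::finite set" and ord :: "'m \<Rightarrow> nat"
  defines "R \<equiv> Schubert_entries ord J"
  shows "(\<lambda>\<Phi>. (\<Phi>, cell_to_cube ord J \<Phi>)) ` Schubert_cell ord J =
    {z. (\<forall>i. fst z $ i \<in> Grassmannian (card (J i))) \<and>
      (\<forall>i r c. if (i, r, c) \<in> R then 0 < snd z $ i $ r $ c \<and> snd z $ i $ r $ c < 1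
        else snd z $ i $ r $ c = 0) \<and>
      (\<forall>i r c. stretch_denominator R (snd z) * fst z $ i $ r $ c =
        (fst z $ i ** (stretch_denominator R (snd z) *\<^sub>R coord_proj (J i) +
          transpose (stretch_numerator R (snd z) i))) $ r $ c)}"
    (is "?L = ?M")
proof -
  let ?Q = "open_cube (coordinate_axes R) :: (real ^ 'm ^ 'm ^ 'n) set"
  have hom: "homeomorphism (Schubert_cell ord J) ?Q (cell_to_cube ord J) (cube_to_cell ord J)"
    unfolding R_def by (rule homeomorphism_Schubert_cell)
  have L: "(\<Phi>, x) \<in> ?L \<longleftrightarrow> x \<in> ?Q \<and> \<Phi> = cube_to_cell ord J x" for \<Phi> x
    using hom unfolding homeomorphism_def by (auto simp: image_iff)
  have M: "(\<Phi>, x) \<in> ?M \<longleftrightarrow> x \<in> ?Q \<and> (\<forall>i. \<Phi> $ i \<in> Grassmannian (card (J i))) \<and>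
      (\<forall>i r c. stretch_denominator R x * \<Phi> $ i $ r $ c =
        (\<Phi> $ i ** (stretch_denominator R x *\<^sub>R coord_proj (J i) + transpose (stretch_numerator R x i))) $ r $ c)"
    for \<Phi> x
    by (simp only: mem_Collect_eq fst_conv snd_conv mem_open_cube_coordinate_axes conj_left_commute)
  have eq: "(\<forall>r c. stretch_denominator R x * \<Phi> $ i $ r $ c =
        (\<Phi> $ i ** (stretch_denominator R x *\<^sub>R coord_proj (J i) + transpose (stretch_numerator R x i))) $ r $ c)
      \<longleftrightarrow> \<Phi> $ i = graph_projection (J i) (graph_matrix R x i)"
    if x: "x \<in> ?Q" and \<Phi>: "\<Phi> $ i \<in> Grassmannian (card (J i))" for \<Phi> x i
  proof -
    let ?d = "stretch_denominator R x"
    have "transpose (stretch_numerator R x i) = ?d *\<^sub>R transpose (graph_matrix R x i)"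
      by (simp add: vec_eq_iff transpose_def stretch_numerator_eq(2) [OF x])
    then have "\<Phi> $ i ** (?d *\<^sub>R coord_proj (J i) + transpose (stretch_numerator R x i)) =
        ?d *\<^sub>R (\<Phi> $ i ** (coord_proj (J i) + transpose (graph_matrix R x i)))"
      by (simp add: scaleR_add_right [symmetric] matrix_mult_scaleR)
    then have "(\<forall>r c. ?d * \<Phi> $ i $ r $ c =
        (\<Phi> $ i ** (?d *\<^sub>R coord_proj (J i) + transpose (stretch_numerator R x i))) $ r $ c)
      \<longleftrightarrow> \<Phi> $ i = \<Phi> $ i ** (coord_proj (J i) + transpose (graph_matrix R x i))"
      using stretch_numerator_eq(1) [OF x] by (simp add: vec_eq_iff)
    then show ?thesis
      using graph_projection_eq_iff [OF \<Phi> off_block_graph_matrix [of J i ord x]] unfolding R_def by metis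
  qed
  have LM: "(\<Phi>, x) \<in> ?L \<longleftrightarrow> (\<Phi>, x) \<in> ?M" for \<Phi> x
  proof
    assume "(\<Phi>, x) \<in> ?L"
    then have x: "x \<in> ?Q" and \<Phi>: "\<Phi> = cube_to_cell ord J x"
      using L by blast+
    then have \<Phi>i: "\<Phi> $ i = graph_projection (J i) (graph_matrix R x i)" for i
      by (simp add: cube_to_cell_def R_def)
    moreover have "\<Phi> $ i \<in> Grassmannian (card (J i))" for i
      unfolding \<Phi>i R_def by (intro graph_projection_in_Grassmannian off_block_graph_matrix)
    ultimately show "(\<Phi>, x) \<in> ?M"
      unfolding M using x eq by blast
  next
    assume "(\<Phi>, x) \<in> ?M"
    then have "x \<in> ?Q" "\<And>i. \<Phi> $ i = graph_projection (J i) (graph_matrix R x i)"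
      unfolding M using eq by blast+
    then show "(\<Phi>, x) \<in> ?L"
      unfolding L by (simp add: cube_to_cell_def R_def vec_eq_iff)
  qed
  show ?thesis
  proof (rule set_eqI)
    fix z :: "(real ^ 'm ^ 'm ^ 'n) \<times> (real ^ 'm ^ 'm ^ 'n)"
    obtain \<Phi> x where "z = (\<Phi>, x)"
      by (cases z)
    then show "z \<in> ?L \<longleftrightarrow> z \<in> ?M"
      using LM by (simp only:)
  qed
qed

lemma semialgebraic_cell_Schubert_cell:
  fixes J :: "'n::finite \<Rightarrow> 'm::finite set"
  shows "semialgebraic_cell (card (Schubert_entries ord J)) (Schubert_cell ord J)"
  unfolding semialgebraic_cell_def semialgebraic_homeomorphic_def
proof (intro exI conjI)
  let ?R = "Schubert_entries ord J"
  show "coordinate_axes ?R \<subseteq> Basis"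
    by (rule coordinate_axes_subset_Basis)
  show "card (coordinate_axes ?R) = card ?R"
    by (rule card_coordinate_axes)
  show "semialgebraic (Schubert_cell ord J)"
    by (intro semialgebraic_if_basic basic_semialgebraic_Schubert_cell)
  have cube: "basic_semialgebraic {z. if A then 0 < x z \<and> x z < 1 else x z = 0}"
    if "real_polynomial_function x" for A and x :: "'z::euclidean_space \<Rightarrow> real"
    using that
    by (cases A) (auto intro!: basic_semialgebraic_conj basic_semialgebraic_less
        basic_semialgebraic_eq real_polynomial_function_basic)
  have "open_cube (coordinate_axes ?R) = {x :: real ^ 'm ^ 'm ^ 'n. \<forall>i r c.
      if (i, r, c) \<in> ?R then 0 < x $ i $ r $ c \<and> x $ i $ r $ c < 1 else x $ i $ r $ c = 0}"
    using mem_open_cube_coordinate_axes by blast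
  then show "semialgebraic (open_cube (coordinate_axes ?R) :: (real ^ 'm ^ 'm ^ 'n) set)"
    by (simp only:) (intro semialgebraic_if_basic basic_semialgebraic_all cube
        real_polynomial_function_entry)
  show "homeomorphism (Schubert_cell ord J) (open_cube (coordinate_axes ?R))
      (cell_to_cube ord J) (cube_to_cell ord J)"
    by (rule homeomorphism_Schubert_cell)
  have \<Phi>: "real_polynomial_function (\<lambda>z :: (real ^ 'm ^ 'm ^ 'n) \<times> (real ^ 'm ^ 'm ^ 'n). fst z $ i $ r $ c)"
    and x: "real_polynomial_function (\<lambda>z :: (real ^ 'm ^ 'm ^ 'n) \<times> (real ^ 'm ^ 'm ^ 'n). snd z $ i $ r $ c)"
    for i r c
    by (rule real_polynomial_function_compose_linear [OF real_polynomial_function_entry],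
        rule bounded_linear_fst bounded_linear_snd)+
  have den: "real_polynomial_function
      (\<lambda>z :: (real ^ 'm ^ 'm ^ 'n) \<times> (real ^ 'm ^ 'm ^ 'n). stretch_denominator R (snd z))" for R
    unfolding stretch_denominator_def case_prod_unfold
    by (intro real_polynomial_function_basic x) simp
  have num: "real_polynomial_function
      (\<lambda>z :: (real ^ 'm ^ 'm ^ 'n) \<times> (real ^ 'm ^ 'm ^ 'n). stretch_numerator R (snd z) i $ r $ c)" for R i r c
    unfolding stretch_numerator_def vec_lambda_beta
    by (cases "(i, r, c) \<in> R") (auto intro!: real_polynomial_function_basic x den)
  show "semialgebraic ((\<lambda>\<Phi>. (\<Phi>, cell_to_cube ord J \<Phi>)) ` Schubert_cell ord J)"
    unfolding graph_Schubert_cell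
  proof (intro semialgebraic_if_basic basic_semialgebraic_conj basic_semialgebraic_all
      basic_semialgebraic_Grassmannian cube \<Phi> x basic_semialgebraic_eq
      real_polynomial_function_matrix_mult)
    show "real_polynomial_function (\<lambda>z :: (real ^ 'm ^ 'm ^ 'n) \<times> (real ^ 'm ^ 'm ^ 'n).
        stretch_denominator ?R (snd z) * fst z $ i $ r $ c)" for i r c
      by (intro real_polynomial_function_basic den \<Phi>)
    show "real_polynomial_function (\<lambda>z :: (real ^ 'm ^ 'm ^ 'n) \<times> (real ^ 'm ^ 'm ^ 'n).
        (stretch_denominator ?R (snd z) *\<^sub>R coord_proj (J i) + transpose (stretch_numerator ?R (snd z) i)) $ r $ c)"
      for i r c
      unfolding vector_add_component vector_scaleR_component transpose_def vec_lambda_beta real_scaleR_def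
      by (intro real_polynomial_function_basic den num)
  qed
qed

lemma Schubert_cell_nonempty: "Schubert_cell ord J \<noteq> ({} :: (real ^ 'm::finite ^ 'm ^ 'n::finite) set)"
proof
  assume "Schubert_cell ord J = ({} :: (real ^ 'm ^ 'm ^ 'n) set)"
  then have "open_cube (coordinate_axes (Schubert_entries ord J)) = ({} :: (real ^ 'm ^ 'm ^ 'n) set)"
    using homeomorphism_Schubert_cell [of ord J] by (auto simp: homeomorphism_def)
  then show False
    using open_cube_nonempty [OF coordinate_axes_subset_Basis] by blast
qed

lemma cell_decomposition_Grassmannian_product:
  fixes k :: "'n::finite \<Rightarrow> nat"
  assumes "inj ord"
  shows "cell_decomposition (Grassmannian_product k :: (real ^ 'm::finite ^ 'm ^ 'n) set)
    (Schubert_cell ord ` {J. \<forall>i. card (J i) = k i})"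
  unfolding cell_decomposition_def
proof (intro conjI)
  let ?Js = "{J :: 'n \<Rightarrow> 'm set. \<forall>i. card (J i) = k i}"
  show "finite (Schubert_cell ord ` ?Js :: (real ^ 'm ^ 'm ^ 'n) set set)"
    by simp
  show "\<forall>C\<in>(Schubert_cell ord ` ?Js :: (real ^ 'm ^ 'm ^ 'n) set set). \<exists>d. semialgebraic_cell d C"
    using semialgebraic_cell_Schubert_cell by blast
  show "partition_on (Grassmannian_product k :: (real ^ 'm ^ 'm ^ 'n) set) (Schubert_cell ord ` ?Js)"
  proof (rule partition_onI)
    show "{} \<notin> (Schubert_cell ord ` ?Js :: (real ^ 'm ^ 'm ^ 'n) set set)"
      by (auto simp: Schubert_cell_nonempty [symmetric])
    show "disjnt C C'" if C: "C \<in> Schubert_cell ord ` ?Js" "C' \<in> Schubert_cell ord ` ?Js" "C \<noteq> C'"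
      for C C' :: "(real ^ 'm ^ 'm ^ 'n) set"
    proof -
      obtain J J' where J: "C = Schubert_cell ord J" "C' = Schubert_cell ord J'"
        using C by blast
      have "J = J'" if "\<Phi> \<in> C" "\<Phi> \<in> C'" for \<Phi>
      proof
        fix i
        show "J i = J' i"
          using Schubert_cell_unique [of "\<Phi> $ i" "J i" "J' i" ord] that
          unfolding J Schubert_cell_def by blast
      qed
      then show ?thesis
        using C(3) J unfolding disjnt_iff by blast
    qed
    show "\<Union> (Schubert_cell ord ` ?Js) = (Grassmannian_product k :: (real ^ 'm ^ 'm ^ 'n) set)"
    proof (intro equalityI subsetI)
      fix \<Phi> :: "real ^ 'm ^ 'm ^ 'n"
      assume "\<Phi> \<in> \<Union> (Schubert_cell ord ` ?Js)"
      then show "\<Phi> \<in> Grassmannian_product k"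
        by (auto simp: Schubert_cell_def Grassmannian_product_def)
    next
      fix \<Phi> :: "real ^ 'm ^ 'm ^ 'n"
      assume \<Phi>: "\<Phi> \<in> Grassmannian_product k"
      then have "\<forall>i. \<exists>J. card J = k i \<and> in_Schubert_cell ord J (\<Phi> $ i)"
        using Schubert_cell_exists [OF _ assms] unfolding Grassmannian_product_def by blast
      from choice [OF this] obtain J where "\<And>i. card (J i) = k i" "\<And>i. in_Schubert_cell ord (J i) (\<Phi> $ i)"
        by blast
      then show "\<Phi> \<in> \<Union> (Schubert_cell ord ` ?Js)"
        using \<Phi> by (auto simp: Schubert_cell_def Grassmannian_product_def)
    qed
  qed
qed

text \<open>The cell in which the pivots are the first indices is given by all entries of the charts.\<close>

lemma semialgebraic_dim_Grassmannian_product_ge: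
  fixes k :: "'n::finite \<Rightarrow> nat"
  assumes k: "\<And>i. k i \<le> CARD('m::finite)"
  shows "ereal (real (\<Sum>i\<in>UNIV. (CARD('m) - k i) * k i))
    \<le> semialgebraic_dim (Grassmannian_product k :: (real ^ 'm ^ 'm ^ 'n) set)"
proof -
  obtain ord :: "'m \<Rightarrow> nat" where ord: "bij_betw ord UNIV {0..<CARD('m)}"
    using ex_bij_betw_finite_nat [of "UNIV :: 'm set"] by auto
  then have inj: "inj ord" by (simp add: bij_betw_def)
  define J where "J i = {c. ord c < k i}" for i
  have card: "card (J i) = k i" for i
  proof -
    have "ord ` J i = {0..<k i}"
    proof (intro equalityI subsetI)
      fix n assume n: "n \<in> {0..<k i}"
      then have "n \<in> ord ` UNIV"
        using ord k [of i] by (simp add: bij_betw_def)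
      with n show "n \<in> ord ` J i"
        by (auto simp: J_def)
    qed (auto simp: J_def)
    then show ?thesis
      using card_image [OF inj_on_subset [OF inj], of "J i"] by simp
  qed
  have "Schubert_entries ord J = chart_entries J"
    by (auto simp: Schubert_entries_def chart_entries_def J_def)
  then have "semialgebraic_cell (\<Sum>i\<in>UNIV. (CARD('m) - k i) * k i) (Schubert_cell ord J)"
    using semialgebraic_cell_Schubert_cell [of ord J] card_chart_entries [of J k] card by simp
  moreover have "Schubert_cell ord J \<in> Schubert_cell ord ` {J. \<forall>i. card (J i) = k i}"
    using card by blast
  ultimately show ?thesis
    unfolding semialgebraic_dim_def
    using cell_decomposition_Grassmannian_product [OF inj, of k]
    by (intro Sup_upper) blast
qed

text \<open>A cell of full dimension would give \<open>S\<close> interior points in the product.\<close>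

lemma semialgebraic_dim_le:
  fixes S :: "(real ^ 'm::finite ^ 'm ^ 'n::finite) set"
  assumes S: "S \<subseteq> Grassmannian_product k"
    and interior: "\<And>V. open V \<Longrightarrow> V \<inter> Grassmannian_product k \<noteq> {} \<Longrightarrow> \<not> V \<inter> Grassmannian_product k \<subseteq> S"
  shows "semialgebraic_dim S \<le> ereal (real (\<Sum>i\<in>UNIV. (CARD('m) - k i) * k i) - 1)"
  unfolding semialgebraic_dim_def
proof (rule Sup_least)
  fix e assume "e \<in> {ereal (real d) | d. \<exists>D. cell_decomposition S D \<and> (\<exists>C\<in>D. semialgebraic_cell d C)}"
  then obtain d D C where e: "e = ereal (real d)" and "cell_decomposition S D" "C \<in> D"
    and C: "semialgebraic_cell d C"
    by blast
  then have CS: "C \<subseteq> S"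
    unfolding cell_decomposition_def partition_on_def by blast
  have "\<not> (\<Sum>i\<in>UNIV. (CARD('m) - k i) * k i) \<le> d"
    using semialgebraic_cell_interior [OF subset_trans [OF CS S] C] interior CS by blast
  then have "real d \<le> real (\<Sum>i\<in>UNIV. (CARD('m) - k i) * k i) - 1"
    by linarith
  then show "e \<le> ereal (real (\<Sum>i\<in>UNIV. (CARD('m) - k i) * k i) - 1)"
    by (simp add: e)
qed

section \<open>Injectivity for a generic tuple of projections\<close>

theorem theorem1p4:
  fixes k :: "'n::finite \<Rightarrow> nat"
  assumes "CARD('n) \<ge> 2 * CARD('m::finite) - 1"
    and "\<And>i. 1 \<le> k i \<and> k i \<le> CARD('m) - 1"
  shows "\<exists>U :: (real ^ 'm ^ 'm ^ 'n) set.
           Zariski_openin (Grassmannian_product k) U \<and> U \<noteq> {} \<and>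
           semialgebraic_dim (Grassmannian_product k - U)
             < semialgebraic_dim (Grassmannian_product k :: (real ^ 'm ^ 'm ^ 'n) set) \<and>
           (\<forall>\<Phi>\<in>U. inj_on (measurement_map \<Phi>) nonzero_mod_sign)"
proof -
  let ?X = "Grassmannian_product k :: (real ^ 'm ^ 'm ^ 'n) set"
  let ?d = "\<Sum>i\<in>UNIV. (CARD('m) - k i) * k i"
  obtain Z :: "(real ^ 'm ^ 'm ^ 'n) set" where Z: "Zariski_closed Z"
    "\<And>V. open V \<Longrightarrow> V \<inter> ?X \<noteq> {} \<Longrightarrow> \<not> V \<inter> ?X \<subseteq> Z"
    "\<And>\<Phi>. \<Phi> \<in> ?X - Z \<Longrightarrow> inj_on (measurement_map \<Phi>) nonzero_mod_sign"
    by (rule generic_injectivity [where k = k, OF assms]) blast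
  have ge: "ereal (real ?d) \<le> semialgebraic_dim ?X"
  proof (rule semialgebraic_dim_Grassmannian_product_ge)
    show "k i \<le> CARD('m)" for i
      using assms(2) [of i] by linarith
  qed
  have "?X - (?X - Z) = ?X \<inter> Z" by blast
  then have "semialgebraic_dim (?X - (?X - Z)) \<le> ereal (real ?d - 1)"
    using semialgebraic_dim_le [of "?X \<inter> Z" k] Z(2) by simp
  also have "\<dots> < ereal (real ?d)"
    by simp
  also note ge
  finally have "semialgebraic_dim (?X - (?X - Z)) < semialgebraic_dim ?X" .
  moreover have "?X - Z \<noteq> {}"
  proof -
    have "?X \<noteq> {}"
    proof
      assume "?X = {}"
      then have "semialgebraic_dim ?X \<le> ereal (real ?d - 1)"
        by (intro semialgebraic_dim_le) auto
      then have "ereal (real ?d) \<le> ereal (real ?d - 1)"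
        using ge order_trans by blast
      then show False by simp
    qed
    then show ?thesis
      using Z(2) [of UNIV] by blast
  qed
  ultimately show ?thesis
    using Z(1,3) unfolding Zariski_openin_def by (intro exI [of _ "?X - Z"]) blast
qed

end
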